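(* Let $q$ be a prime power, let $1\le\ell<k<n$ be integers, let $0\le\alpha\le1$ and $0<\gamma\le1$, and put $a=k-\ell$ and $d=n-\ell$. Let $\mathcal B$ be a family of affine $\ell$-flats in $\mathbb F_q^n$, of density $p_{\mathcal B}$ among all affine $\ell$-flats in $\mathbb F_q^n$. Suppose that (at least) an $\alpha$-fraction of the containment flags $$(W,U)\in\mathcal G_\ell(n)\times\mathcal G_k(n),\qquad W\subset U,$$ admit an affine translate of $U$ containing at least $\gamma q^a$ members of $\mathcal B$ parallel to $W$. Then $$p_{\mathcal B}\ge\alpha\max\left\{\left(\frac{\gamma}{1+q^{1-a}}\right)^d,\ \frac{\gamma}{4}\exp\!\left(-\frac{8d}{\gamma q^{a-1}}\right)\right\},$$ where the second expression is omitted from the maximum unless $\gamma q^{a-1}\ge8$.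
   Context: An affine $r$-flat in $\mathbb F_q^n$ is a translate of an $r$-dimensional linear subspace; that subspace is its direction. $\mathcal G_r(n)$ denotes the set of $r$-dimensional linear subspaces of $\mathbb F_q^n$. An affine $\ell$-flat is parallel to $W\in\mathcal G_\ell(n)$ if its direction is $W$, i.e. it is a translate of $W$. *)

theory Defs
  imports "HOL-Analysis.Analysis"
begin

definition grassmannian :: "nat \<Rightarrow> ('a::field ^ 'n) set set" where
  "grassmannian r = {W. vec.subspace W \<and> vec.dim W = r}"

definition translate_of :: "('a::field ^ 'n) set \<Rightarrow> ('a ^ 'n) set \<Rightarrow> bool" where
  "translate_of A W \<longleftrightarrow> (\<exists>v. A = (+) v ` W)"

definition affine_flats :: "nat \<Rightarrow> ('a::field ^ 'n) set set" where
  "affine_flats r = {A. \<exists>W \<in> grassmannian r. translate_of A W}"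

definition flat_density :: "nat \<Rightarrow> ('a::{field,finite} ^ 'n) set set \<Rightarrow> real" where
  "flat_density r B = real (card B) / real (card (affine_flats r :: ('a ^ 'n) set set))"

definition containment_flags ::
    "nat \<Rightarrow> nat \<Rightarrow> (('a::field ^ 'n) set \<times> ('a ^ 'n) set) set" where
  "containment_flags l k = {(W, U). W \<in> grassmannian l \<and> U \<in> grassmannian k \<and> W \<subset> U}"

text \<open>For \<open>W\<close> a linear subspace, the flats parallel to \<open>W\<close> are exactly its translates.\<close>

definition rich_flag ::
    "('a::field ^ 'n) set set \<Rightarrow> real \<Rightarrow> ('a ^ 'n) set \<Rightarrow> ('a ^ 'n) set \<Rightarrow> bool" where
  "rich_flag B t W U \<longleftrightarrow>
     (\<exists>X. translate_of X U \<and> real (card {A \<in> B. translate_of A W \<and> A \<subseteq> X}) \<ge> t)"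

end

theory Submission
  imports Defs "HOL-Algebra.Algebraic_Closure_Type" "HOL-Library.Function_Algebras"
begin

text \<open>
Divide by \<open>W\<close>. The members of \<open>B\<close> parallel to \<open>W\<close> become a set \<open>E\<close> of points of \<open>F\<^sup>d\<close>, where
\<open>F\<close> is the field with \<open>q\<close> elements; a \<open>k\<close>-dimensional space above \<open>W\<close> becomes an
\<open>a\<close>-dimensional direction \<open>S\<close>; and the flag is rich if some translate of \<open>S\<close> has at least
\<open>\<gamma> q\<^sup>a\<close> points in \<open>E\<close>. What has to be shown is a Furstenberg-type estimate: many rich directions
force \<open>E\<close> to be large. It must be linear in the fraction of rich directions, for only then can it be
averaged over \<open>W\<close>.

The estimate is proved by the polynomial method with multiplicities. Give the points of \<open>E\<close> a
multiplicity \<open>m1\<close> and all other points of \<open>F\<^sup>d\<close> a smaller background multiplicity \<open>m0\<close>, and consider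
the polynomials of degree at most \<open>N\<close> that vanish to these orders. Let \<open>K\<close> be the extension of \<open>F\<close>
of degree \<open>a\<close>. A point \<open>z\<close> of \<open>K\<^sup>d\<close> parametrizes the direction of all vectors \<open>tr (z y)\<close>, \<open>y\<close> in
\<open>K\<close>; the parametrization is polynomial in \<open>y\<close>, of degree \<open>q\<^bsup>a-1\<^esup>\<close>, with leading coefficient a
Frobenius image of \<open>z\<close>. Restricting a polynomial of the system to a rich translate thus gives a
polynomial in one variable with too many zeros, and its leading coefficient, a value of the top
homogeneous part, has to vanish: the top form of the polynomial vanishes to some order \<open>m\<close> at the
Frobenius image of every point that parametrizes a rich direction (\<open>top_vanishing\<close>). Points that
parametrize an \<open>a\<close>-dimensional direction fill all but at most a fraction \<open>1/q\<close> of \<open>K\<^sup>d\<close>, so the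
Schwartz--Zippel lemma with multiplicities (\<open>schwartz_zippel_mult\<close>) shows that no nonzero form of
degree less than \<open>m (q\<^sup>a - q\<^bsup>a-1\<^esup>)\<close> vanishes to order \<open>m\<close> at all of them
(\<open>forms_vanishing_generic\<close>).

Linearity in the number of rich directions comes from submodularity. Impose the conditions
belonging to the directions one after the other, and let the weight of a direction be the drop in
dimension that it causes; any subfamily of directions then causes a drop of at least the sum of its
weights (\<open>chain_weights\<close>). Comparing with the polynomials that vanish to order \<open>m0\<close> everywhere,
the total weight of the rich directions is at most \<open>card E\<close> times the number of additional
conditions per point, while the weight of all directions is at least the number of monomials minus
the number of background conditions (\<open>direction_weights\<close>). Averaging over the general linear group
of the whole space, which is transitive on flags and on \<open>l\<close>-dimensional subspaces, replaces the
weight of the rich directions by at least the fraction \<open>\<alpha>\<close> of the total weight, and replaces \<open>card E\<close> by the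
density of \<open>B\<close> (\<open>averaged_bound\<close>).

Finally let \<open>m0\<close>, \<open>m1\<close>, \<open>m\<close>, \<open>N\<close> grow in proportion. With \<open>\<mu>0\<close> and \<open>\<mu>1\<close> the limits of the scaled
multiplicities and \<open>p\<close> the density, the result is
\<open>\<alpha> (((\<mu>0 + \<gamma> (\<mu>1 - \<mu>0)) / (1 + q\<^bsup>1-a\<^esup>))\<^sup>d - \<mu>0\<^sup>d) \<le> p (\<mu>1\<^sup>d - \<mu>0\<^sup>d)\<close>
(\<open>multiplicity_limit\<close>). No background multiplicity, \<open>\<mu>0 = 0\<close>, gives the first bound. With
\<open>\<mu>0 = 1\<close> and \<open>\<mu>1\<close> only slightly larger the powers behave like exponentials, so that the factor
\<open>\<gamma>\<close> is lost once instead of \<open>d\<close> times, and this gives the second bound (\<open>two_bounds\<close>).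
\<close>

hide_const (open) Polynomials.degree up_ring.coeff up_ring.monom Polynomials.lead_coeff Coset.order

section \<open>Multivariate polynomials, Hasse derivatives and the Schwartz--Zippel lemma with multiplicities\<close>

definition tdeg :: "('i::finite \<Rightarrow> nat) \<Rightarrow> nat" where
  "tdeg \<alpha> = (\<Sum>i\<in>UNIV. \<alpha> i)"

definition monomial :: "('i::finite \<Rightarrow> 'r::comm_ring_1) \<Rightarrow> ('i \<Rightarrow> nat) \<Rightarrow> 'r" where
  "monomial x \<alpha> = (\<Prod>i\<in>UNIV. x i ^ \<alpha> i)"

definition exponents :: "'i::finite set \<Rightarrow> nat \<Rightarrow> ('i \<Rightarrow> nat) set" where
  "exponents I k = {\<alpha>. (\<forall>i. i \<notin> I \<longrightarrow> \<alpha> i = 0) \<and> tdeg \<alpha> \<le> k}"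

text \<open>
A polynomial is its function of coefficients, indexed by exponent vectors over a finite type of
variables. The predicate says that only the variables in \<open>I\<close> occur and that the total degree is at
most \<open>k\<close>; the set of variables is a parameter because the number of variables of interest,
\<open>d\<close>, is not the size of a type, and because the induction in \<open>schwartz_zippel_mult\<close> runs over it.
\<close>
definition mpoly :: "'i::finite set \<Rightarrow> nat \<Rightarrow> (('i \<Rightarrow> nat) \<Rightarrow> 'r::zero) \<Rightarrow> bool" where
  "mpoly I k c \<longleftrightarrow> (\<forall>\<alpha>. c \<alpha> \<noteq> 0 \<longrightarrow> \<alpha> \<in> exponents I k)"

definition eval_mp :: "(('i::finite \<Rightarrow> nat) \<Rightarrow> 'r::comm_ring_1) \<Rightarrow> ('i \<Rightarrow> 'r) \<Rightarrow> 'r" where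
  "eval_mp c x = (\<Sum>\<alpha> | c \<alpha> \<noteq> 0. c \<alpha> * monomial x \<alpha>)"

text \<open>
The Hasse derivative: the coefficient of \<open>z\<^sup>\<beta>\<close> in \<open>c (x + z)\<close>, as a polynomial in \<open>x\<close>. Ordinary
derivatives would lose information in positive characteristic.
\<close>
definition hasse :: "('i::finite \<Rightarrow> nat) \<Rightarrow> (('i \<Rightarrow> nat) \<Rightarrow> 'r::comm_ring_1) \<Rightarrow> ('i \<Rightarrow> nat) \<Rightarrow> 'r" where
  "hasse \<beta> c = (\<lambda>\<delta>. of_nat (\<Prod>i\<in>UNIV. (\<beta> i + \<delta> i) choose \<beta> i) * c (\<lambda>i. \<beta> i + \<delta> i))"

definition vanishes :: "(('i::finite \<Rightarrow> nat) \<Rightarrow> 'r::comm_ring_1) \<Rightarrow> ('i \<Rightarrow> 'r) \<Rightarrow> nat \<Rightarrow> bool" where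
  "vanishes c x M \<longleftrightarrow> (\<forall>\<beta>. tdeg \<beta> < M \<longrightarrow> eval_mp (hasse \<beta> c) x = 0)"

definition hom_part :: "nat \<Rightarrow> (('i::finite \<Rightarrow> nat) \<Rightarrow> 'r::zero) \<Rightarrow> ('i \<Rightarrow> nat) \<Rightarrow> 'r" where
  "hom_part k c = (\<lambda>\<alpha>. if tdeg \<alpha> = k then c \<alpha> else 0)"

lemma le_tdeg: "\<alpha> i \<le> tdeg \<alpha>"
  unfolding tdeg_def by (rule member_le_sum) auto

lemma tdeg_zero [simp]: "tdeg (\<lambda>i. 0) = 0"
  by (simp add: tdeg_def)

lemma tdeg_eq_0: "tdeg \<alpha> = 0 \<longleftrightarrow> \<alpha> = (\<lambda>i. 0)"
  by (auto simp: tdeg_def fun_eq_iff)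

lemma tdeg_add: "tdeg (\<lambda>i. \<alpha> i + \<beta> i) = tdeg \<alpha> + tdeg \<beta>"
  by (simp add: tdeg_def sum.distrib)

lemma tdeg_upd: "\<alpha> v = 0 \<Longrightarrow> tdeg (\<alpha>(v := r)) = tdeg \<alpha> + r"
  unfolding tdeg_def by (subst (1 2) sum.remove[of UNIV v]) auto

lemma finite_exponents [simp, intro]: "finite (exponents I k)"
proof (rule finite_subset)
  show "exponents I k \<subseteq> PiE UNIV (\<lambda>i. {..k})"
    by (auto simp: exponents_def intro: order_trans[OF le_tdeg])
qed (auto intro!: finite_PiE)

lemma exponents_mono: "I \<subseteq> J \<Longrightarrow> k \<le> l \<Longrightarrow> exponents I k \<subseteq> exponents J l"
  by (auto simp: exponents_def)

lemma mpoly_mono: "mpoly I k c \<Longrightarrow> I \<subseteq> J \<Longrightarrow> k \<le> l \<Longrightarrow> mpoly J l c"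
  using exponents_mono unfolding mpoly_def by blast

lemma eval_mp_eq: "mpoly I k c \<Longrightarrow> eval_mp c x = (\<Sum>\<alpha>\<in>exponents I k. c \<alpha> * monomial x \<alpha>)"
  unfolding eval_mp_def by (rule sum.mono_neutral_left) (auto simp: mpoly_def)

lemma mpoly_hom_part: "mpoly I k c \<Longrightarrow> mpoly I k (hom_part j c)"
  by (auto simp: mpoly_def hom_part_def split: if_splits)

lemma mpoly_hasse: "mpoly I k c \<Longrightarrow> mpoly I (k - tdeg \<beta>) (hasse \<beta> c)"
  unfolding mpoly_def
proof (intro allI impI)
  fix \<delta> assume c: "\<forall>\<alpha>. c \<alpha> \<noteq> 0 \<longrightarrow> \<alpha> \<in> exponents I k" and "hasse \<beta> c \<delta> \<noteq> 0"
  then have "c (\<lambda>i. \<beta> i + \<delta> i) \<noteq> 0" by (intro notI) (simp add: hasse_def)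
  with c have "(\<lambda>i. \<beta> i + \<delta> i) \<in> exponents I k" by blast
  then show "\<delta> \<in> exponents I (k - tdeg \<beta>)" by (auto simp: exponents_def tdeg_add)
qed

lemma mpoly_hasse': "mpoly I k c \<Longrightarrow> mpoly I k (hasse \<beta> c)"
  using mpoly_hasse mpoly_mono by (metis diff_le_self order_refl)

lemma monomial_add:
  "monomial (\<lambda>i. u i + z i) \<alpha> =
     (\<Sum>\<beta> | \<forall>i. \<beta> i \<le> \<alpha> i. of_nat (\<Prod>i\<in>UNIV. \<alpha> i choose \<beta> i) * monomial u (\<lambda>i. \<alpha> i - \<beta> i) * monomial z \<beta>)"
proof -
  have "monomial (\<lambda>i. u i + z i) \<alpha> = (\<Prod>i\<in>UNIV. \<Sum>b\<le>\<alpha> i. of_nat (\<alpha> i choose b) * z i ^ b * u i ^ (\<alpha> i - b))"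
    unfolding monomial_def by (subst add.commute, subst binomial_ring) simp
  also have "\<dots> = (\<Sum>\<beta>\<in>PiE UNIV (\<lambda>i. {..\<alpha> i}). \<Prod>i\<in>UNIV. of_nat (\<alpha> i choose \<beta> i) * z i ^ \<beta> i * u i ^ (\<alpha> i - \<beta> i))"
    by (rule prod_sum_PiE) auto
  also have "PiE UNIV (\<lambda>i. {..\<alpha> i}) = {\<beta>. \<forall>i. \<beta> i \<le> \<alpha> i}"
    by (auto simp: PiE_def Pi_def)
  finally show ?thesis
    by (simp add: monomial_def prod.distrib mult_ac)
qed

text \<open>
Valid over every commutative ring; it is applied over a ring of univariate polynomials.
\<close>
lemma taylor:
  fixes c :: "('i::finite \<Rightarrow> nat) \<Rightarrow> 'r::comm_ring_1"
  assumes "mpoly UNIV k c"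
  shows "eval_mp c (\<lambda>i. u i + z i) = (\<Sum>\<beta>\<in>exponents UNIV k. eval_mp (hasse \<beta> c) u * monomial z \<beta>)"
proof -
  let ?M = "exponents UNIV k :: ('i \<Rightarrow> nat) set"
  let ?f = "\<lambda>\<beta> \<delta>. of_nat (\<Prod>i\<in>UNIV. (\<beta> i + \<delta> i) choose \<beta> i) * c (\<lambda>i. \<beta> i + \<delta> i) * monomial u \<delta> * monomial z \<beta>"
  let ?B = "\<lambda>\<alpha>. {\<beta> :: 'i \<Rightarrow> nat. \<forall>i. \<beta> i \<le> \<alpha> i}"
  have fB: "finite (?B \<alpha>)" for \<alpha>
    by (rule finite_subset[OF _ finite_exponents[of UNIV "tdeg \<alpha>"]]) (auto simp: exponents_def tdeg_def intro: sum_mono)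
  have "eval_mp c (\<lambda>i. u i + z i) = (\<Sum>\<alpha>\<in>?M. \<Sum>\<beta>\<in>?B \<alpha>. c \<alpha> * (of_nat (\<Prod>i\<in>UNIV. \<alpha> i choose \<beta> i) * monomial u (\<lambda>i. \<alpha> i - \<beta> i) * monomial z \<beta>))"
    by (simp add: eval_mp_eq[OF assms] monomial_add sum_distrib_left)
  also have "\<dots> = (\<Sum>(\<alpha>,\<beta>)\<in>Sigma ?M ?B. c \<alpha> * (of_nat (\<Prod>i\<in>UNIV. \<alpha> i choose \<beta> i) * monomial u (\<lambda>i. \<alpha> i - \<beta> i) * monomial z \<beta>))"
    by (rule sum.Sigma) (auto simp: fB)
  also have "\<dots> = (\<Sum>(\<beta>,\<delta>)\<in>{(\<beta>,\<delta>). (\<lambda>i. \<beta> i + \<delta> i) \<in> ?M}. ?f \<beta> \<delta>)"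
    by (rule sum.reindex_bij_witness[of _ "\<lambda>(\<beta>,\<delta>). ((\<lambda>i. \<beta> i + \<delta> i), \<beta>)" "\<lambda>(\<alpha>,\<beta>). (\<beta>, \<lambda>i. \<alpha> i - \<beta> i)"])
       (auto simp: fun_eq_iff mult_ac)
  also have "\<dots> = (\<Sum>(\<beta>,\<delta>)\<in>?M \<times> ?M. ?f \<beta> \<delta>)"
  proof (rule sum.mono_neutral_left)
    show "\<forall>p\<in>?M \<times> ?M - {(\<beta>, \<delta>). (\<lambda>i. \<beta> i + \<delta> i) \<in> ?M}. (case p of (\<beta>, \<delta>) \<Rightarrow> ?f \<beta> \<delta>) = 0"
    proof (intro ballI)
      fix p assume "p \<in> ?M \<times> ?M - {(\<beta>, \<delta>). (\<lambda>i. \<beta> i + \<delta> i) \<in> ?M}"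
      then have "(\<lambda>i. fst p i + snd p i) \<notin> ?M" by auto
      then have "c (\<lambda>i. fst p i + snd p i) = 0" using assms unfolding mpoly_def by blast
      then show "(case p of (\<beta>, \<delta>) \<Rightarrow> ?f \<beta> \<delta>) = 0" by (simp add: case_prod_unfold)
    qed
  qed (simp, auto simp: exponents_def tdeg_add)
  also have "\<dots> = (\<Sum>\<beta>\<in>?M. \<Sum>\<delta>\<in>?M. ?f \<beta> \<delta>)"
    by (rule sum.cartesian_product[symmetric])
  also have "\<dots> = (\<Sum>\<beta>\<in>?M. eval_mp (hasse \<beta> c) u * monomial z \<beta>)"
    unfolding eval_mp_eq[OF mpoly_hasse'[OF assms]] by (simp add: hasse_def sum_distrib_right)
  finally show ?thesis .
qed

text \<open>
Iterated Hasse derivatives are multiples of Hasse derivatives, hence derivation by \<open>\<beta>\<close> lowers the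
order of vanishing by at most the total degree of \<open>\<beta>\<close>.
\<close>
lemma hasse_hasse:
  "hasse \<gamma> (hasse \<beta> c) = (\<lambda>\<delta>. of_nat (\<Prod>i\<in>UNIV. (\<beta> i + \<gamma> i) choose \<beta> i) * hasse (\<lambda>i. \<beta> i + \<gamma> i) c \<delta>)"
proof
  fix \<delta>
  have *: "((b + (g + d)) choose b) * ((g + d) choose g) = ((b + g + d) choose (b + g)) * ((b + g) choose b)" for b g d :: nat
    using choose_mult[of b "b + g" "b + g + d"] by (simp add: add.assoc)
  have "hasse \<gamma> (hasse \<beta> c) \<delta> =
     of_nat (\<Prod>i\<in>UNIV. ((\<beta> i + (\<gamma> i + \<delta> i)) choose \<beta> i) * ((\<gamma> i + \<delta> i) choose \<gamma> i)) * c (\<lambda>i. \<beta> i + (\<gamma> i + \<delta> i))"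
    by (simp add: hasse_def prod.distrib mult_ac)
  also have "\<dots> = of_nat (\<Prod>i\<in>UNIV. (\<beta> i + \<gamma> i) choose \<beta> i) * hasse (\<lambda>i. \<beta> i + \<gamma> i) c \<delta>"
    unfolding * by (simp add: hasse_def prod.distrib mult_ac add.assoc)
  finally show "hasse \<gamma> (hasse \<beta> c) \<delta> = \<dots>" .
qed

lemma eval_mp_scale:
  assumes "mpoly I k c"
  shows "eval_mp (\<lambda>\<alpha>. b * c \<alpha>) x = b * eval_mp c x"
proof -
  have "mpoly I k (\<lambda>\<alpha>. b * c \<alpha>)" using assms unfolding mpoly_def by (metis mult_zero_right)
  then show ?thesis by (simp add: eval_mp_eq[OF assms] eval_mp_eq sum_distrib_left mult_ac)
qed

lemma vanishes_hasse:
  assumes "mpoly I k c" "vanishes c x M"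
  shows "vanishes (hasse \<beta> c) x (M - tdeg \<beta>)"
  unfolding vanishes_def
proof (intro allI impI)
  fix \<gamma> :: "'a \<Rightarrow> nat" assume "tdeg \<gamma> < M - tdeg \<beta>"
  then have "eval_mp (hasse (\<lambda>i. \<beta> i + \<gamma> i) c) x = 0"
    using assms(2) by (auto simp: vanishes_def tdeg_add)
  then show "eval_mp (hasse \<gamma> (hasse \<beta> c)) x = 0"
    unfolding hasse_hasse by (subst eval_mp_scale[OF mpoly_hasse[OF assms(1)]]) simp
qed

abbreviation const_mp :: "(('i \<Rightarrow> nat) \<Rightarrow> 'k::comm_ring_1) \<Rightarrow> ('i \<Rightarrow> nat) \<Rightarrow> 'k poly" where
  "const_mp c \<equiv> (\<lambda>\<alpha>. [:c \<alpha>:])"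

lemma mpoly_const_mp: "mpoly I k c \<Longrightarrow> mpoly I k (const_mp c)"
  by (simp add: mpoly_def)

lemma hasse_const_mp: "hasse \<beta> (const_mp c) = const_mp (hasse \<beta> c)"
  by (simp add: hasse_def fun_eq_iff of_nat_poly)

lemma eval_mp_const_mp_const: "eval_mp (const_mp c) (\<lambda>i. [:u i:]) = [:eval_mp c u:]"
proof -
  have m: "monomial (\<lambda>i. [:u i:]) \<alpha> = [:monomial u \<alpha>:]" for \<alpha>
  proof -
    have "(\<Prod>i\<in>A. [:f i:]) = [:\<Prod>i\<in>A. f i:]" if "finite A" for A :: "'b set" and f :: "'b \<Rightarrow> 'a"
      using that by (induction A rule: finite_induct) (auto simp: mult.commute one_pCons)
    then show ?thesis by (simp add: monomial_def poly_const_pow)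
  qed
  show ?thesis
  proof -
    have *: "(\<Sum>i\<in>A. [:f i:]) = [:\<Sum>i\<in>A. f i:]" for A :: "('b \<Rightarrow> nat) set" and f :: "('b \<Rightarrow> nat) \<Rightarrow> 'a"
      by (induction A rule: infinite_finite_induct) auto
    show ?thesis by (simp add: eval_mp_def m * mult.commute)
  qed
qed

text \<open>
Along a polynomial curve \<open>s\<close> that passes at time \<open>t\<close> through a point where \<open>c\<close> vanishes to order
\<open>M\<close>, the composition has a zero of order \<open>M\<close> at \<open>t\<close>: in the Taylor expansion around that point,
every surviving term is a product of at least \<open>M\<close> factors \<open>s i - s i (t)\<close>, each divisible by
the linear polynomial with root \<open>t\<close>.
\<close>
lemma vanishes_imp_dvd:
  fixes c :: "('i::finite \<Rightarrow> nat) \<Rightarrow> 'k::field"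
  assumes c: "mpoly UNIV k c" and v: "vanishes c (\<lambda>i. poly (s i) t) M"
  shows "[:-t, 1:] ^ M dvd eval_mp (const_mp c) s"
proof -
  define u where "u i = poly (s i) t" for i
  define z where "z i = s i - [:u i:]" for i
  have z: "[:-t, 1:] dvd z i" for i
    by (simp add: z_def u_def poly_eq_0_iff_dvd[symmetric])
  have mz: "[:-t, 1:] ^ tdeg \<beta> dvd monomial z \<beta>" for \<beta>
    unfolding tdeg_def monomial_def power_sum by (intro prod_dvd_prod dvd_power_same z)
  have "eval_mp (const_mp c) (\<lambda>i. [:u i:] + z i) = (\<Sum>\<beta>\<in>exponents UNIV k. eval_mp (hasse \<beta> (const_mp c)) (\<lambda>i. [:u i:]) * monomial z \<beta>)"
    by (rule taylor[OF mpoly_const_mp[OF c]])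
  also have "\<dots> = (\<Sum>\<beta>\<in>exponents UNIV k. [:eval_mp (hasse \<beta> c) u:] * monomial z \<beta>)"
    by (simp only: hasse_const_mp eval_mp_const_mp_const)
  finally have e: "eval_mp (const_mp c) s = (\<Sum>\<beta>\<in>exponents UNIV k. [:eval_mp (hasse \<beta> c) u:] * monomial z \<beta>)"
    by (simp add: z_def)
  have "[:-t, 1:] ^ M dvd [:eval_mp (hasse \<beta> c) u:] * monomial z \<beta>" for \<beta>
  proof (cases "tdeg \<beta> < M")
    case True
    then show ?thesis using v by (simp add: vanishes_def u_def[abs_def])
  next
    case False
    then show ?thesis by (meson mz dvd_mult dvd_trans le_imp_power_dvd not_le)
  qed
  then show ?thesis unfolding e by (intro dvd_sum) auto
qed

lemma sum_le_degree:
  fixes p :: "'k::field poly"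
  assumes "p \<noteq> 0" "finite Y" "\<And>y. y \<in> Y \<Longrightarrow> [:-y, 1:] ^ M y dvd p"
  shows "(\<Sum>y\<in>Y. M y) \<le> degree p"
proof -
  have "(\<Sum>y\<in>Y. M y) \<le> (\<Sum>y\<in>Y. order y p)"
    by (intro sum_mono) (use assms order_divides in blast)
  also have "\<dots> = (\<Sum>y\<in>{y\<in>Y. poly p y = 0}. order y p)"
    using assms by (intro sum.mono_neutral_right) (auto simp: order_root)
  also have "\<dots> \<le> (\<Sum>y | poly p y = 0. order y p)"
    by (intro sum_mono2) (use assms poly_roots_finite in auto)
  also have "\<dots> \<le> degree p" by (rule sum_order_le_degree[OF assms(1)])
  finally show ?thesis .
qed

lemma coeff_mult_top:
  fixes p q :: "'k::comm_ring_1 poly"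
  assumes "degree p \<le> a" "degree q \<le> b"
  shows "coeff (p * q) (a + b) = coeff p a * coeff q b"
proof -
  have "coeff (p * q) (a + b) = (\<Sum>i\<le>a + b. coeff p i * coeff q (a + b - i))"
    by (rule coeff_mult)
  also have "\<dots> = (\<Sum>i\<in>{a}. coeff p i * coeff q (a + b - i))"
  proof (rule sum.mono_neutral_right)
    show "\<forall>i\<in>{..a + b} - {a}. coeff p i * coeff q (a + b - i) = 0"
    proof
      fix i assume "i \<in> {..a + b} - {a}"
      then have "i > a \<or> a + b - i > b" by auto
      then show "coeff p i * coeff q (a + b - i) = 0"
        using assms by (auto simp: coeff_eq_0)
    qed
  qed auto
  finally show ?thesis by simp
qed

lemma power_top:
  fixes p :: "'k::comm_ring_1 poly"
  assumes "degree p \<le> a"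
  shows "degree (p ^ n) \<le> n * a \<and> coeff (p ^ n) (n * a) = coeff p a ^ n"
proof (induction n)
  case (Suc n)
  then show ?case using assms degree_mult_le[of p "p ^ n"] coeff_mult_top[of p a "p ^ n" "n * a"] by auto
qed auto

lemma prod_top:
  fixes p :: "'i \<Rightarrow> 'k::comm_ring_1 poly"
  assumes "finite A" "\<And>i. i \<in> A \<Longrightarrow> degree (p i) \<le> d i"
  shows "degree (prod p A) \<le> sum d A \<and> coeff (prod p A) (sum d A) = (\<Prod>i\<in>A. coeff (p i) (d i))"
  using assms
proof (induction A rule: finite_induct)
  case (insert x A)
  then show ?case
    using degree_mult_le[of "p x" "prod p A"] coeff_mult_top[of "p x" "d x" "prod p A" "sum d A"] by force
qed auto

lemma monomial_top:
  fixes s :: "'i::finite \<Rightarrow> 'k::comm_ring_1 poly"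
  assumes "\<And>i. degree (s i) \<le> e"
  shows "degree (monomial s \<alpha>) \<le> tdeg \<alpha> * e" "coeff (monomial s \<alpha>) (tdeg \<alpha> * e) = monomial (\<lambda>i. coeff (s i) e) \<alpha>"
proof -
  have *: "tdeg \<alpha> * e = (\<Sum>i\<in>UNIV. \<alpha> i * e)" by (simp add: tdeg_def sum_distrib_right)
  show "degree (monomial s \<alpha>) \<le> tdeg \<alpha> * e" "coeff (monomial s \<alpha>) (tdeg \<alpha> * e) = monomial (\<lambda>i. coeff (s i) e) \<alpha>"
    unfolding * monomial_def using prod_top[of UNIV "\<lambda>i. s i ^ \<alpha> i" "\<lambda>i. \<alpha> i * e"] power_top[OF assms]
    by auto
qed

text \<open>
The top coefficient along a curve sees only the top homogeneous part, evaluated at the vector of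
leading coefficients of the curve.
\<close>
lemma curve_top:
  fixes c :: "('i::finite \<Rightarrow> nat) \<Rightarrow> 'k::field"
  assumes c: "mpoly UNIV k c" and s: "\<And>i. degree (s i) \<le> e" and e: "e > 0"
  shows "degree (eval_mp (const_mp c) s) \<le> k * e" "coeff (eval_mp (const_mp c) s) (k * e) = eval_mp (hom_part k c) (\<lambda>i. coeff (s i) e)"
proof -
  have E: "eval_mp (const_mp c) s = (\<Sum>\<alpha>\<in>exponents UNIV k. [:c \<alpha>:] * monomial s \<alpha>)"
    by (rule eval_mp_eq[OF mpoly_const_mp[OF c]])
  have d: "degree ([:c \<alpha>:] * monomial s \<alpha>) \<le> tdeg \<alpha> * e" for \<alpha>
    using monomial_top(1)[of s e \<alpha>, OF s] by simp
  show "degree (eval_mp (const_mp c) s) \<le> k * e"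
    unfolding E
  proof (intro degree_sum_le order_trans[OF d])
    fix \<alpha> :: "'i \<Rightarrow> nat" assume "\<alpha> \<in> exponents UNIV k"
    then show "tdeg \<alpha> * e \<le> k * e" by (simp add: exponents_def)
  qed simp
  have "coeff (eval_mp (const_mp c) s) (k * e) = (\<Sum>\<alpha>\<in>exponents UNIV k. c \<alpha> * coeff (monomial s \<alpha>) (k * e))"
    by (simp add: E coeff_sum)
  also have "\<dots> = (\<Sum>\<alpha>\<in>exponents UNIV k. hom_part k c \<alpha> * monomial (\<lambda>i. coeff (s i) e) \<alpha>)"
  proof (intro sum.cong refl)
    fix \<alpha> :: "'i \<Rightarrow> nat" assume "\<alpha> \<in> exponents UNIV k"
    then have "tdeg \<alpha> \<le> k" by (auto simp: exponents_def)
    show "c \<alpha> * coeff (monomial s \<alpha>) (k * e) = hom_part k c \<alpha> * monomial (\<lambda>i. coeff (s i) e) \<alpha>"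
    proof (cases "tdeg \<alpha> = k")
      case True
      then show ?thesis using monomial_top(2)[of s e \<alpha>, OF s] by (simp add: hom_part_def)
    next
      case False
      then have "tdeg \<alpha> * e < k * e" using \<open>tdeg \<alpha> \<le> k\<close> e by simp
      then have "coeff (monomial s \<alpha>) (k * e) = 0"
        using monomial_top(1)[of s e \<alpha>, OF s] by (intro coeff_eq_0) linarith
      then show ?thesis using False by (simp add: hom_part_def)
    qed
  qed
  also have "\<dots> = eval_mp (hom_part k c) (\<lambda>i. coeff (s i) e)"
    by (rule eval_mp_eq[OF mpoly_hom_part[OF c], symmetric])
  finally show "coeff (eval_mp (const_mp c) s) (k * e) = eval_mp (hom_part k c) (\<lambda>i. coeff (s i) e)" .
qed

text \<open>
The central use of the curves: a curve that meets the zeros of \<open>c\<close> with total multiplicity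
exceeding the degree of the composition makes the composition zero, in particular its top
coefficient.
\<close>
lemma curve_vanishing:
  fixes c :: "('i::finite \<Rightarrow> nat) \<Rightarrow> 'k::field"
  assumes c: "mpoly UNIV k c" and s: "\<And>i. degree (s i) \<le> e" and e: "e > 0" and Y: "finite Y"
    and v: "\<And>y. y \<in> Y \<Longrightarrow> vanishes c (\<lambda>i. poly (s i) y) (M y)"
    and big: "k * e < (\<Sum>y\<in>Y. M y)"
  shows "eval_mp (hom_part k c) (\<lambda>i. coeff (s i) e) = 0"
proof -
  have "eval_mp (const_mp c) s = 0"
  proof (rule ccontr)
    assume "eval_mp (const_mp c) s \<noteq> 0"
    then have "(\<Sum>y\<in>Y. M y) \<le> degree (eval_mp (const_mp c) s)"
      by (rule sum_le_degree[OF _ Y]) (intro vanishes_imp_dvd[OF c] v)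
    moreover have "degree (eval_mp (const_mp c) s) \<le> k * e" by (rule curve_top(1)[OF c s e])
    ultimately show False using big by linarith
  qed
  then show ?thesis using curve_top(2)[of k c s, OF c s e] by simp
qed


definition slice :: "'i::finite \<Rightarrow> nat \<Rightarrow> (('i \<Rightarrow> nat) \<Rightarrow> 'r::zero) \<Rightarrow> ('i \<Rightarrow> nat) \<Rightarrow> 'r" where
  "slice v r c = (\<lambda>\<alpha>. if \<alpha> v = 0 then c (\<alpha>(v := r)) else 0)"

definition grid :: "'i set \<Rightarrow> 'k::zero set \<Rightarrow> ('i \<Rightarrow> 'k) set" where
  "grid I G = {x. (\<forall>i\<in>I. x i \<in> G) \<and> (\<forall>i. i \<notin> I \<longrightarrow> x i = 0)}"

lemma grid_insert_sum:
  assumes "v \<notin> I"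
  shows "(\<Sum>x\<in>grid (insert v I) G. f x) = (\<Sum>x\<in>grid I G. \<Sum>t\<in>G. f (x(v := t)))"
proof -
  have "(\<Sum>x\<in>grid I G. \<Sum>t\<in>G. f (x(v := t))) = (\<Sum>(x,t)\<in>grid I G \<times> G. f (x(v := t)))"
    by (rule sum.cartesian_product)
  also have "\<dots> = (\<Sum>x\<in>grid (insert v I) G. f x)"
    by (rule sum.reindex_bij_witness[of _ "\<lambda>x. (x(v := 0), x v)" "\<lambda>(x,t). x(v := t)"])
       (use assms in \<open>auto simp: grid_def fun_eq_iff\<close>)
  finally show ?thesis by simp
qed

lemma grid_empty: "grid {} G = {\<lambda>i. 0}"
  by (auto simp: grid_def)

lemma card_grid: "finite I \<Longrightarrow> card (grid I G) = card G ^ card I"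
proof (induction I rule: finite_induct)
  case (insert v I)
  have "card (grid (insert v I) G) = (\<Sum>x\<in>grid I G. \<Sum>t\<in>G. 1)"
    unfolding card_eq_sum by (rule grid_insert_sum[OF insert.hyps(2)])
  then show ?case using insert by simp
qed (simp add: grid_empty)

lemma finite_grid:
  assumes "finite G" shows "finite (grid (I :: 'i::finite set) G)"
proof (rule finite_subset)
  show "grid I G \<subseteq> PiE UNIV (\<lambda>i. insert 0 G)" by (auto simp: grid_def)
qed (use assms in \<open>auto intro!: finite_PiE\<close>)

lemma mpoly_slice:
  assumes "mpoly (insert v I) k c"
  shows "mpoly I (k - r) (slice v r c)"
  unfolding mpoly_def
proof (intro allI impI)
  fix \<alpha> assume "slice v r c \<alpha> \<noteq> 0"
  then have "\<alpha> v = 0" "\<alpha>(v := r) \<in> exponents (insert v I) k"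
    using assms by (auto simp: slice_def mpoly_def split: if_splits)
  then show "\<alpha> \<in> exponents I (k - r)"
    unfolding exponents_def using tdeg_upd[of \<alpha> v r] by (auto split: if_splits) metis
qed

lemma slice_hasse:
  assumes "\<beta> v = 0"
  shows "slice v r (hasse \<beta> c) = hasse \<beta> (slice v r c)"
proof
  fix \<delta>
  show "slice v r (hasse \<beta> c) \<delta> = hasse \<beta> (slice v r c) \<delta>"
  proof (cases "\<delta> v = 0")
    case True
    have "(\<Prod>i\<in>UNIV. (\<beta> i + (\<delta>(v := r)) i) choose \<beta> i) = (\<Prod>i\<in>UNIV. (\<beta> i + \<delta> i) choose \<beta> i)"
      by (rule prod.cong) (use assms in auto)
    moreover have "(\<lambda>i. \<beta> i + (\<delta>(v := r)) i) = (\<lambda>i. \<beta> i + \<delta> i)(v := r)"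
      using assms by auto
    ultimately show ?thesis using True assms
      unfolding hasse_def slice_def by simp
  next
    case False
    then show ?thesis by (simp add: slice_def hasse_def)
  qed
qed

lemma coeff_eval_mp_line:
  fixes c :: "('i::finite \<Rightarrow> nat) \<Rightarrow> 'k::field"
  assumes c: "mpoly UNIV k c"
  shows "coeff (eval_mp (const_mp c) (\<lambda>i. if i = v then [:0, 1:] else [:x i:])) r = eval_mp (slice v r c) x"
proof -
  let ?M = "exponents UNIV k :: ('i \<Rightarrow> nat) set"
  let ?y = "x(v := 1)"
  have m: "monomial (\<lambda>i. if i = v then [:0, 1:] else [:x i:]) \<alpha> = monom (monomial ?y \<alpha>) (\<alpha> v)" for \<alpha> :: "'i \<Rightarrow> nat"
  proof -
    have *: "(\<Prod>i\<in>A. [:f i:]) = [:\<Prod>i\<in>A. f i:]" if "finite A" for A :: "'i set" and f :: "'i \<Rightarrow> 'k"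
      using that by (induction A rule: finite_induct) (auto simp: mult.commute one_pCons)
    have "monomial (\<lambda>i. if i = v then [:0, 1:] else [:x i:]) \<alpha> = [:0, 1:] ^ \<alpha> v * (\<Prod>i\<in>UNIV - {v}. [:x i:] ^ \<alpha> i)"
      unfolding monomial_def by (subst prod.remove[of UNIV v]) auto
    also have "(\<Prod>i\<in>UNIV - {v}. [:x i:] ^ \<alpha> i) = [:\<Prod>i\<in>UNIV - {v}. x i ^ \<alpha> i:]"
      by (simp add: poly_const_pow *)
    also have "(\<Prod>i\<in>UNIV - {v}. x i ^ \<alpha> i) = monomial ?y \<alpha>"
      unfolding monomial_def prod.remove[of UNIV v "\<lambda>i. ?y i ^ \<alpha> i", OF finite UNIV_I] by simp
    finally show ?thesis by (simp add: monom_altdef mult.commute)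
  qed
  have "coeff (eval_mp (const_mp c) (\<lambda>i. if i = v then [:0, 1:] else [:x i:])) r
      = (\<Sum>\<alpha>\<in>?M. if \<alpha> v = r then c \<alpha> * monomial ?y \<alpha> else 0)"
    by (simp add: eval_mp_eq[OF mpoly_const_mp[OF c]] m coeff_sum if_distrib cong: if_cong)
  also have "\<dots> = (\<Sum>\<alpha>\<in>{\<alpha>\<in>?M. \<alpha> v = r}. c \<alpha> * monomial ?y \<alpha>)"
    by (rule sum.inter_filter[symmetric]) simp
  also have "\<dots> = (\<Sum>\<alpha>\<in>{\<alpha>. \<alpha> v = 0 \<and> \<alpha>(v := r) \<in> ?M}. slice v r c \<alpha> * monomial x \<alpha>)"
  proof (rule sum.reindex_bij_witness[of _ "\<lambda>\<alpha>. \<alpha>(v := r)" "\<lambda>\<alpha>. \<alpha>(v := 0)"])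
    fix \<alpha> assume a: "\<alpha> \<in> {\<alpha>\<in>?M. \<alpha> v = r}"
    have "monomial x (\<alpha>(v := 0)) = monomial ?y \<alpha>"
      unfolding monomial_def by (rule prod.cong) auto
    with a show "slice v r c (\<alpha>(v := 0)) * monomial x (\<alpha>(v := 0)) = c \<alpha> * monomial ?y \<alpha>"
      by (auto simp: slice_def fun_upd_idem)
  qed (auto simp: fun_upd_idem)
  also have "\<dots> = (\<Sum>\<alpha>\<in>?M. slice v r c \<alpha> * monomial x \<alpha>)"
  proof (rule sum.mono_neutral_left)
    show "{\<alpha>. \<alpha> v = 0 \<and> \<alpha>(v := r) \<in> ?M} \<subseteq> ?M"
      by (auto simp: exponents_def tdeg_upd)
    show "\<forall>\<alpha>\<in>?M - {\<alpha>. \<alpha> v = 0 \<and> \<alpha>(v := r) \<in> ?M}. slice v r c \<alpha> * monomial x \<alpha> = 0"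
      using c by (auto simp: slice_def mpoly_def)
  qed simp
  also have "\<dots> = eval_mp (slice v r c) x"
  proof (rule eval_mp_eq[symmetric])
    show "mpoly UNIV k (slice v r c)"
      by (rule mpoly_mono[OF mpoly_slice[of v UNIV k c r]]) (use c in auto)
  qed
  finally show ?thesis .
qed

text \<open>
An exponent of maximal total degree yields a constant nonzero derivative, so the order of vanishing
of a nonzero polynomial is finite at every point.
\<close>
lemma exists_hasse_nonzero:
  assumes c: "mpoly I k c" and nz: "c \<noteq> (\<lambda>_. 0)"
  shows "\<exists>\<beta>. eval_mp (hasse \<beta> c) x \<noteq> 0"
proof -
  define A where "A = {\<alpha>. c \<alpha> \<noteq> 0}"
  have "finite A" by (rule finite_subset[OF _ finite_exponents[of I k]]) (use c in \<open>auto simp: A_def mpoly_def\<close>)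
  then have fin: "finite (tdeg ` A)" by simp
  have "A \<noteq> {}" using nz by (auto simp: A_def)
  then have "Max (tdeg ` A) \<in> tdeg ` A" using fin by (intro Max_in) auto
  then obtain \<alpha> where al: "\<alpha> \<in> A" "Max (tdeg ` A) = tdeg \<alpha>" by (rule imageE)
  have a: "\<alpha> \<in> A" "tdeg \<beta> \<le> tdeg \<alpha>" if "\<beta> \<in> A" for \<beta>
    using al Max_ge[OF fin, of "tdeg \<beta>"] that by auto
  have h: "hasse \<alpha> c \<delta> = (if \<delta> = (\<lambda>i. 0) then c \<alpha> else 0)" for \<delta>
  proof (cases "\<delta> = (\<lambda>i. 0)")
    case False
    then have "tdeg \<delta> > 0" by (metis tdeg_eq_0 gr0I)
    then have "(\<lambda>i. \<alpha> i + \<delta> i) \<notin> A" using a(2)[of "\<lambda>i. \<alpha> i + \<delta> i"] by (auto simp: tdeg_add)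
    then show ?thesis using False by (simp add: hasse_def A_def)
  qed (simp add: hasse_def)
  have "{\<delta>. hasse \<alpha> c \<delta> \<noteq> 0} = {\<lambda>i. 0}" using al(1) by (auto simp: h A_def)
  then have "eval_mp (hasse \<alpha> c) x = c \<alpha>" unfolding eval_mp_def by (simp add: h monomial_def)
  then have "eval_mp (hasse \<alpha> c) x \<noteq> 0" using al(1) by (simp add: A_def)
  then show ?thesis by blast
qed

lemma eval_mp_zero [simp]: "eval_mp (\<lambda>_. 0) x = 0"
  by (simp add: eval_mp_def)

text \<open>
Induction over the variables. Collect \<open>c\<close> in powers of a new variable \<open>v\<close>, with top coefficient
\<open>cs\<close> of exponent \<open>s\<close>. Over a point \<open>x\<close> of the smaller grid choose a derivative \<open>B x\<close> of minimal
total degree that does not kill \<open>cs\<close> at \<open>x\<close>. Applied to \<open>c\<close>, it leaves on the line above \<open>x\<close> a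
nonzero polynomial of degree \<open>s\<close>, and lowers all orders by at most the degree of \<open>B x\<close>, which is
the order of vanishing of \<open>cs\<close> at \<open>x\<close>. So the line carries at most \<open>s\<close> plus \<open>card G\<close> times that
order, and the induction hypothesis bounds the sum of these orders.
\<close>
theorem schwartz_zippel_mult:
  fixes c :: "('i::finite \<Rightarrow> nat) \<Rightarrow> 'k::field" and I :: "'i set"
  assumes "finite G" "mpoly I k c" "c \<noteq> (\<lambda>_. 0)" "\<And>x. x \<in> grid I G \<Longrightarrow> vanishes c x (\<mu> x)"
  shows "card G * (\<Sum>x\<in>grid I G. \<mu> x) \<le> k * card G ^ card I"
  using finite[of I] assms(2-)
proof (induction I arbitrary: c k \<mu> rule: finite_induct)
  case empty
  have c0: "c \<alpha> = 0" if "\<alpha> \<noteq> (\<lambda>i. 0)" for \<alpha>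
    using empty.prems(1) that by (fastforce simp: mpoly_def exponents_def)
  obtain \<alpha> where "c \<alpha> \<noteq> 0" using empty.prems(2) by auto
  then have "c (\<lambda>i. 0) \<noteq> 0" using c0[of \<alpha>] by fastforce
  then have "{\<alpha>. c \<alpha> \<noteq> 0} = {\<lambda>i. 0}" using c0 by blast
  then have "eval_mp (hasse (\<lambda>i. 0) c) (\<lambda>i. 0) = c (\<lambda>i. 0)" by (simp add: hasse_def eval_mp_def monomial_def)
  then have "\<mu> (\<lambda>i. 0) = 0"
    using empty.prems(3)[of "\<lambda>i. 0"] \<open>c (\<lambda>i. 0) \<noteq> 0\<close> unfolding grid_empty vanishes_def
    by (metis gr0I singletonI tdeg_zero)
  then show ?case by (simp add: grid_empty)
next
  case (insert v I)
  note c = insert.prems(1)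
  have cU: "mpoly UNIV k c" by (rule mpoly_mono[OF c]) auto
  define R where "R = {r. slice v r c \<noteq> (\<lambda>_. 0)}"
  have sl: "\<exists>\<alpha>. c \<alpha> \<noteq> 0 \<and> \<alpha> v = r" if "r \<in> R" for r
  proof -
    from that obtain \<alpha> where "slice v r c \<alpha> \<noteq> 0" by (auto simp: R_def fun_eq_iff)
    then show ?thesis by (intro exI[of _ "\<alpha>(v := r)"]) (auto simp: slice_def split: if_splits)
  qed
  have Rk: "r \<le> k" if rR: "r \<in> R" for r
  proof -
    obtain \<alpha> where "c \<alpha> \<noteq> 0" "\<alpha> v = r" using sl[OF rR] by blast
    then show ?thesis using c le_tdeg[of \<alpha> v] unfolding mpoly_def exponents_def by force
  qed
  have finR: "finite R" by (rule finite_subset[of _ "{..k}"]) (auto dest: Rk)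
  obtain \<alpha>0 where a0: "c \<alpha>0 \<noteq> 0" using insert.prems(2) by auto
  then have "slice v (\<alpha>0 v) c (\<alpha>0(v := 0)) \<noteq> 0" by (simp add: slice_def)
  then have "\<alpha>0 v \<in> R" by (auto simp: R_def fun_eq_iff)
  then have Rne: "R \<noteq> {}" by auto
  define s where "s = Max R"
  have sR: "s \<in> R" unfolding s_def using finR Rne by (rule Max_in)
  have smax: "slice v r c = (\<lambda>_. 0)" if "r > s" for r
    using Max_ge[OF finR, of r, folded s_def] that unfolding R_def by fastforce
  define cs where "cs = slice v s c"
  have cs: "mpoly I (k - s) cs" "cs \<noteq> (\<lambda>_. 0)"
    using mpoly_slice[OF c] sR by (auto simp: cs_def R_def)
  have "\<exists>\<beta>. eval_mp (hasse \<beta> cs) x \<noteq> 0 \<and> vanishes cs x (tdeg \<beta>)" for x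
  proof -
    obtain \<beta> where "eval_mp (hasse \<beta> cs) x \<noteq> 0" using exists_hasse_nonzero[OF cs] by blast
    then have "\<exists>\<beta>. eval_mp (hasse \<beta> cs) x \<noteq> 0 \<and> (\<forall>\<gamma>. tdeg \<gamma> < tdeg \<beta> \<longrightarrow> \<not> eval_mp (hasse \<gamma> cs) x \<noteq> 0)"
      using ex_has_least_nat[of "\<lambda>\<beta>. eval_mp (hasse \<beta> cs) x \<noteq> 0" \<beta> tdeg] by (metis not_less)
    then show ?thesis unfolding vanishes_def by blast
  qed
  then obtain B where B: "\<And>x. eval_mp (hasse (B x) cs) x \<noteq> 0" "\<And>x. vanishes cs x (tdeg (B x))" by metis
  have Bv: "B x v = 0" for x
  proof (rule ccontr)
    assume "B x v \<noteq> 0"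
    then have "hasse (B x) cs = (\<lambda>_. 0)"
      by (auto simp: hasse_def cs_def slice_def fun_eq_iff)
    then show False using B(1)[of x] by simp
  qed
  have fibre: "(\<Sum>t\<in>G. \<mu> (x(v := t))) \<le> s + card G * tdeg (B x)" if x: "x \<in> grid I G" for x
  proof -
    define p where "p = eval_mp (const_mp (hasse (B x) c)) (\<lambda>i. if i = v then [:0, 1:] else [:x i:])"
    have hU: "mpoly UNIV k (hasse (B x) c)" by (rule mpoly_hasse'[OF cU])
    have co: "coeff p r = eval_mp (hasse (B x) (slice v r c)) x" for r
      unfolding p_def coeff_eval_mp_line[OF hU] slice_hasse[where \<beta> = "B x", OF Bv] ..
    have "coeff p s \<noteq> 0" using B(1)[of x] by (simp add: co cs_def)
    then have "p \<noteq> 0" by auto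
    have "degree p \<le> s"
      by (rule degree_le) (simp add: co smax hasse_def)
    have "(\<Sum>t\<in>G. \<mu> (x(v := t)) - tdeg (B x)) \<le> degree p"
    proof (rule sum_le_degree[OF \<open>p \<noteq> 0\<close> assms(1)])
      fix t assume "t \<in> G"
      then have "x(v := t) \<in> grid (insert v I) G" using x by (auto simp: grid_def)
      then have "vanishes (hasse (B x) c) (x(v := t)) (\<mu> (x(v := t)) - tdeg (B x))"
        by (intro vanishes_hasse[OF c] insert.prems(3))
      moreover have "x(v := t) = (\<lambda>i. poly (if i = v then [:0, 1:] else [:x i:]) t)" by auto
      ultimately show "[:-t, 1:] ^ (\<mu> (x(v := t)) - tdeg (B x)) dvd p"
        unfolding p_def by (intro vanishes_imp_dvd[OF hU]) simp
    qed
    also note \<open>degree p \<le> s\<close>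
    finally have "(\<Sum>t\<in>G. \<mu> (x(v := t)) - tdeg (B x)) \<le> s" .
    moreover have "(\<Sum>t\<in>G. \<mu> (x(v := t))) \<le> (\<Sum>t\<in>G. (\<mu> (x(v := t)) - tdeg (B x)) + tdeg (B x))"
      by (rule sum_mono) simp
    ultimately show ?thesis by (simp add: sum.distrib)
  qed
  have "(\<Sum>x\<in>grid (insert v I) G. \<mu> x) = (\<Sum>x\<in>grid I G. \<Sum>t\<in>G. \<mu> (x(v := t)))"
    by (rule grid_insert_sum[OF insert.hyps(2)])
  also have "\<dots> \<le> (\<Sum>x\<in>grid I G. s + card G * tdeg (B x))"
    by (rule sum_mono[OF fibre])
  also have "\<dots> = s * card G ^ card I + card G * (\<Sum>x\<in>grid I G. tdeg (B x))"
    by (simp add: sum.distrib card_grid insert.hyps sum_distrib_left)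
  also have "\<dots> \<le> s * card G ^ card I + (k - s) * card G ^ card I"
    by (intro add_left_mono insert.IH[OF cs]) (rule B(2))
  also have "\<dots> = k * card G ^ card I"
    using Rk[OF sR] by (simp flip: distrib_right)
  finally have "card G * (\<Sum>x\<in>grid (insert v I) G. \<mu> x) \<le> card G * (k * card G ^ card I)" by simp
  then show ?case using insert.hyps by (simp add: mult_ac)
qed

section \<open>The extension field and its trace parametrization of subspaces\<close>

lemma finite_field_power_card:
  fixes x :: "'a::{field,finite}"
  shows "x ^ CARD('a) = x"
proof (cases "x = 0")
  case False
  have c: "Suc (card (UNIV - {0::'a})) = CARD('a)"
    by (simp add: card_Diff_singleton)
  have "(\<Prod>y\<in>UNIV - {0}. x * y) = (\<Prod>y\<in>UNIV - {0}. y)"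
    by (rule prod.reindex_bij_witness[of _ "\<lambda>y. y / x" "\<lambda>y. x * y"]) (use False in auto)
  then have "x ^ card (UNIV - {0::'a}) * (\<Prod>y\<in>UNIV - {0}. y) = (\<Prod>y\<in>UNIV - {0}. y)"
    by (simp add: prod.distrib)
  moreover have "(\<Prod>y\<in>UNIV - {0::'a}. y) \<noteq> 0" by simp
  ultimately have "x ^ card (UNIV - {0::'a}) = 1" by simp
  then show ?thesis by (simp only: c[symmetric] power_Suc mult_1_right)
qed (simp add: zero_power)

lemma card_field_gt_1: "CARD('a::{field,finite}) > 1"
proof -
  have "card {0::'a, 1} \<le> CARD('a)" by (rule card_mono) auto
  then show ?thesis by simp
qed

lemma coeff_X: "n > 1 \<Longrightarrow> coeff ([:0, 1:] :: 'r::comm_ring_1 poly) n = 0"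
  by (cases n) (auto simp: coeff_pCons split: nat.splits)

text \<open>
The polynomial \<open>(1 + x)\<^sup>q - x\<^sup>q - 1\<close> has degree less than \<open>q\<close> and vanishes on the whole field, so it
is zero. This yields additivity of the \<open>q\<close>-th power without knowing that \<open>q\<close> is a power of the
characteristic.
\<close>
lemma card_field_binomial:
  assumes "0 < k" "k < CARD('a::{field,finite})"
  shows "of_nat (CARD('a) choose k) = (0::'a)"
proof -
  let ?q = "CARD('a)"
  define p where "p = [:1, 1::'a:] ^ ?q - monom 1 ?q - [:1:]"
  have co: "coeff ([:1, 1::'a:] ^ ?q) i = of_nat (?q choose i)" if "i \<le> ?q" for i
    using coeff_linear_poly_power[OF that, of 1 "1::'a"] by simp
  have "p = 0"
  proof (rule ccontr)
    assume "p \<noteq> 0"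
    have "degree p < ?q"
    proof (rule degree_lessI)
      show "p \<noteq> 0 \<or> 0 < ?q" using card_field_gt_1 by simp
      show "\<forall>i\<ge>?q. coeff p i = 0"
      proof (intro allI impI)
        fix i assume i: "i \<ge> ?q"
        show "coeff p i = 0"
        proof (cases "i = ?q")
          case True
          then show ?thesis using card_field_gt_1[where 'a='a] by (simp add: p_def co pCons_0_0 coeff_pCons split: nat.splits)
        next
          case False
          have "degree ([:1, 1::'a:] ^ ?q) \<le> ?q" using degree_power_le[of "[:1, 1::'a:]" ?q] by simp
          then have "coeff ([:1, 1::'a:] ^ ?q) i = 0" using i False by (intro coeff_eq_0) simp
          then show ?thesis using i False card_field_gt_1[where 'a='a] by (simp add: p_def coeff_pCons split: nat.splits)
        qed
      qed
    qed
    moreover have "{x. poly p x = 0} = UNIV"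
      by (auto simp: p_def poly_monom finite_field_power_card)
    ultimately show False using card_poly_roots_bound[OF \<open>p \<noteq> 0\<close>] by simp
  qed
  then have "coeff p k = 0" by simp
  then show ?thesis using assms by (simp add: p_def co coeff_pCons split: nat.splits)
qed

lemma of_nat_card_ac: "of_nat CARD('a) = (0 :: 'a::{field,finite} alg_closure)"
proof -
  have "of_nat (CARD('a) choose 1) = (0::'a)"
    by (rule card_field_binomial) (use card_field_gt_1 in auto)
  then have "to_ac (of_nat CARD('a) :: 'a) = 0" by simp
  then show ?thesis by (simp only: to_ac_of_nat)
qed

lemma frobenius_add:
  fixes x y :: "'a::{field,finite} alg_closure"
  shows "(x + y) ^ CARD('a) = x ^ CARD('a) + y ^ CARD('a)"
proof -
  let ?q = "CARD('a)"
  have q: "?q > 0" by simp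
  have "(x + y) ^ ?q = (\<Sum>k\<le>?q. of_nat (?q choose k) * x ^ k * y ^ (?q - k))"
    by (rule binomial_ring)
  also have "\<dots> = (\<Sum>k\<in>{0,?q}. of_nat (?q choose k) * x ^ k * y ^ (?q - k))"
  proof (intro sum.mono_neutral_right ballI)
    fix k assume "k \<in> {..?q} - {0, ?q}"
    then have "of_nat (?q choose k) = (0::'a)" by (intro card_field_binomial) auto
    then have "to_ac (of_nat (?q choose k) :: 'a) = 0" by simp
    then show "of_nat (?q choose k) * x ^ k * y ^ (?q - k) = 0" by (simp only: to_ac_of_nat) simp
  qed auto
  finally show ?thesis using q by (simp add: add.commute)
qed

lemma frobenius_iter_add:
  fixes x y :: "'a::{field,finite} alg_closure"
  shows "(x + y) ^ (CARD('a) ^ j) = x ^ (CARD('a) ^ j) + y ^ (CARD('a) ^ j)"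
proof (induction j)
  case (Suc j)
  have "(x + y) ^ (CARD('a) ^ Suc j) = ((x + y) ^ (CARD('a) ^ j)) ^ CARD('a)"
    by (simp add: mult.commute flip: power_mult)
  also have "\<dots> = x ^ (CARD('a) ^ Suc j) + y ^ (CARD('a) ^ Suc j)"
    by (simp add: Suc frobenius_add mult.commute flip: power_mult)
  finally show ?case .
qed simp

lemma frobenius_sum:
  fixes f :: "'b \<Rightarrow> 'a::{field,finite} alg_closure"
  shows "(\<Sum>i\<in>A. f i) ^ CARD('a) = (\<Sum>i\<in>A. f i ^ CARD('a))"
  by (induction A rule: infinite_finite_induct) (auto simp: frobenius_add zero_power)

lemma range_to_ac: "range (to_ac :: 'a::{field,finite} \<Rightarrow> _) = {x. x ^ CARD('a) = x}"
proof (rule card_seteq)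
  let ?p = "monom 1 CARD('a) - [:0, 1:] :: 'a alg_closure poly"
  have "coeff ?p CARD('a) = 1" using coeff_X[OF card_field_gt_1[where 'a='a]] by simp
  then have "?p \<noteq> 0" by (metis coeff_0 zero_neq_one)
  have r: "{x. x ^ CARD('a) = x} = {x. poly ?p x = 0}" by (auto simp: poly_monom)
  show "finite {x :: 'a alg_closure. x ^ CARD('a) = x}"
    unfolding r by (rule poly_roots_finite[OF \<open>?p \<noteq> 0\<close>])
  show "range (to_ac :: 'a \<Rightarrow> _) \<subseteq> {x. x ^ CARD('a) = x}"
    by (auto simp: finite_field_power_card simp flip: to_ac_power)
  have "degree ?p \<le> CARD('a)"
    by (rule degree_diff_le) (auto simp: degree_monom_le Suc_leI)
  then have "card {x. poly ?p x = 0} \<le> CARD('a)"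
    using card_poly_roots_bound[OF \<open>?p \<noteq> 0\<close>] by linarith
  then show "card {x :: 'a alg_closure. x ^ CARD('a) = x} \<le> card (range (to_ac :: 'a \<Rightarrow> _))"
    unfolding r by (simp add: card_image[OF inj_to_ac])
qed

lemma card_roots_separable:
  fixes p :: "'k::alg_closed_field poly"
  assumes p: "p \<noteq> 0" and sep: "\<And>x. poly (pderiv p) x \<noteq> 0"
  shows "card {x. poly p x = 0} = degree p"
proof -
  obtain A where A: "size A = degree p" "p = Polynomial.smult (lead_coeff p) (\<Prod>x\<in>#A. [:-x, 1:])"
    using alg_closed_imp_factorization[OF p] by blast
  have cnt: "count A x \<le> 1" for x
  proof (rule ccontr)
    assume "\<not> count A x \<le> 1"
    then have "{#x, x#} \<subseteq># A" by (simp add: mset_subset_eqI subseteq_mset_def)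
    then obtain B where B: "A = {#x, x#} + B" by (metis mset_subset_eq_exists_conv)
    have "p = [:-x, 1:] * ([:-x, 1:] * Polynomial.smult (lead_coeff p) (\<Prod>x\<in>#B. [:-x, 1:]))"
      by (subst A(2)) (simp add: B)
    then obtain r where r: "p = [:-x, 1:] * ([:-x, 1:] * r)" by blast
    have "poly (pderiv p) x = 0" unfolding r by (simp only: pderiv_mult poly_add poly_mult) simp
    then show False using sep by simp
  qed
  have "poly p x = lead_coeff p * poly (\<Prod>x\<in>#A. [:-x, 1:]) x" for x
    by (subst A(2)) simp
  then have rt: "set_mset A = {x. poly p x = 0}"
    using p by (auto simp: poly_prod_mset)
  have "A = mset_set (set_mset A)"
  proof (rule multiset_eqI)
    fix x
    show "count A x = count (mset_set (set_mset A)) x"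
    proof (cases "x \<in># A")
      case True
      then have "count A x > 0" by simp
      then have "count A x = 1" using cnt[of x] by linarith
      then show ?thesis using True by simp
    next
      case False
      then show ?thesis by (simp add: not_in_iff)
    qed
  qed
  then have "size A = card (set_mset A)" by (metis size_mset_set)
  then show ?thesis using A(1) rt by simp
qed

text \<open>
For positive \<open>a\<close>, the field with \<open>q\<^sup>a\<close> elements.
\<close>
definition ext_field :: "nat \<Rightarrow> 'a::{field,finite} alg_closure set" where
  "ext_field a = {x. x ^ (CARD('a) ^ a) = x}"

lemma card_ext_field:
  assumes "a > 0"
  shows "finite (ext_field a :: 'a::{field,finite} alg_closure set)"
    and "card (ext_field a :: 'a alg_closure set) = CARD('a) ^ a"
proof -
  let ?Q = "CARD('a) ^ a"
  let ?p = "monom 1 ?Q - [:0, 1:] :: 'a alg_closure poly"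
  have Q: "?Q > 1" using one_less_power[OF card_field_gt_1 assms] .
  have l: "coeff ?p ?Q = 1" using coeff_X[OF Q] by simp
  then have "?p \<noteq> 0" by (metis coeff_0 zero_neq_one)
  have "degree ?p \<le> ?Q"
    by (rule degree_diff_le) (use Q in \<open>auto simp: degree_monom_le\<close>)
  with le_degree[of ?p ?Q] l have deg: "degree ?p = ?Q" by simp
  have ex: "ext_field a = {x :: 'a alg_closure. poly ?p x = 0}" by (auto simp: ext_field_def poly_monom)
  show fin: "finite (ext_field a :: 'a alg_closure set)" unfolding ex by (rule poly_roots_finite[OF \<open>?p \<noteq> 0\<close>])
  have "(of_nat ?Q :: 'a alg_closure) = 0" using assms by (simp add: of_nat_card_ac)
  then have pd: "pderiv ?p = [:-1:]"
    by (simp add: pderiv_diff pderiv_monom pderiv_pCons del: of_nat_power)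
  have "card {x. poly ?p x = 0} = degree ?p"
    by (rule card_roots_separable[OF \<open>?p \<noteq> 0\<close>]) (simp add: pd)
  then show "card (ext_field a :: 'a alg_closure set) = ?Q" unfolding ex deg .
qed

text \<open>
The trace from \<open>ext_field a\<close> to the ground field.
\<close>
definition tr :: "nat \<Rightarrow> 'a::{field,finite} alg_closure \<Rightarrow> 'a alg_closure" where
  "tr a z = (\<Sum>j<a. z ^ (CARD('a) ^ j))"

lemma ext_field_closed:
  assumes "x \<in> ext_field a" "y \<in> ext_field a"
  shows "x + y \<in> ext_field a" "x - y \<in> ext_field a" "x * y \<in> ext_field a"
proof -
  show "x + y \<in> ext_field a" "x * y \<in> ext_field a"
    using assms by (simp_all add: ext_field_def frobenius_iter_add power_mult_distrib)
  have "(x - y) ^ (CARD('a) ^ a) + y ^ (CARD('a) ^ a) = x ^ (CARD('a) ^ a)"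
    by (subst frobenius_iter_add[symmetric]) simp
  then have "(x - y) ^ (CARD('a) ^ a) + y = x" using assms by (simp add: ext_field_def)
  then have "(x - y) ^ (CARD('a) ^ a) = x - y" by (metis add_diff_cancel_right')
  then show "x - y \<in> ext_field a" by (simp add: ext_field_def)
qed

lemma to_ac_in_ext_field: "to_ac x \<in> ext_field a"
proof -
  have "to_ac x ^ (CARD('a) ^ a) = to_ac (x :: 'a::{field,finite})"
    by (induction a) (simp_all add: power_mult flip: to_ac_power, simp add: finite_field_power_card)
  then show ?thesis by (simp add: ext_field_def)
qed

lemma zero_in_ext_field: "0 \<in> ext_field a"
  using to_ac_in_ext_field[of 0] by simp

lemma tr_add: "tr a (x + y) = tr a x + tr a y"
  by (simp add: tr_def frobenius_iter_add sum.distrib)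

lemma tr_scale: "tr a (to_ac x * y) = to_ac x * tr a y"
proof -
  have "to_ac x ^ (CARD('a) ^ j) = to_ac (x :: 'a::{field,finite})" for j
    using to_ac_in_ext_field[of x j] by (simp add: ext_field_def)
  then show ?thesis by (simp add: tr_def power_mult_distrib sum_distrib_left)
qed

lemma tr_range:
  fixes z :: "'a::{field,finite} alg_closure"
  assumes "z \<in> ext_field a"
  shows "tr a z \<in> range to_ac"
proof -
  have "tr a z ^ CARD('a) = (\<Sum>j<a. z ^ (CARD('a) ^ Suc j))"
    by (simp add: tr_def frobenius_sum mult.commute flip: power_mult)
  also have "\<dots> = tr a z"
  proof -
    have "z + (\<Sum>j<a. z ^ (CARD('a) ^ Suc j)) = tr a z + z ^ (CARD('a) ^ a)"
      unfolding tr_def by (subst sum.lessThan_Suc[symmetric], subst sum.lessThan_Suc_shift) simp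
    then show ?thesis using assms by (simp add: ext_field_def)
  qed
  finally show ?thesis by (simp add: range_to_ac)
qed

lemma card_tr_kernel:
  assumes "a > 0"
  shows "card {z \<in> ext_field a :: 'a::{field,finite} alg_closure set. tr a z = 0} \<le> CARD('a) ^ (a - 1)"
proof -
  let ?p = "\<Sum>j<a. monom 1 (CARD('a) ^ j) :: 'a alg_closure poly"
  obtain b where b: "a = Suc b" using assms by (cases a) auto
  have inj: "CARD('a) ^ j = CARD('a) ^ b \<longleftrightarrow> j = b" for j
    using card_field_gt_1[where 'a='a] by simp
  have "coeff ?p (CARD('a) ^ b) = 1"
    by (simp add: coeff_sum b inj)
  then have "?p \<noteq> 0" by (metis coeff_0 zero_neq_one)
  have "degree ?p \<le> CARD('a) ^ b"
    by (rule degree_sum_le) (auto simp: b intro!: order_trans[OF degree_monom_le] power_increasing)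
  moreover have "card {z \<in> ext_field a :: 'a alg_closure set. tr a z = 0} \<le> card {z. poly ?p z = 0}"
    by (rule card_mono[OF poly_roots_finite[OF \<open>?p \<noteq> 0\<close>]]) (auto simp: poly_sum poly_monom tr_def)
  ultimately show ?thesis using card_poly_roots_bound[OF \<open>?p \<noteq> 0\<close>] b by simp
qed

text \<open>
The map \<open>y \<mapsto> tr a (z * y)\<close> as a polynomial in \<open>y\<close>.
\<close>
definition tr_curve :: "nat \<Rightarrow> 'a::{field,finite} alg_closure \<Rightarrow> 'a alg_closure poly" where
  "tr_curve a z = (\<Sum>j<a. monom (z ^ (CARD('a) ^ j)) (CARD('a) ^ j))"

lemma poly_tr_curve: "poly (tr_curve a z) y = tr a (z * y)"
  by (simp add: tr_curve_def tr_def poly_sum poly_monom power_mult_distrib)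

lemma degree_tr_curve: "degree (tr_curve a (z :: 'a::{field,finite} alg_closure)) \<le> CARD('a) ^ (a - 1)"
  unfolding tr_curve_def
  by (rule degree_sum_le) (auto intro!: order_trans[OF degree_monom_le] power_increasing)

lemma coeff_tr_curve:
  assumes "a > 0"
  shows "coeff (tr_curve a (z :: 'a::{field,finite} alg_closure)) (CARD('a) ^ (a - 1)) = z ^ (CARD('a) ^ (a - 1))"
proof -
  obtain b where b: "a = Suc b" using assms by (cases a) auto
  have inj: "CARD('a) ^ j = CARD('a) ^ b \<longleftrightarrow> j = b" for j
    using card_field_gt_1[where 'a='a] by simp
  show ?thesis by (simp add: tr_curve_def coeff_sum b inj)
qed

text \<open>
The parameters \<open>z\<close> for which \<open>y \<mapsto> tr a (z i * y)\<close> is injective on \<open>ext_field a\<close>, so that they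
parametrize a direction of full dimension \<open>a\<close>.
\<close>
definition generic :: "'i::finite set \<Rightarrow> nat \<Rightarrow> ('i \<Rightarrow> 'a::{field,finite} alg_closure) set" where
  "generic I a = {z \<in> grid I (ext_field a). \<forall>y\<in>ext_field a. (\<forall>i\<in>I. tr a (z i * y) = 0) \<longrightarrow> y = 0}"

text \<open>
At least a fraction \<open>1 - 1/q\<close> of all points is generic: for each of the fewer than \<open>q\<^sup>a\<close> nonzero
\<open>y\<close>, at most a fraction \<open>1/q\<close> of the values of each coordinate \<open>z i\<close> satisfies
\<open>tr a (z i * y) = 0\<close>, and there are more than \<open>a\<close> coordinates. The fraction \<open>1 - 1/q\<close> is what
turns into the constant \<open>1 + q\<^bsup>1-a\<^esup>\<close> of the theorem.
\<close>
lemma card_generic: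
  assumes a: "a > 0" and d: "a < card (I :: 'i::finite set)"
  defines "q \<equiv> CARD('a::{field,finite})"
  shows "(q ^ a) ^ card I * (q ^ a - q ^ (a - 1)) \<le> q ^ a * card (generic I a :: ('i \<Rightarrow> 'a alg_closure) set)"
proof -
  let ?K = "ext_field a :: 'a alg_closure set" let ?d = "card I"
  define e where "e = q ^ (a - 1)"
  have Q: "q ^ a = q * e" using a by (simp add: e_def power_eq_if)
  note K = card_ext_field[OF a, where 'a='a]
  let ?N = "{z \<in> ?K. tr a z = 0}"
  let ?B = "\<lambda>y. {z \<in> grid I ?K. \<forall>i\<in>I. tr a (z i * y) = 0}"
  have B: "card (?B y) \<le> e ^ ?d" if y: "y \<in> ?K - {0}" for y
  proof -
    have "card (?B y) \<le> card (grid I ?N)"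
    proof (rule card_inj_on_le)
      show "inj_on (\<lambda>z i. z i * y) (?B y)"
        using y by (auto simp: inj_on_def fun_eq_iff)
      show "(\<lambda>z i. z i * y) ` ?B y \<subseteq> grid I ?N"
        using y by (auto simp: grid_def ext_field_closed)
      show "finite (grid I ?N)" using K by (intro finite_grid) auto
    qed
    also have "\<dots> = card ?N ^ ?d" by (simp add: card_grid)
    also have "\<dots> \<le> e ^ ?d" using card_tr_kernel[OF a, where 'a='a] by (intro power_mono) (auto simp: e_def q_def)
    finally show ?thesis .
  qed
  have "grid I ?K - generic I a \<subseteq> (\<Union>y\<in>?K - {0}. ?B y)" by (auto simp: generic_def)
  then have "card (grid I ?K - generic I a) \<le> card (\<Union>y\<in>?K - {0}. ?B y)"
    by (rule card_mono[rotated]) (use K finite_grid[of ?K I] in auto)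
  also have "\<dots> \<le> (\<Sum>y\<in>?K - {0}. card (?B y))" by (rule card_UN_le) (use K in auto)
  also have "\<dots> \<le> (\<Sum>y\<in>?K - {0}. e ^ ?d)" by (rule sum_mono[OF B])
  also have "\<dots> = (q ^ a - 1) * e ^ ?d" using K zero_in_ext_field[of a, where 'a='a] by (simp add: q_def)
  finally have 1: "card (grid I ?K - generic I a) \<le> (q ^ a - 1) * e ^ ?d" .
  have "card (grid I ?K - generic I a) = (q ^ a) ^ ?d - card (generic I a :: ('i \<Rightarrow> 'a alg_closure) set)"
    using K finite_grid[of ?K I] by (subst card_Diff_subset) (auto simp: generic_def card_grid q_def intro: finite_subset)
  with 1 have 2: "(q ^ a) ^ ?d \<le> card (generic I a :: ('i \<Rightarrow> 'a alg_closure) set) + (q ^ a - 1) * e ^ ?d" by linarith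
  have "q * (q ^ a - 1) \<le> q ^ Suc a" by simp
  also have "\<dots> \<le> q ^ ?d" using d by (intro power_increasing) (auto simp: q_def Suc_leI)
  finally have 3: "q ^ a * ((q ^ a - 1) * e ^ ?d) \<le> e * (q ^ ?d * e ^ ?d)"
    by (simp add: Q mult_ac)
  have "q ^ a * (q ^ a) ^ ?d \<le> q ^ a * card (generic I a :: ('i \<Rightarrow> 'a alg_closure) set) + e * (q ^ a) ^ ?d"
    using mult_le_mono2[OF 2, of "q ^ a"] 3 by (simp add: distrib_left power_mult_distrib[symmetric] flip: Q)
  then show ?thesis by (simp add: diff_mult_distrib2 mult.commute e_def)
qed

lemma frobenius_inj:
  assumes "a > 0"
  shows "inj_on (\<lambda>x. x ^ (CARD('a) ^ (a - 1))) (ext_field a :: 'a::{field,finite} alg_closure set)"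
    and "x \<in> ext_field a \<Longrightarrow> (x :: 'a alg_closure) ^ (CARD('a) ^ (a - 1)) \<in> ext_field a"
proof -
  have *: "(x ^ (CARD('a) ^ (a - 1))) ^ CARD('a) = x" if "x \<in> ext_field a" for x :: "'a alg_closure"
    using that assms by (simp add: ext_field_def power_eq_if[of _ a] mult.commute flip: power_mult)
  show "inj_on (\<lambda>x. x ^ (CARD('a) ^ (a - 1))) (ext_field a :: 'a alg_closure set)"
    by (rule inj_on_inverseI[where g = "\<lambda>x. x ^ CARD('a)"]) (rule *)
  have "(x ^ (CARD('a) ^ (a - 1))) ^ (CARD('a) ^ a) = (x ^ (CARD('a) ^ a)) ^ (CARD('a) ^ (a - 1))"
    unfolding power_mult[symmetric] by (simp only: mult.commute)
  then show "x \<in> ext_field a \<Longrightarrow> (x :: 'a alg_closure) ^ (CARD('a) ^ (a - 1)) \<in> ext_field a"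
    by (simp add: ext_field_def)
qed

section \<open>Orders of finite abelian groups\<close>

text \<open>
Dimensions over the finite ground field are replaced throughout by logarithms of orders of finite
subgroups.
\<close>
definition add_subgroup :: "'g::ab_group_add set \<Rightarrow> bool" where
  "add_subgroup H \<longleftrightarrow> 0 \<in> H \<and> (\<forall>x\<in>H. \<forall>y\<in>H. x - y \<in> H)"

lemma add_subgroup_add: "add_subgroup H \<Longrightarrow> x \<in> H \<Longrightarrow> y \<in> H \<Longrightarrow> x + y \<in> H"
  unfolding add_subgroup_def by (metis diff_0 diff_minus_eq_add)

lemma add_subgroup_Int: "add_subgroup H \<Longrightarrow> add_subgroup Y \<Longrightarrow> add_subgroup (H \<inter> Y)"
  by (auto simp: add_subgroup_def)

lemma add_subgroup_INT: "(\<And>s. s \<in> D \<Longrightarrow> add_subgroup (Z s)) \<Longrightarrow> add_subgroup (\<Inter>s\<in>D. Z s)"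
  by (auto simp: add_subgroup_def)

lemma add_subgroup_card_pos: "add_subgroup H \<Longrightarrow> finite H \<Longrightarrow> card H > 0"
  by (auto simp: add_subgroup_def card_gt_0_iff)

lemma card_hom:
  fixes f :: "'g::ab_group_add \<Rightarrow> 'h::ab_group_add"
  assumes H: "add_subgroup H" "finite H" and f: "\<And>x y. x \<in> H \<Longrightarrow> y \<in> H \<Longrightarrow> f (x - y) = f x - f y"
  shows "card H = card (f ` H) * card {x\<in>H. f x = 0}"
proof -
  have fib: "card {x\<in>H. f x = v} = card {x\<in>H. f x = 0}" if "v \<in> f ` H" for v
  proof -
    obtain x0 where x0: "x0 \<in> H" "v = f x0" using \<open>v \<in> f ` H\<close> by auto
    have ad: "x + x0 \<in> H" "f (x + x0) = f x + f x0" if "x \<in> H" for x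
    proof -
      show "x + x0 \<in> H" using add_subgroup_add[OF H(1) that x0(1)] .
      from f[OF this x0(1)] show "f (x + x0) = f x + f x0" by simp
    qed
    have "bij_betw (\<lambda>x. x - x0) {x\<in>H. f x = v} {x\<in>H. f x = 0}"
      by (rule bij_betw_byWitness[where f' = "\<lambda>x. x + x0"])
         (use H(1) x0 f ad in \<open>auto simp: add_subgroup_def\<close>)
    then show ?thesis by (rule bij_betw_same_card)
  qed
  have "card H = (\<Sum>v\<in>f ` H. card {x\<in>H. f x = v})"
    using sum.image_gen[OF H(2), of "\<lambda>_. 1::nat" f] by simp
  then show ?thesis using fib by simp
qed

text \<open>
The kernel of subtraction \<open>A \<times> C \<rightarrow> B\<close> is a copy of \<open>A \<inter> C\<close>.
\<close>
lemma card_subgroups: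
  fixes A C B :: "'g::ab_group_add set"
  assumes "add_subgroup A" "add_subgroup C" "add_subgroup B" "finite B" "A \<subseteq> B" "C \<subseteq> B"
  shows "card A * card C \<le> card B * card (A \<inter> C)"
proof -
  have fin: "finite A" "finite C" using assms finite_subset by auto
  let ?f = "\<lambda>p::'g \<times> 'g. fst p - snd p"
  have "card (A \<times> C) = card (?f ` (A \<times> C)) * card {x\<in>A \<times> C. ?f x = 0}"
    by (rule card_hom) (use assms fin in \<open>auto simp: add_subgroup_def zero_prod_def\<close>)
  also have "card {x\<in>A \<times> C. ?f x = 0} = card (A \<inter> C)"
    by (rule bij_betw_same_card[of fst], rule bij_betw_byWitness[where f' = "\<lambda>x. (x, x)"]) auto
  also have "card (?f ` (A \<times> C)) \<le> card B"
  proof (rule card_mono[OF assms(4)])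
    show "?f ` (A \<times> C) \<subseteq> B" 
    proof clarify
      fix a c assume "a \<in> A" "c \<in> C"
      then have "a \<in> B" "c \<in> B" using assms(5,6) by auto
      then show "fst (a, c) - snd (a, c) \<in> B" using assms(3) unfolding add_subgroup_def fst_conv snd_conv by blast
    qed
  qed
  finally show ?thesis by (simp add: card_cartesian_product)
qed

text \<open>
Impose the conditions \<open>Z s\<close> on \<open>J\<close> one after the other and let \<open>w s\<close> be the loss in logarithmic
size at step \<open>s\<close>. By submodularity (\<open>card_subgroups\<close>) a condition costs at least as much when
fewer conditions precede it, so a subfamily loses at least the sum of its weights. The weights
depend on \<open>J\<close> and \<open>Z\<close> only, not on the subfamily; this is the source of the linear dependence on
the number of rich directions.
\<close>
lemma chain_weights:
  fixes Z :: "'j \<Rightarrow> 'g::ab_group_add set" and J :: "'g set"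
  assumes "finite D0" "b > 1" "add_subgroup J" "finite J" "\<And>s. add_subgroup (Z s)"
  defines "L \<equiv> \<lambda>D. log b (card (J \<inter> (\<Inter>s\<in>D. Z s)))"
  shows "\<exists>w::'j \<Rightarrow> real. (\<forall>s. w s \<ge> 0) \<and> (\<Sum>s\<in>D0. w s) = L {} - L D0 \<and>
           (\<forall>D\<subseteq>D0. (\<Sum>s\<in>D. w s) \<le> L {} - L D)"
  using assms(1)
proof (induction D0 rule: finite_induct)
  case empty
  then show ?case by (intro exI[of _ "\<lambda>_. 0"]) auto
next
  case (insert t D0)
  then obtain w where w: "\<forall>s. w s \<ge> 0" "(\<Sum>s\<in>D0. w s) = L {} - L D0" "\<And>D. D \<subseteq> D0 \<Longrightarrow> (\<Sum>s\<in>D. w s) \<le> L {} - L D"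
    by blast
  let ?H = "\<lambda>D. J \<inter> (\<Inter>s\<in>D. Z s)"
  have sg: "add_subgroup (?H D)" for D by (intro add_subgroup_Int add_subgroup_INT assms)
  have fin: "finite (?H D)" for D using assms by auto
  have pos: "card (?H D) > 0" for D by (rule add_subgroup_card_pos[OF sg fin])
  have sub: "L D0 - L (insert t D0) \<le> L D - L (insert t D)" if "D \<subseteq> D0" for D
  proof -
    have "card (?H D0) * card (?H (insert t D)) \<le> card (?H D) * card (?H D0 \<inter> ?H (insert t D))"
      by (rule card_subgroups[OF sg sg sg fin]) (use that in auto)
    also have "?H D0 \<inter> ?H (insert t D) = ?H (insert t D0)" using that by auto
    finally have "real (card (?H D0) * card (?H (insert t D))) \<le> real (card (?H D) * card (?H (insert t D0)))"
      by (simp only: of_nat_le_iff)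
    then have le: "real (card (?H D0)) * real (card (?H (insert t D))) \<le> real (card (?H D)) * real (card (?H (insert t D0)))"
      by simp
    have p: "0 < real (card (?H E))" for E using pos by simp
    have "log b (real (card (?H D0)) * real (card (?H (insert t D)))) \<le> log b (real (card (?H D)) * real (card (?H (insert t D0))))"
      by (rule log_le_cancel_iff[OF assms(2) mult_pos_pos[OF p p] mult_pos_pos[OF p p], THEN iffD2, OF le])
    then show ?thesis
      unfolding L_def log_mult_pos[OF p p] by simp
  qed
  have nonneg: "0 \<le> L D0 - L (insert t D0)"
  proof -
    have p: "0 < real (card (?H E))" for E using pos by simp
    have "card (?H (insert t D0)) \<le> card (?H D0)" by (rule card_mono[OF fin]) auto
    then have "log b (card (?H (insert t D0))) \<le> log b (card (?H D0))"
      by (intro log_le_cancel_iff[OF assms(2) p p, THEN iffD2]) simp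
    then show ?thesis by (simp add: L_def)
  qed
  let ?w = "w(t := L D0 - L (insert t D0))"
  show ?case
  proof (intro exI[of _ ?w] conjI allI impI)
    show "?w s \<ge> 0" for s using w nonneg by auto
    have "sum ?w D0 = sum w D0" by (rule sum.cong) (use insert in auto)
    then show "sum ?w (insert t D0) = L {} - L (insert t D0)" using insert w(2) by simp
  next
    fix D assume D: "D \<subseteq> insert t D0"
    show "sum ?w D \<le> L {} - L D"
    proof (cases "t \<in> D")
      case True
      define D' where "D' = D - {t}"
      have D': "D = insert t D'" "t \<notin> D'" "D' \<subseteq> D0" "finite D'"
        using True D insert finite_subset[of D "insert t D0"] by (auto simp: D'_def)
      have "sum ?w D' = sum w D'" by (rule sum.cong) (use D' in auto)
      then have "sum ?w D = (L D0 - L (insert t D0)) + sum w D'" using D' by simp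
      also have "\<dots> \<le> (L D' - L D) + (L {} - L D')" using sub[OF D'(3)] w(3)[OF D'(3)] D' by simp
      finally show ?thesis by simp
    next
      case False
      have "sum ?w D = sum w D" by (rule sum.cong) (use False in auto)
      then show ?thesis using w(3)[of D] False D by auto
    qed
  qed
qed

section \<open>Top forms along a rich direction\<close>

definition lift :: "(('i \<Rightarrow> nat) \<Rightarrow> 'a::field) \<Rightarrow> ('i \<Rightarrow> nat) \<Rightarrow> 'a alg_closure" where
  "lift c = (\<lambda>\<alpha>. to_ac (c \<alpha>))"

lemma mpoly_lift: "mpoly I k c \<Longrightarrow> mpoly I k (lift c)"
  by (simp add: mpoly_def lift_def)

lemma eval_mp_lift: "eval_mp (lift c) (\<lambda>i. to_ac (u i)) = to_ac (eval_mp c u)"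
  by (simp add: eval_mp_def lift_def monomial_def to_ac_sum to_ac_prod)

lemma hasse_lift: "hasse \<beta> (lift c) = lift (hasse \<beta> c)"
  by (simp add: hasse_def lift_def fun_eq_iff to_ac_prod)

lemma vanishes_lift: "vanishes (lift c) (\<lambda>i. to_ac (u i)) M \<longleftrightarrow> vanishes c u M"
  by (simp add: vanishes_def hasse_lift eval_mp_lift)

text \<open>
The traces of elements of \<open>ext_field a\<close> lie in the ground field (\<open>tr_range\<close>), so that \<open>of_ac\<close> does not
resort to its default value where this point is used.
\<close>
definition tr_point :: "nat \<Rightarrow> ('i \<Rightarrow> 'a::{field,finite} alg_closure) \<Rightarrow> 'a alg_closure \<Rightarrow> 'i \<Rightarrow> 'a" where
  "tr_point a z y = (\<lambda>i. of_ac (tr a (z i * y)))"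

lemma to_ac_tr_point:
  assumes "z \<in> grid I (ext_field a)" "y \<in> ext_field a"
  shows "to_ac (tr_point a z y i) = tr a (z i * y)"
proof -
  have "z i \<in> ext_field a" using assms(1) zero_in_ext_field by (cases "i \<in> I") (auto simp: grid_def)
  then show ?thesis unfolding tr_point_def by (intro to_ac_of_ac tr_range ext_field_closed assms)
qed

lemma hasse_hom_part:
  assumes "tdeg \<beta> \<le> k"
  shows "hasse \<beta> (hom_part k c) = hom_part (k - tdeg \<beta>) (hasse \<beta> c)"
  using assms by (auto simp: hasse_def hom_part_def tdeg_add fun_eq_iff)

lemma hasse_hom_part_0:
  assumes "k < tdeg \<beta>"
  shows "hasse \<beta> (hom_part k c) = (\<lambda>_. 0)"
  using assms by (auto simp: hasse_def hom_part_def tdeg_add fun_eq_iff)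

text \<open>
If the zeros of \<open>c\<close> on the translate by \<open>u\<close> of the direction of \<open>z\<close> have large total multiplicity,
then the top form of \<open>c\<close> vanishes to order \<open>m\<close> at the Frobenius image of \<open>z\<close>. The
case \<open>m = 1\<close> is \<open>curve_vanishing\<close> for the trace curve. For higher order it is applied to a Hasse
derivative of total degree \<open>j < m\<close>: each of the \<open>q\<^sup>a\<close> multiplicities falls by at most \<open>j\<close>, and the
degree of the composition falls by \<open>j q\<^bsup>a-1\<^esup>\<close>; the second summand on the left of the last
assumption pays for the difference.
\<close>
lemma top_vanishing:
  fixes c :: "('i::finite \<Rightarrow> nat) \<Rightarrow> 'a::{field,finite}"
  defines "q \<equiv> CARD('a)"
  assumes a: "a > 0" and c: "mpoly I k c" and z: "z \<in> grid I (ext_field a)"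
    and v: "\<And>y. y \<in> ext_field a \<Longrightarrow> vanishes c (\<lambda>i. u i + tr_point a z y i) (M y)"
    and big: "k * q ^ (a - 1) + (m - 1) * (q ^ a - q ^ (a - 1)) < (\<Sum>y\<in>ext_field a. M y)"
  shows "vanishes (hom_part k (lift c)) (\<lambda>i. z i ^ (q ^ (a - 1))) m"
  unfolding vanishes_def
proof (intro allI impI)
  fix \<beta> :: "'i \<Rightarrow> nat" assume \<beta>: "tdeg \<beta> < m"
  define e where "e = q ^ (a - 1)"
  define j where "j = tdeg \<beta>"
  have e: "e > 0" "e \<le> q ^ a" by (auto simp: e_def q_def intro: power_increasing Suc_leI)
  note K = card_ext_field[OF a, where 'a='a]
  show "eval_mp (hasse \<beta> (hom_part k (lift c))) (\<lambda>i. z i ^ (q ^ (a - 1))) = 0"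
  proof (cases "j \<le> k")
    case False
    then show ?thesis by (simp add: hasse_hom_part_0 j_def)
  next
    case True
    define s where "s i = [:to_ac (u i):] + tr_curve a (z i)" for i
    have top: "coeff (s i) e = z i ^ e" for i
    proof -
      have "coeff [:to_ac (u i):] e = 0" using e by (cases e) auto
      then show ?thesis using coeff_tr_curve[OF a, of "z i"] by (simp add: s_def e_def q_def)
    qed
    have "eval_mp (hom_part (k - j) (hasse \<beta> (lift c))) (\<lambda>i. coeff (s i) e) = 0"
    proof (rule curve_vanishing[where Y = "ext_field a" and M = "\<lambda>y. M y - j"])
      show "mpoly UNIV (k - j) (hasse \<beta> (lift c))"
        unfolding j_def by (rule mpoly_mono[OF mpoly_hasse[OF mpoly_lift[OF c]]]) auto
      show "degree (s i) \<le> e" for i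
        unfolding s_def by (rule degree_add_le) (use degree_tr_curve[of a "z i"] in \<open>auto simp: e_def q_def\<close>)
      show "vanishes (hasse \<beta> (lift c)) (\<lambda>i. poly (s i) y) (M y - j)" if y: "y \<in> ext_field a" for y
      proof -
        have "(\<lambda>i. poly (s i) y) = (\<lambda>i. to_ac (u i + tr_point a z y i))"
          using to_ac_tr_point[OF z y] by (simp add: s_def poly_tr_curve fun_eq_iff)
        then have "vanishes (lift c) (\<lambda>i. poly (s i) y) (M y)"
          using v[OF y] by (simp only: vanishes_lift)
        then show ?thesis unfolding j_def by (rule vanishes_hasse[OF mpoly_lift[OF c]])
      qed
      have "(\<Sum>y\<in>ext_field a. M y) \<le> (\<Sum>y\<in>ext_field a. (M y - j) + j)" by (rule sum_mono) simp
      also have "\<dots> = (\<Sum>y\<in>ext_field a. M y - j) + q ^ a * j" using K by (simp add: sum.distrib q_def)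
      finally have 1: "(\<Sum>y\<in>ext_field a. M y) \<le> (\<Sum>y\<in>ext_field a. M y - j) + q ^ a * j" .
      have "j * (q ^ a - e) \<le> (m - 1) * (q ^ a - e)" using \<beta> by (intro mult_le_mono1) (simp add: j_def)
      with big have 2: "k * e + j * (q ^ a - e) < (\<Sum>y\<in>ext_field a. M y)" unfolding e_def by linarith
      have 3: "k * e = (k - j) * e + j * e" using True by (simp flip: distrib_right)
      have "j * (q ^ a - e) + j * e = q ^ a * j" by (metis e(2) add_mult_distrib2 le_add_diff_inverse2 mult.commute)
      with 1 2 3 show "(k - j) * e < (\<Sum>y\<in>ext_field a. M y - j)" by linarith
    qed (use e K in auto)
    then show ?thesis
      unfolding e_def[symmetric] top using True by (simp add: hasse_hom_part j_def)
  qed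
qed

section \<open>Counting vanishing conditions\<close>

lemma card_supported:
  assumes "finite C"
  shows "finite {g :: 'p \<Rightarrow> 'b::{zero,finite}. \<forall>p. p \<notin> C \<longrightarrow> g p = 0}"
    and "card {g :: 'p \<Rightarrow> 'b::{zero,finite}. \<forall>p. p \<notin> C \<longrightarrow> g p = 0} = CARD('b) ^ card C"
proof -
  let ?S = "{g :: 'p \<Rightarrow> 'b. \<forall>p. p \<notin> C \<longrightarrow> g p = 0}"
  have b: "bij_betw (\<lambda>g. restrict g C) ?S (PiE C (\<lambda>_. UNIV))"
    by (rule bij_betw_byWitness[where f' = "\<lambda>g p. if p \<in> C then g p else 0"])
       (auto simp: fun_eq_iff PiE_def extensional_def)
  have fin: "finite (PiE C (\<lambda>_. UNIV :: 'b set))" using assms by (intro finite_PiE) auto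
  show "finite ?S" using b fin bij_betw_finite by blast
  show "card ?S = CARD('b) ^ card C" using bij_betw_same_card[OF b] assms by (simp add: card_PiE)
qed

definition mpoly_space :: "'i::finite set \<Rightarrow> nat \<Rightarrow> (('i \<Rightarrow> nat) \<Rightarrow> 'b::zero) set" where
  "mpoly_space I N = {c. mpoly I N c}"

lemma mpoly_space_alt: "mpoly_space I N = {c. \<forall>\<alpha>. \<alpha> \<notin> exponents I N \<longrightarrow> c \<alpha> = 0}"
  by (auto simp: mpoly_space_def mpoly_def)

lemma finite_mpoly_space: "finite (mpoly_space I N :: (('i::finite \<Rightarrow> nat) \<Rightarrow> 'b::{zero,finite}) set)"
  unfolding mpoly_space_alt by (rule card_supported) simp

lemma card_mpoly_space: "card (mpoly_space I N :: (('i::finite \<Rightarrow> nat) \<Rightarrow> 'b::{zero,finite}) set) = CARD('b) ^ card (exponents I N)"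
  unfolding mpoly_space_alt by (rule card_supported) simp

lemma mpoly_diff: "mpoly I k c \<Longrightarrow> mpoly I k d \<Longrightarrow> mpoly I k (c - d :: _ \<Rightarrow> 'r::ab_group_add)"
  unfolding mpoly_def by (metis diff_zero minus_apply)

lemma eval_mp_diff:
  assumes "mpoly I k c" "mpoly I k d"
  shows "eval_mp (c - d) x = eval_mp c x - eval_mp d x"
  by (simp add: eval_mp_eq[OF mpoly_diff[OF assms]] eval_mp_eq[OF assms(1)] eval_mp_eq[OF assms(2)] left_diff_distrib sum_subtractf)

lemma hasse_diff: "hasse \<beta> (c - d) = hasse \<beta> c - hasse \<beta> d"
  by (simp add: hasse_def fun_eq_iff right_diff_distrib)

lemma hom_part_diff: "hom_part k (c - d :: _ \<Rightarrow> 'r::ab_group_add) = hom_part k c - hom_part k d"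
  by (simp add: hom_part_def fun_eq_iff)

lemma eval_mp_hasse_diff:
  assumes "mpoly I k c" "mpoly I k d"
  shows "eval_mp (hasse \<beta> (c - d)) x = eval_mp (hasse \<beta> c) x - eval_mp (hasse \<beta> d) x"
  unfolding hasse_diff by (rule eval_mp_diff[OF mpoly_hasse[OF assms(1)] mpoly_hasse[OF assms(2)]])

lemma vanishes_diff:
  assumes "mpoly I k c" "mpoly I k d" "vanishes c x M" "vanishes d x M"
  shows "vanishes (c - d) x M"
  using assms(3,4) unfolding vanishes_def eval_mp_hasse_diff[OF assms(1,2)] by simp

lemma mpoly_0: "mpoly I k 0"
  by (simp add: mpoly_def)

lemma vanishes_0: "vanishes (0 :: ('i::finite \<Rightarrow> nat) \<Rightarrow> 'r::comm_ring_1) x M"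
proof -
  have "hasse \<beta> (0 :: ('i \<Rightarrow> nat) \<Rightarrow> 'r) = (\<lambda>_. 0)" for \<beta> by (simp add: hasse_def fun_eq_iff)
  then show ?thesis by (simp add: vanishes_def)
qed

definition vanishing_polys :: "'i::finite set \<Rightarrow> nat \<Rightarrow> (('i \<Rightarrow> 'a) \<Rightarrow> nat) \<Rightarrow> (('i \<Rightarrow> nat) \<Rightarrow> 'a::{field,finite}) set" where
  "vanishing_polys I N M = {c. mpoly I N c \<and> (\<forall>u\<in>grid I UNIV. vanishes c u (M u))}"

lemma add_subgroup_vanishing_polys: "add_subgroup (vanishing_polys I N M)"
  by (auto simp: add_subgroup_def vanishing_polys_def mpoly_0 vanishes_0 mpoly_diff intro: vanishes_diff)

lemma vanishing_polys_mpoly_space: "vanishing_polys I N M \<subseteq> mpoly_space I N"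
  by (auto simp: vanishing_polys_def mpoly_space_def)

lemma finite_vanishing_polys: "finite (vanishing_polys I N M)"
  by (rule finite_subset[OF vanishing_polys_mpoly_space finite_mpoly_space])

text \<open>
The number of linear conditions imposed by vanishing to order \<open>m\<close> at a point.
\<close>
definition jet_dim :: "'i::finite set \<Rightarrow> nat \<Rightarrow> nat" where
  "jet_dim I m = card {\<beta>. (\<forall>i. i \<notin> I \<longrightarrow> \<beta> i = 0) \<and> tdeg \<beta> < m}"

text \<open>
Raising the required order at \<open>u\<close> from \<open>M0 u\<close> to \<open>M u\<close> imposes only the conditions of the
intermediate orders, and each condition divides the number of solutions by at most the size of the
field.
\<close>
lemma vanishing_polys_conditions:
  fixes M0 M :: "('i::finite \<Rightarrow> 'a::{field,finite}) \<Rightarrow> nat"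
  assumes le: "\<And>u. M0 u \<le> M u"
  shows "card (vanishing_polys I N M0) \<le>
    CARD('a) ^ (\<Sum>u\<in>grid I UNIV. jet_dim I (M u) - jet_dim I (M0 u)) * card (vanishing_polys I N M)"
proof -
  define T where "T m = {\<beta> :: 'i \<Rightarrow> nat. (\<forall>i. i \<notin> I \<longrightarrow> \<beta> i = 0) \<and> tdeg \<beta> < m}" for m
  have finT: "finite (T m)" for m
    by (rule finite_subset[OF _ finite_exponents[of I m]]) (auto simp: T_def exponents_def)
  define C where "C = (SIGMA u : (grid I UNIV :: ('i \<Rightarrow> 'a) set). T (M u) - T (M0 u))"
  have fing: "finite (grid I UNIV :: ('i \<Rightarrow> 'a) set)" by (rule finite_grid) simp
  have finC: "finite C" unfolding C_def using fing finT by auto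
  have "card C = (\<Sum>u\<in>grid I UNIV. card (T (M u) - T (M0 u)))"
    unfolding C_def by (rule card_SigmaI) (use fing finT in auto)
  also have "\<dots> = (\<Sum>u\<in>grid I UNIV. jet_dim I (M u) - jet_dim I (M0 u))"
  proof (rule sum.cong[OF refl])
    fix u
    show "card (T (M u) - T (M0 u)) = jet_dim I (M u) - jet_dim I (M0 u)"
      unfolding jet_dim_def T_def[symmetric] using finT le[of u]
      by (intro card_Diff_subset) (auto simp: T_def)
  qed
  finally have cardC: "card C = (\<Sum>u\<in>grid I UNIV. jet_dim I (M u) - jet_dim I (M0 u))" .
  let ?H = "vanishing_polys I N M0"
  define f where "f c = (\<lambda>p. if p \<in> C then eval_mp (hasse (snd p) c) (fst p) else 0)" for c :: "('i \<Rightarrow> nat) \<Rightarrow> 'a"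
  have "card ?H = card (f ` ?H) * card {c\<in>?H. f c = 0}"
  proof (rule card_hom[OF add_subgroup_vanishing_polys finite_vanishing_polys])
    fix c d assume "c \<in> ?H" "d \<in> ?H"
    then have "mpoly I N c" "mpoly I N d" by (auto simp: vanishing_polys_def)
    from eval_mp_hasse_diff[OF this] show "f (c - d) = f c - f d"
      by (simp add: f_def fun_eq_iff)
  qed
  also have "{c\<in>?H. f c = 0} = vanishing_polys I N M"
  proof (intro equalityI subsetI)
    fix c assume c: "c \<in> {c\<in>?H. f c = 0}"
    then have cp: "mpoly I N c" by (auto simp: vanishing_polys_def)
    have "vanishes c u (M u)" if u: "u \<in> grid I UNIV" for u
      unfolding vanishes_def
    proof (intro allI impI)
      fix \<beta> :: "'i \<Rightarrow> nat" assume \<beta>: "tdeg \<beta> < M u"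
      show "eval_mp (hasse \<beta> c) u = 0"
      proof (cases "\<forall>i. i \<notin> I \<longrightarrow> \<beta> i = 0")
        case True
        show ?thesis
        proof (cases "tdeg \<beta> < M0 u")
          case True
          then show ?thesis using c u by (auto simp: vanishing_polys_def vanishes_def)
        next
          case False
          then have "(u, \<beta>) \<in> C" using True \<beta> u by (auto simp: C_def T_def)
          moreover have "f c (u, \<beta>) = 0" using c by simp
          ultimately show ?thesis by (simp add: f_def)
        qed
      next
        case False
        then obtain i where i: "i \<notin> I" "\<beta> i \<noteq> 0" by blast
        have "c (\<lambda>i. \<beta> i + \<delta> i) = 0" for \<delta>
          using cp i unfolding mpoly_def exponents_def by fastforce
        then have "hasse \<beta> c = (\<lambda>_. 0)" by (simp add: hasse_def fun_eq_iff)
        then show ?thesis by simp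
      qed
    qed
    then show "c \<in> vanishing_polys I N M" using cp by (auto simp: vanishing_polys_def)
  next
    fix c assume c: "c \<in> vanishing_polys I N M"
    then have "f c = 0" by (auto simp: f_def fun_eq_iff C_def T_def vanishing_polys_def vanishes_def)
    moreover have "c \<in> ?H" using c le unfolding vanishing_polys_def vanishes_def by (auto intro: less_le_trans)
    ultimately show "c \<in> {c\<in>?H. f c = 0}" by simp
  qed
  also have "card (f ` ?H) \<le> card {g :: _ \<Rightarrow> 'a. \<forall>p. p \<notin> C \<longrightarrow> g p = 0}"
    by (rule card_mono[OF card_supported(1)[OF finC]]) (auto simp: f_def)
  also have "\<dots> = CARD('a) ^ card C" by (rule card_supported(2)[OF finC])
  finally show ?thesis by (simp add: cardC)
qed

text \<open>
The degree \<open>k\<close> component of the graded space associated with the filtration of \<open>H\<close> by degree.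
\<close>
definition top_forms :: "'i::finite set \<Rightarrow> nat \<Rightarrow> (('i \<Rightarrow> nat) \<Rightarrow> 'b::zero) set \<Rightarrow> (('i \<Rightarrow> nat) \<Rightarrow> 'b) set" where
  "top_forms I k H = hom_part k ` {c\<in>H. mpoly I k c}"

lemma add_subgroup_top_forms:
  fixes H :: "(('i::finite \<Rightarrow> nat) \<Rightarrow> 'b::ab_group_add) set"
  assumes "add_subgroup H" shows "add_subgroup (top_forms I k H)"
  unfolding add_subgroup_def
proof (intro conjI ballI)
  have "0 = hom_part k (0 :: ('i \<Rightarrow> nat) \<Rightarrow> 'b)" by (simp add: hom_part_def fun_eq_iff)
  then show "0 \<in> top_forms I k H" using assms mpoly_0 unfolding top_forms_def add_subgroup_def by blast
  fix x y assume "x \<in> top_forms I k H" "y \<in> top_forms I k H"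
  then obtain c d where "x = hom_part k c" "y = hom_part k d" "c \<in> H" "d \<in> H" "mpoly I k c" "mpoly I k d"
    by (auto simp: top_forms_def)
  then show "x - y \<in> top_forms I k H"
    using assms mpoly_diff[of I k c d] unfolding top_forms_def add_subgroup_def by (auto simp flip: hom_part_diff)
qed

lemma card_graded:
  fixes H :: "(('i::finite \<Rightarrow> nat) \<Rightarrow> 'b::{ab_group_add,finite}) set"
  assumes "add_subgroup H" "H \<subseteq> mpoly_space I N"
  shows "card H = (\<Prod>k\<le>N. card (top_forms I k H))"
proof -
  have fin: "finite H" using assms finite_mpoly_space finite_subset by blast
  have "card {c\<in>H. mpoly I n c} = (\<Prod>k\<le>n. card (top_forms I k H))" for n
  proof (induction n)
    case 0
    have "hom_part 0 c = c" if "mpoly I 0 c" for c :: "('i \<Rightarrow> nat) \<Rightarrow> 'b"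
      using that unfolding mpoly_def exponents_def hom_part_def by (fastforce simp: fun_eq_iff)
    then have "top_forms I 0 H = {c\<in>H. mpoly I 0 c}" unfolding top_forms_def by force
    then show ?case by simp
  next
    case (Suc n)
    let ?Y = "{c\<in>H. mpoly I (Suc n) c}"
    have "add_subgroup ?Y" using assms(1) by (auto simp: add_subgroup_def mpoly_0 mpoly_diff)
    then have "card ?Y = card (hom_part (Suc n) ` ?Y) * card {c\<in>?Y. hom_part (Suc n) c = 0}"
      by (rule card_hom) (use fin in \<open>auto simp: hom_part_diff\<close>)
    also have "{c\<in>?Y. hom_part (Suc n) c = 0} = {c\<in>H. mpoly I n c}"
    proof -
      have "mpoly I (Suc n) c \<and> hom_part (Suc n) c = 0 \<longleftrightarrow> mpoly I n c" for c :: "('i \<Rightarrow> nat) \<Rightarrow> 'b"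
      proof
        assume c: "mpoly I (Suc n) c \<and> hom_part (Suc n) c = 0"
        show "mpoly I n c" unfolding mpoly_def
        proof (intro allI impI)
          fix \<alpha> assume nz: "c \<alpha> \<noteq> 0"
          have "hom_part (Suc n) c \<alpha> = 0" using c by simp
          then have "tdeg \<alpha> \<noteq> Suc n" using nz by (auto simp: hom_part_def)
          moreover have "\<alpha> \<in> exponents I (Suc n)" using c nz by (auto simp: mpoly_def)
          ultimately show "\<alpha> \<in> exponents I n" by (auto simp: exponents_def)
        qed
      next
        assume c: "mpoly I n c"
        then have "hom_part (Suc n) c = 0" unfolding mpoly_def exponents_def hom_part_def by (fastforce simp: fun_eq_iff)
        then show "mpoly I (Suc n) c \<and> hom_part (Suc n) c = 0" using mpoly_mono[OF c, of I "Suc n"] by simp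
      qed
      then show ?thesis by auto
    qed
    finally show ?case using Suc by (simp add: top_forms_def mult.commute)
  qed
  moreover have "{c\<in>H. mpoly I N c} = H" using assms(2) by (auto simp: mpoly_space_def)
  ultimately show ?thesis by metis
qed

section \<open>Weights of directions\<close>

lemma tr_point_grid:
  assumes "z \<in> grid I (ext_field a)"
  shows "tr_point a z y \<in> grid I UNIV"
proof -
  have "z i = 0" if "i \<notin> I" for i using assms that by (simp add: grid_def)
  then show ?thesis by (simp add: grid_def tr_point_def tr_def zero_power)
qed

lemma inj_tr_point:
  assumes "z \<in> generic I a"
  shows "inj_on (tr_point a z) (ext_field a)"
proof (rule inj_onI)
  fix x y assume xy: "x \<in> ext_field a" "y \<in> ext_field a" "tr_point a z x = tr_point a z y"
  have z: "z \<in> grid I (ext_field a)" using assms by (simp add: generic_def)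
  have "tr a (z i * x) = tr a (z i * y)" for i
    using to_ac_tr_point[OF z xy(1), of i] to_ac_tr_point[OF z xy(2), of i] xy(3) by simp
  moreover have "tr a (z i * x) = tr a (z i * (x - y)) + tr a (z i * y)" for i
    by (simp flip: tr_add add: right_diff_distrib)
  ultimately have "tr a (z i * (x - y)) = 0" for i by simp
  then have "x - y = 0" using assms ext_field_closed(2)[OF xy(1,2)] unfolding generic_def by blast
  then show "x = y" by simp
qed

text \<open>
Taking the directions as images of generic parameters makes the trace parametrization available
without a choice of basis.
\<close>
definition directions :: "'i::finite set \<Rightarrow> nat \<Rightarrow> ('i \<Rightarrow> 'a::{field,finite}) set set" where
  "directions I a = (\<lambda>z. tr_point a z ` ext_field a) ` generic I a"

lemma lift_diff: "lift (c - d) = lift c - lift d"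
  by (simp add: lift_def fun_eq_iff)

lemma lift_0: "lift 0 = 0"
  by (simp add: lift_def fun_eq_iff)

lemma lift_hom_part: "lift (hom_part k c) = hom_part k (lift c)"
  by (simp add: lift_def hom_part_def fun_eq_iff)

lemma finite_generic: "a > 0 \<Longrightarrow> finite (generic I a)"
  by (rule finite_subset[of _ "grid I (ext_field a)"]) (auto simp: generic_def intro: finite_grid card_ext_field)

text \<open>
Schwartz--Zippel on the grid \<open>(ext_field a)\<^bsup>I\<^esup>\<close>, on which the Frobenius image of the generic points
has relative size at least \<open>1 - 1/q\<close>.
\<close>
lemma forms_vanishing_generic:
  fixes c :: "('i::finite \<Rightarrow> nat) \<Rightarrow> 'a::{field,finite} alg_closure"
  defines "q \<equiv> CARD('a)"
  assumes a: "a > 0" and d: "a < card I" and c: "mpoly I k c"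
    and v: "\<And>z. z \<in> generic I a \<Longrightarrow> vanishes c (\<lambda>i. z i ^ (q ^ (a - 1))) m"
    and k: "k < m * (q ^ a - q ^ (a - 1))"
  shows "c = 0"
proof (rule ccontr)
  assume nz: "c \<noteq> 0"
  define e where "e = q ^ (a - 1)"
  have e: "e > 0" by (simp add: e_def q_def)
  note K = card_ext_field[OF a, where 'a='a]
  let ?K = "ext_field a :: 'a alg_closure set" let ?d = "card I"
  let ?G = "generic I a :: ('i \<Rightarrow> 'a alg_closure) set"
  define Fr where "Fr z = (\<lambda>i::'i. z i ^ e)" for z :: "'i \<Rightarrow> 'a alg_closure"
  have fing: "finite (grid I ?K)" by (rule finite_grid[OF K(1)])
  have sub: "Fr ` ?G \<subseteq> grid I ?K"
    using frobenius_inj(2)[OF a, where 'a='a] e by (auto simp: Fr_def generic_def grid_def e_def q_def zero_power)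
  have inj: "inj_on Fr ?G"
  proof (rule inj_onI)
    fix x y assume xy: "x \<in> ?G" "y \<in> ?G" "Fr x = Fr y"
    have "x i \<in> ?K" "y i \<in> ?K" for i
      using xy zero_in_ext_field by (cases "i \<in> I"; auto simp: generic_def grid_def)+
    moreover have "x i ^ e = y i ^ e" for i using xy(3) unfolding Fr_def by metis
    ultimately show "x = y"
      using frobenius_inj(1)[OF a, where 'a='a] unfolding e_def q_def by (auto simp: fun_eq_iff dest: inj_onD)
  qed
  let ?\<mu> = "\<lambda>x. if x \<in> Fr ` ?G then m else 0"
  have "card ?K * (\<Sum>x\<in>grid I ?K. ?\<mu> x) \<le> k * card ?K ^ ?d"
  proof (rule schwartz_zippel_mult[OF K(1) c])
    show "c \<noteq> (\<lambda>_. 0)" using nz by (simp add: zero_fun_def)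
    show "vanishes c x (?\<mu> x)" for x
      using v by (auto simp: Fr_def e_def) (simp add: vanishes_def)
  qed
  also have "(\<Sum>x\<in>grid I ?K. ?\<mu> x) = m * card ?G"
    using sub fing by (simp add: sum.inter_restrict[symmetric] Int_absorb1 card_image[OF inj] mult.commute)
  finally have 1: "m * (q ^ a * card ?G) \<le> k * (q ^ a) ^ ?d" using K by (simp add: q_def mult_ac)
  have "m * ((q ^ a) ^ ?d * (q ^ a - e)) \<le> m * (q ^ a * card ?G)"
    using card_generic[OF a d, where 'a='a] by (intro mult_le_mono2) (simp add: q_def e_def)
  with 1 have "m * ((q ^ a) ^ ?d * (q ^ a - e)) \<le> k * (q ^ a) ^ ?d" by linarith
  then have "(m * (q ^ a - e)) * (q ^ a) ^ ?d \<le> k * (q ^ a) ^ ?d" by (simp only: mult_ac)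
  moreover have "(q ^ a) ^ ?d > 0" by (simp add: q_def)
  ultimately have "m * (q ^ a - e) \<le> k" by (rule mult_right_le_imp_le)
  then show False using k by (simp add: e_def)
qed

lemma jet_dim_0: "jet_dim I 0 = 0"
  by (simp add: jet_dim_def)

lemma jet_dim_mono: "m \<le> m' \<Longrightarrow> jet_dim I m \<le> jet_dim I m'"
  unfolding jet_dim_def
  by (rule card_mono[OF finite_subset[OF _ finite_exponents[of I m']]]) (auto simp: exponents_def)

text \<open>
The weight of a direction is the sum over the degrees \<open>k \<le> N\<close> of its weight from \<open>chain_weights\<close>,
where \<open>J\<close> consists of the degree \<open>k\<close> top forms of the polynomials vanishing to order \<open>m0\<close> at all
points, and the condition of a direction is vanishing to order \<open>m\<close> at its parameters. All
conditions together leave only \<open>0\<close>, so the weights sum up to the logarithmic size of that space of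
polynomials. If the directions in \<open>D\<close> are rich for \<open>E\<close>, the polynomials with the higher order \<open>m1\<close>
on \<open>E\<close> have top forms satisfying the conditions in \<open>D\<close>; so this space is smaller by at least the
weight of \<open>D\<close>, yet it is cut out by \<open>card E * (jet_dim I m1 - jet_dim I m0)\<close> conditions.
\<close>
theorem direction_weights:
  fixes I :: "'i::finite set"
  defines "q \<equiv> CARD('a::{field,finite})"
  assumes a: "a > 0" and d: "a < card I" and m01: "m0 \<le> m1"
    and N: "N < m * (q ^ a - q ^ (a - 1))"
  shows "\<exists>w :: ('i \<Rightarrow> 'a) set \<Rightarrow> real. (\<forall>S. w S \<ge> 0) \<and>
    real (card (exponents I N)) - real (q ^ card I * jet_dim I m0) \<le> (\<Sum>S\<in>directions I a. w S) \<and>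
    (\<forall>E D. E \<subseteq> grid I UNIV \<longrightarrow> D \<subseteq> directions I a \<longrightarrow>
       (\<forall>S\<in>D. \<exists>u\<in>grid I UNIV. N * q ^ (a - 1) + (m - 1) * (q ^ a - q ^ (a - 1))
           < m0 * q ^ a + (m1 - m0) * card {x\<in>S. (\<lambda>i. u i + x i) \<in> E}) \<longrightarrow>
       (\<Sum>S\<in>D. w S) \<le> real (card E) * (real (jet_dim I m1) - real (jet_dim I m0)))"
proof -
  define e where "e = q ^ (a - 1)"
  note K = card_ext_field[OF a, where 'a='a]
  have q1: "real q > 1" using card_field_gt_1[where 'a='a] by (simp add: q_def)
  define A where "A = (vanishing_polys I N (\<lambda>_. m0) :: (('i \<Rightarrow> nat) \<Rightarrow> 'a) set)"
  define J where "J k = top_forms I k A" for k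
  define Z where "Z S = {c \<in> mpoly_space I N. \<forall>z\<in>generic I a. tr_point a z ` ext_field a = S \<longrightarrow> vanishes (lift c) (\<lambda>i. z i ^ e) m}"
    for S :: "('i \<Rightarrow> 'a) set"
  have sgZ: "add_subgroup (Z S)" for S
    by (auto simp: add_subgroup_def Z_def mpoly_space_def mpoly_0 mpoly_diff lift_0 vanishes_0 lift_diff
        intro!: vanishes_diff[OF mpoly_lift mpoly_lift])
  have sgJ: "add_subgroup (J k)" for k unfolding J_def A_def by (rule add_subgroup_top_forms[OF add_subgroup_vanishing_polys])
  have finJ: "finite (J k)" for k unfolding J_def A_def top_forms_def
    by (rule finite_imageI, rule finite_subset[OF _ finite_vanishing_polys]) auto
  have findirs: "finite (directions I a :: ('i \<Rightarrow> 'a) set set)" unfolding directions_def by (intro finite_imageI finite_generic a)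
  let ?L = "\<lambda>k D. log q (card (J k \<inter> (\<Inter>S\<in>D. Z S)))"
  define P where "P k w \<longleftrightarrow> (\<forall>S. w S \<ge> 0) \<and> (\<Sum>S\<in>directions I a. w S) = ?L k {} - ?L k (directions I a) \<and>
           (\<forall>D\<subseteq>directions I a. (\<Sum>S\<in>D. w S) \<le> ?L k {} - ?L k D)" for k and w :: "('i \<Rightarrow> 'a) set \<Rightarrow> real"
  have "\<exists>w. P k w" for k
    unfolding P_def by (rule chain_weights[OF findirs q1 sgJ finJ sgZ])
  then obtain W where P: "\<And>k. P k (W k)" by metis
  have W: "\<And>k S. W k S \<ge> 0" "\<And>k. (\<Sum>S\<in>directions I a. W k S) = ?L k {} - ?L k (directions I a)"
    "\<And>k D. D \<subseteq> directions I a \<Longrightarrow> (\<Sum>S\<in>D. W k S) \<le> ?L k {} - ?L k D"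
    using P unfolding P_def by blast+
  have L0: "?L k (directions I a) = 0" if k: "k \<le> N" for k
  proof -
    have "c = 0" if c: "c \<in> J k \<inter> (\<Inter>S\<in>directions I a. Z S)" for c
    proof -
      have cp: "mpoly I k c" using c by (auto simp: J_def top_forms_def intro: mpoly_hom_part)
      have "lift c = 0"
      proof (rule forms_vanishing_generic[OF a d mpoly_lift[OF cp]])
        show "k < m * (CARD('a) ^ a - CARD('a) ^ (a - 1))" using k N by (simp add: q_def)
        fix z :: "'i \<Rightarrow> 'a alg_closure" assume z: "z \<in> generic I a"
        then have "c \<in> Z (tr_point a z ` ext_field a)" using c by (auto simp: directions_def)
        then show "vanishes (lift c) (\<lambda>i. z i ^ CARD('a) ^ (a - 1)) m"
          using z by (auto simp: Z_def e_def q_def)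
      qed
      then have "to_ac (c \<alpha>) = 0" for \<alpha> by (metis lift_def zero_fun_apply)
      then show ?thesis by (simp add: fun_eq_iff)
    qed
    moreover have "0 \<in> J k \<inter> (\<Inter>S\<in>directions I a. Z S)" using sgJ[of k] sgZ by (auto simp: add_subgroup_def)
    ultimately have "J k \<inter> (\<Inter>S\<in>directions I a. Z S) = {0}" by blast
    then show ?thesis by simp
  qed
  have logprod: "log q (\<Prod>k\<in>B. real (f k)) = (\<Sum>k\<in>B. log q (f k))" if "finite B" "\<And>k. k \<in> B \<Longrightarrow> f k > 0" for f :: "nat \<Rightarrow> nat" and B
    using that q1 by (induction B rule: finite_induct) (auto simp: log_mult_pos prod_pos)
  have logA: "log q (card H) = (\<Sum>k\<le>N. log q (card (top_forms I k H)))" if "add_subgroup H" "H \<subseteq> mpoly_space I N" for H :: "(('i \<Rightarrow> nat) \<Rightarrow> 'a) set"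
  proof -
    have "finite H" using that finite_mpoly_space finite_subset by blast
    then have "card (top_forms I k H) > 0" for k
      by (intro add_subgroup_card_pos add_subgroup_top_forms that) (auto simp: top_forms_def)
    then show ?thesis unfolding card_graded[OF that] of_nat_prod by (intro logprod) auto
  qed
  have logcond: "log q (card (vanishing_polys I N M0 :: (('i \<Rightarrow> nat) \<Rightarrow> 'a) set)) \<le>
      real (\<Sum>u\<in>grid I UNIV. jet_dim I (M u) - jet_dim I (M0 u)) + log q (card (vanishing_polys I N M :: (('i \<Rightarrow> nat) \<Rightarrow> 'a) set))"
    if "\<And>u. M0 u \<le> M u" for M0 M :: "('i \<Rightarrow> 'a) \<Rightarrow> nat"
  proof -
    let ?s = "\<Sum>u\<in>grid I UNIV. jet_dim I (M u) - jet_dim I (M0 u)"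
    have pos: "0 < real (card (vanishing_polys I N M' :: (('i \<Rightarrow> nat) \<Rightarrow> 'a) set))" for M'
      using add_subgroup_card_pos[OF add_subgroup_vanishing_polys finite_vanishing_polys] by simp
    have qs: "0 < real q ^ ?s" using q1 by simp
    have "real (card (vanishing_polys I N M0 :: (('i \<Rightarrow> nat) \<Rightarrow> 'a) set)) \<le> real q ^ ?s * real (card (vanishing_polys I N M :: (('i \<Rightarrow> nat) \<Rightarrow> 'a) set))"
      using vanishing_polys_conditions[of M0 M I N, OF that] unfolding q_def
      by (metis of_nat_le_iff of_nat_mult of_nat_power)
    then have "log q (card (vanishing_polys I N M0 :: (('i \<Rightarrow> nat) \<Rightarrow> 'a) set)) \<le> log q (real q ^ ?s * real (card (vanishing_polys I N M :: (('i \<Rightarrow> nat) \<Rightarrow> 'a) set)))"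
      by (intro log_le_cancel_iff[OF q1 pos mult_pos_pos[OF qs pos], THEN iffD2])
    then show ?thesis unfolding log_mult_pos[OF qs pos] using q1 by (simp add: log_nat_power)
  qed
  define w where "w S = (\<Sum>k\<le>N. W k S)" for S
  have wD: "(\<Sum>S\<in>D. w S) = (\<Sum>k\<le>N. \<Sum>S\<in>D. W k S)" for D
    unfolding w_def by (rule sum.swap)
  have totA: "(\<Sum>k\<le>N. ?L k {}) = log q (card A)"
  proof -
    have "log q (card A) = (\<Sum>k\<le>N. log q (card (top_forms I k A)))"
      unfolding A_def by (rule logA[OF add_subgroup_vanishing_polys vanishing_polys_mpoly_space])
    then show ?thesis by (simp add: J_def)
  qed
  show ?thesis
  proof (intro exI[of _ w] conjI allI impI)
    show "0 \<le> w S" for S unfolding w_def by (intro sum_nonneg W)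
    have "(\<Sum>S\<in>directions I a. w S) = log q (card A)"
      unfolding wD W(2) totA[symmetric] by (rule sum.cong) (simp_all add: L0)
    moreover have "real (card (exponents I N)) \<le> real (q ^ card I * jet_dim I m0) + log q (card A)"
    proof -
      have v0: "vanishing_polys I N (\<lambda>_. 0) = (mpoly_space I N :: (('i \<Rightarrow> nat) \<Rightarrow> 'a) set)"
        by (auto simp: vanishing_polys_def mpoly_space_def vanishes_def)
      have "log q (card (mpoly_space I N :: (('i \<Rightarrow> nat) \<Rightarrow> 'a) set)) = real (card (exponents I N))"
        unfolding card_mpoly_space using q1 by (simp add: q_def log_nat_power)
      moreover have "(\<Sum>u\<in>(grid I UNIV :: ('i \<Rightarrow> 'a) set). jet_dim I m0 - jet_dim I 0) = q ^ card I * jet_dim I m0"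
        by (simp add: jet_dim_0 card_grid q_def)
      ultimately show ?thesis
        using logcond[of "\<lambda>_. 0" "\<lambda>_. m0"] by (simp add: v0 A_def)
    qed
    ultimately show "real (card (exponents I N)) - real (q ^ card I * jet_dim I m0) \<le> (\<Sum>S\<in>directions I a. w S)" by simp
  next
    fix E :: "('i \<Rightarrow> 'a) set" and D
    assume E: "E \<subseteq> grid I UNIV" and D: "D \<subseteq> directions I a"
      and rich: "\<forall>S\<in>D. \<exists>u\<in>grid I UNIV. N * q ^ (a - 1) + (m - 1) * (q ^ a - q ^ (a - 1))
           < m0 * q ^ a + (m1 - m0) * card {x\<in>S. (\<lambda>i. u i + x i) \<in> E}"
    define M where "M u = (if u \<in> E then m1 else m0)" for u
    define V where "V = (vanishing_polys I N M :: (('i \<Rightarrow> nat) \<Rightarrow> 'a) set)"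
    have fing: "finite (grid I UNIV :: ('i \<Rightarrow> 'a) set)" by (rule finite_grid) simp
    have VA: "V \<subseteq> A" unfolding V_def A_def vanishing_polys_def vanishes_def M_def using m01 by (auto intro: less_le_trans)
    have sub: "top_forms I k V \<subseteq> J k \<inter> (\<Inter>S\<in>D. Z S)" if k: "k \<le> N" for k
    proof
      fix f assume "f \<in> top_forms I k V"
      then obtain c where c: "c \<in> V" "mpoly I k c" "f = hom_part k c" by (auto simp: top_forms_def)
      have "f \<in> J k" using c VA by (auto simp: J_def top_forms_def)
      moreover have "f \<in> Z S" if S: "S \<in> D" for S
      proof -
        obtain u where u: "u \<in> grid I UNIV"
          and big: "N * q ^ (a - 1) + (m - 1) * (q ^ a - q ^ (a - 1)) < m0 * q ^ a + (m1 - m0) * card {x\<in>S. (\<lambda>i. u i + x i) \<in> E}"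
          using rich S by blast
        have "vanishes (hom_part k (lift c)) (\<lambda>i. z i ^ e) m" if z: "z \<in> generic I a" and zS: "tr_point a z ` ext_field a = S" for z
          unfolding e_def q_def
        proof (rule top_vanishing[OF a c(2), where M = "\<lambda>y. M (\<lambda>i. u i + tr_point a z y i)" and u = u])
          show zg: "z \<in> grid I (ext_field a)" using z by (simp add: generic_def)
          show "vanishes c (\<lambda>i. u i + tr_point a z y i) (M (\<lambda>i. u i + tr_point a z y i))" for y
          proof -
            have "(\<lambda>i. u i + tr_point a z y i) \<in> grid I UNIV"
              using u tr_point_grid[OF zg, of y] by (simp add: grid_def)
            then show ?thesis using c(1) by (auto simp: V_def vanishing_polys_def)
          qed
          have bij: "bij_betw (tr_point a z) (ext_field a) S" using inj_tr_point[OF z] zS by (simp add: bij_betw_def)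
          have finS: "finite S" using zS K(1) by auto
          have cS: "card S = q ^ a" using bij_betw_same_card[OF bij] K(2) by (simp add: q_def)
          have "(\<Sum>y\<in>ext_field a. M (\<lambda>i. u i + tr_point a z y i)) = (\<Sum>x\<in>S. M (\<lambda>i. u i + x i))"
            using sum.reindex_bij_betw[OF bij, of "\<lambda>x. M (\<lambda>i. u i + x i)"] .
          also have "\<dots> = (\<Sum>x\<in>S. m0 + (if (\<lambda>i. u i + x i) \<in> E then m1 - m0 else 0))"
            by (rule sum.cong) (use m01 in \<open>auto simp: M_def\<close>)
          also have "\<dots> = m0 * q ^ a + (m1 - m0) * card {x\<in>S. (\<lambda>i. u i + x i) \<in> E}"
            by (simp add: sum.distrib cS mult.commute sum.inter_filter[OF finS, symmetric])
          finally have tot: "(\<Sum>y\<in>ext_field a. M (\<lambda>i. u i + tr_point a z y i)) = m0 * q ^ a + (m1 - m0) * card {x\<in>S. (\<lambda>i. u i + x i) \<in> E}" .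
          have "k * q ^ (a - 1) \<le> N * q ^ (a - 1)" using k by simp
          with big tot show "k * CARD('a) ^ (a - 1) + (m - 1) * (CARD('a) ^ a - CARD('a) ^ (a - 1))
              < (\<Sum>y\<in>ext_field a. M (\<lambda>i. u i + tr_point a z y i))"
            unfolding q_def by linarith
        qed
        moreover have "f \<in> mpoly_space I N"
          unfolding c(3) mpoly_space_def using mpoly_mono[OF mpoly_hom_part[OF c(2)], of I N k] k by auto
        ultimately show ?thesis by (auto simp: Z_def c(3) lift_hom_part)
      qed
      ultimately show "f \<in> J k \<inter> (\<Inter>S\<in>D. Z S)" by blast
    qed
    have "log q (card V) = (\<Sum>k\<le>N. log q (card (top_forms I k V)))"
      unfolding V_def by (rule logA[OF add_subgroup_vanishing_polys vanishing_polys_mpoly_space])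
    also have "\<dots> \<le> (\<Sum>k\<le>N. ?L k D)"
    proof (rule sum_mono)
      fix k assume "k \<in> {..N}"
      then have s: "top_forms I k V \<subseteq> J k \<inter> (\<Inter>S\<in>D. Z S)" using sub by simp
      have f: "finite (J k \<inter> (\<Inter>S\<in>D. Z S))" using finJ by auto
      have sgV: "add_subgroup (top_forms I k V)" unfolding V_def by (rule add_subgroup_top_forms[OF add_subgroup_vanishing_polys])
      have p: "0 < real (card (top_forms I k V))"
        using add_subgroup_card_pos[OF sgV finite_subset[OF s f]] by simp
      have "card (top_forms I k V) \<le> card (J k \<inter> (\<Inter>S\<in>D. Z S))" by (rule card_mono[OF f s])
      then show "log q (card (top_forms I k V)) \<le> ?L k D"
        using p by (intro log_le_cancel_iff[OF q1, THEN iffD2]) auto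
    qed
    also have "\<dots> \<le> (\<Sum>k\<le>N. ?L k {} - (\<Sum>S\<in>D. W k S))"
      by (rule sum_mono) (use W(3)[OF D] in \<open>simp add: algebra_simps\<close>)
    also have "\<dots> = log q (card A) - (\<Sum>S\<in>D. w S)"
      unfolding wD sum_subtractf totA ..
    finally have 1: "log q (card V) \<le> log q (card A) - (\<Sum>S\<in>D. w S)" .
    have "log q (card A) \<le> real (\<Sum>u\<in>(grid I UNIV :: ('i \<Rightarrow> 'a) set). jet_dim I (M u) - jet_dim I m0) + log q (card V)"
      using logcond[of "\<lambda>_. m0" M] m01 by (auto simp: A_def V_def M_def)
    also have "(\<Sum>u\<in>(grid I UNIV :: ('i \<Rightarrow> 'a) set). jet_dim I (M u) - jet_dim I m0) = (\<Sum>u\<in>E. jet_dim I m1 - jet_dim I m0)"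
      using E fing by (intro sum.mono_neutral_cong_right) (auto simp: M_def)
    also have "\<dots> = card E * (jet_dim I m1 - jet_dim I m0)" by simp
    finally have "(\<Sum>S\<in>D. w S) \<le> real (card E * (jet_dim I m1 - jet_dim I m0))" using 1 by linarith
    then show "(\<Sum>S\<in>D. w S) \<le> real (card E) * (real (jet_dim I m1) - real (jet_dim I m0))"
      using jet_dim_mono[OF m01, of I] by (simp add: of_nat_diff)
  qed
qed

section \<open>Passing to the limit\<close>

lemma card_exponents:
  fixes I :: "'i::finite set"
  shows "card (exponents I k) = (card I + k) choose card I"
  using finite[of I]
proof (induction I arbitrary: k rule: finite_induct)
  case empty
  have "(exponents {} k :: ('i \<Rightarrow> nat) set) = {\<lambda>i. 0}" by (auto simp: exponents_def)
  then show ?case by simp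
next
  case (insert v I)
  have "bij_betw (\<lambda>(r, \<alpha>). \<alpha>(v := r)) (SIGMA r : {..k}. exponents I (k - r)) (exponents (insert v I) k)"
  proof (rule bij_betw_byWitness[where f' = "\<lambda>\<alpha>. (\<alpha> v, \<alpha>(v := 0))"])
    show "\<forall>p\<in>SIGMA r : {..k}. exponents I (k - r). (\<lambda>\<alpha>. (\<alpha> v, \<alpha>(v := 0))) ((\<lambda>(r, \<alpha>). \<alpha>(v := r)) p) = p"
      using insert.hyps by (auto simp: exponents_def fun_eq_iff)
    show "\<forall>\<alpha>\<in>exponents (insert v I) k. (\<lambda>(r, \<alpha>). \<alpha>(v := r)) ((\<lambda>\<alpha>. (\<alpha> v, \<alpha>(v := 0))) \<alpha>) = \<alpha>"
      by auto
    show "(\<lambda>(r, \<alpha>). \<alpha>(v := r)) ` (SIGMA r : {..k}. exponents I (k - r)) \<subseteq> exponents (insert v I) k"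
      using insert.hyps by (auto simp: exponents_def tdeg_upd)
    show "(\<lambda>\<alpha>. (\<alpha> v, \<alpha>(v := 0))) ` exponents (insert v I) k \<subseteq> (SIGMA r : {..k}. exponents I (k - r))"
    proof clarify
      fix \<alpha> assume a: "\<alpha> \<in> exponents (insert v I) k"
      have "tdeg \<alpha> = tdeg (\<alpha>(v := 0)) + \<alpha> v" using tdeg_upd[of "\<alpha>(v := 0)" v "\<alpha> v"] by simp
      then show "\<alpha> v \<in> {..k} \<and> \<alpha>(v := 0) \<in> exponents I (k - \<alpha> v)"
        using a by (auto simp: exponents_def)
    qed
  qed
  then have "card (exponents (insert v I) k) = card (SIGMA r : {..k}. exponents I (k - r))"
    by (metis bij_betw_same_card)
  also have "\<dots> = (\<Sum>r\<le>k. (card I + (k - r)) choose card I)"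
    by (simp add: card_SigmaI insert.IH)
  also have "\<dots> = (\<Sum>j\<le>k. (card I + j) choose card I)"
    by (rule sum.reindex_bij_witness[of _ "\<lambda>j. k - j" "\<lambda>j. k - j"]) auto
  also have "\<dots> = (card I + k + 1) choose (card I + 1)" by (rule choose_rising_sum(1))
  finally show ?case using insert.hyps by simp
qed

text \<open>
Together with the next lemma: up to the factor \<open>d!\<close>, the number of monomials is asymptotically the
\<open>d\<close>-th power of the degree.
\<close>
lemma pow_le_fact_choose: "(Suc k) ^ d \<le> fact d * ((d + k) choose d)"
proof (induction d)
  case (Suc d)
  have "Suc k ^ Suc d \<le> Suc (d + k) * (fact d * ((d + k) choose d))"
    using Suc by (simp only: power_Suc) (intro mult_le_mono, auto)
  also have "\<dots> = fact d * (Suc (d + k) * ((d + k) choose d))" by (simp only: mult_ac)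
  also have "Suc (d + k) * ((d + k) choose d) = Suc d * (Suc (d + k) choose Suc d)"
    by (rule Suc_times_binomial[symmetric])
  also have "fact d * (Suc d * (Suc (d + k) choose Suc d)) = fact (Suc d) * ((Suc d + k) choose Suc d)"
    by (simp only: fact_Suc of_nat_id mult_ac add_Suc)
  finally show ?case .
qed simp

lemma fact_choose_le_pow: "fact d * ((d + k) choose d) \<le> (Suc k + d) ^ d"
proof -
  have "fact d * ((d + k) choose d) \<le> (d + k) ^ d"
    using binomial_fact_pow[of "d + k" d] by (simp add: mult.commute)
  also have "\<dots> \<le> (Suc k + d) ^ d" by (rule power_mono) auto
  finally show ?thesis .
qed

lemma jet_dim_Suc: "jet_dim I (Suc k) = card (exponents I k)"
  unfolding jet_dim_def exponents_def by (simp add: less_Suc_eq_le)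

lemma exponents_lower: "real (Suc k) ^ card I \<le> fact (card I) * real (card (exponents I k))"
  unfolding card_exponents using pow_le_fact_choose[of k "card I"]
  by (metis of_nat_fact of_nat_le_iff of_nat_mult of_nat_power)

lemma jet_dim_lower:
  assumes "card I > 0"
  shows "real m ^ card I \<le> fact (card I) * real (jet_dim I m)"
  using assms exponents_lower[of _ I] by (cases m) (auto simp: jet_dim_Suc jet_dim_0 zero_power)

lemma jet_dim_upper: "fact (card I) * real (jet_dim I m) \<le> (real m + real (card I)) ^ card I"
proof (cases m)
  case 0
  then show ?thesis by (simp add: jet_dim_0)
next
  case (Suc k)
  have "real (fact (card I) * ((card I + k) choose card I)) \<le> real ((Suc k + card I) ^ card I)"
    using fact_choose_le_pow[of "card I" k] by (simp only: of_nat_le_iff)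
  then show ?thesis by (simp add: Suc jet_dim_Suc card_exponents add_ac)
qed

lemma floor_over_tendsto:
  fixes y :: "nat \<Rightarrow> real"
  assumes "\<And>s. y s \<ge> 0" "(\<lambda>s. y s / real s) \<longlonglongrightarrow> Y"
  shows "(\<lambda>s. real (nat \<lfloor>y s\<rfloor>) / real s) \<longlonglongrightarrow> Y"
proof (rule tendsto_sandwich[OF _ _ _ assms(2)])
  have "real (nat \<lfloor>y s\<rfloor>) \<ge> y s - 1" "real (nat \<lfloor>y s\<rfloor>) \<le> y s" for s
    using assms(1)[of s] by linarith+
  then show "\<forall>\<^sub>F s in sequentially. y s / real s - 1 / real s \<le> real (nat \<lfloor>y s\<rfloor>) / real s"
    "\<forall>\<^sub>F s in sequentially. real (nat \<lfloor>y s\<rfloor>) / real s \<le> y s / real s"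
    by (auto intro!: always_eventually divide_right_mono simp flip: diff_divide_distrib)
  show "(\<lambda>s. y s / real s - 1 / real s) \<longlonglongrightarrow> Y"
    using tendsto_diff[OF assms(2) lim_1_over_n] by simp
qed

text \<open>
Here \<open>e\<close> stands for \<open>q\<^bsup>a-1\<^esup>\<close>. Let \<open>m0\<close> and \<open>m1\<close> be \<open>\<mu>0 s\<close> and \<open>\<mu>1 s\<close>, take \<open>m\<close> as large as the
condition of richness permits and \<open>N\<close> maximal below \<open>m (q e - e)\<close>, divide by \<open>(q s)\<^sup>d\<close> and let \<open>s\<close>
tend to infinity.
\<close>
lemma multiplicity_limit:
  fixes q e d :: nat and \<alpha> \<gamma> p \<mu>0 \<mu>1 :: real
  assumes q: "q > 1" and e: "e > 0" and d: "d > 0" and \<gamma>: "0 < \<gamma>" "\<gamma> \<le> 1"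
    and \<mu>: "0 \<le> \<mu>0" "\<mu>0 \<le> \<mu>1" "0 < \<mu>1"
    and H: "\<And>m0 m1 N m :: nat. m0 \<le> m1 \<Longrightarrow> N < m * (q * e - e) \<Longrightarrow>
       real (N * e + (m - 1) * (q * e - e)) < real (q * e) * (m0 + \<gamma> * (real m1 - m0)) \<Longrightarrow>
       \<alpha> * ((real N + 1) ^ d - (q * (real m0 + d)) ^ d) \<le> p * q ^ d * ((real m1 + d) ^ d - real m0 ^ d)"
  shows "\<alpha> * (((\<mu>0 + \<gamma> * (\<mu>1 - \<mu>0)) / (1 + 1 / e)) ^ d - \<mu>0 ^ d) \<le> p * (\<mu>1 ^ d - \<mu>0 ^ d)"
proof -
  define m0 where "m0 s = nat \<lfloor>\<mu>0 * real s\<rfloor>" for s :: nat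
  define m1 where "m1 s = nat \<lfloor>\<mu>1 * real s\<rfloor>" for s :: nat
  define g where "g = q * e - e"
  have "e < q * e" using q e by simp
  then have g: "g > 0" "real g = real q * e - e" by (simp_all add: g_def of_nat_diff)
  \<comment> \<open>With \<open>N + 1 = m g\<close> the richness condition reads \<open>m g (e + 1) - q e < q e (m0 + \<gamma> (m1 - m0))\<close>, so \<open>c\<close> is the largest admissible slope of \<open>m\<close>.\<close>
  define c where "c = real (q * e) / (real g * (real e + 1))"
  define y where "y s = c * (real (m0 s) + \<gamma> * (real (m1 s) - real (m0 s)))" for s
  define m where "m s = nat \<lfloor>y s\<rfloor>" for s
  define \<mu>b where "\<mu>b = \<mu>0 + \<gamma> * (\<mu>1 - \<mu>0)"
  have m01: "m0 s \<le> m1 s" for s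
    unfolding m0_def m1_def using \<mu> by (intro nat_mono floor_mono mult_right_mono) auto
  have c: "c > 0" unfolding c_def using g e q by (intro divide_pos_pos mult_pos_pos) auto
  have y0: "y s \<ge> 0" for s unfolding y_def using c \<gamma> m01[of s] by simp
  have lim: "(\<lambda>s. z * real s / real s) \<longlonglongrightarrow> z" for z :: real
    by (rule tendsto_eventually) (rule eventually_mono[OF eventually_gt_at_top[of 0]], simp)
  have l0: "(\<lambda>s. real (m0 s) / real s) \<longlonglongrightarrow> \<mu>0" and l1: "(\<lambda>s. real (m1 s) / real s) \<longlonglongrightarrow> \<mu>1"
    unfolding m0_def m1_def by (rule floor_over_tendsto[OF _ lim], use \<mu> in simp)+
  have "(\<lambda>s. c * (real (m0 s) / real s + \<gamma> * (real (m1 s) / real s - real (m0 s) / real s))) \<longlonglongrightarrow> c * \<mu>b"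
    unfolding \<mu>b_def by (intro tendsto_intros l0 l1)
  then have ly: "(\<lambda>s. y s / real s) \<longlonglongrightarrow> c * \<mu>b"
    unfolding y_def by (rule Lim_transform_eventually) (auto intro!: eventually_sequentiallyI[of 1] simp: field_simps)
  have lm: "(\<lambda>s. real (m s) / real s) \<longlonglongrightarrow> c * \<mu>b"
    unfolding m_def by (rule floor_over_tendsto[OF y0 ly])
  have "\<mu>b > 0"
  proof (cases "\<mu>0 = 0")
    case True
    then show ?thesis using \<mu> \<gamma> by (simp add: \<mu>b_def)
  next
    case False
    then show ?thesis using \<mu> \<gamma> unfolding \<mu>b_def by (intro add_pos_nonneg) auto
  qed
  then have "c * \<mu>b > 0" using c by simp
  then have eval_mp: "\<forall>\<^sub>F s in sequentially. real (m s) / real s > 0" using order_tendstoD(1)[OF lm] by blast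
  have ineq: "\<forall>\<^sub>F s in sequentially.
     \<alpha> * ((real (m s) / real s * (real g / real q)) ^ d - (real (m0 s) / real s + real d / real s) ^ d)
       \<le> p * ((real (m1 s) / real s + real d / real s) ^ d - (real (m0 s) / real s) ^ d)"
    using eval_mp eventually_gt_at_top[of 0]
  proof eventually_elim
    case (elim s)
    then have ms: "m s > 0" by (cases "m s") auto
    define N where "N = m s * g - 1"
    have mg: "m s * g > 0" using ms g by simp
    have rN: "real N = real (m s) * real g - 1" using mg by (simp add: N_def of_nat_diff)
    have "real (m s) \<le> y s" using y0[of s] unfolding m_def by linarith
    then have "real (m s) * (real g * (real e + 1)) \<le> y s * (real g * (real e + 1))"
      by (rule mult_right_mono) simp
    also have "y s * (real g * (real e + 1)) = real (q * e) * (real (m0 s) + \<gamma> * (real (m1 s) - real (m0 s)))"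
    proof -
      have "real g * (real e + 1) > 0" using g(1) by (intro mult_pos_pos) auto
      then have ce: "c * (real g * (real e + 1)) = real (q * e)" unfolding c_def using g(1) by simp
      show ?thesis unfolding y_def ce[symmetric] by (simp only: mult_ac)
    qed
    finally have my: "real (m s) * (real g * (real e + 1)) \<le> real (q * e) * (real (m0 s) + \<gamma> * (real (m1 s) - real (m0 s)))" .
    have "real (N * e + (m s - 1) * (q * e - e)) = (real (m s) * g - 1) * e + (real (m s) - 1) * g"
      using ms by (simp add: rN g_def[symmetric] of_nat_diff)
    also have "\<dots> = real (m s) * (real g * (real e + 1)) - real q * e"
      by (simp add: g(2) algebra_simps)
    also have "\<dots> < real (m s) * (real g * (real e + 1))" using q e by simp
    also note my
    finally have hyp: "real (N * e + (m s - 1) * (q * e - e)) < real (q * e) * (real (m0 s) + \<gamma> * (real (m1 s) - real (m0 s)))" .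
    have "N < m s * (q * e - e)" using mg by (simp add: N_def g_def)
    from H[OF m01 this hyp]
    have h: "\<alpha> * ((real (m s) * g) ^ d - (q * (real (m0 s) + d)) ^ d) \<le> p * q ^ d * ((real (m1 s) + d) ^ d - real (m0 s) ^ d)"
      by (simp add: rN)
    have qs: "(real q * real s) ^ d > 0" using q elim by simp
    have 1: "(real (m s) / real s * (real g / real q)) ^ d = (real (m s) * g) ^ d / (real q * real s) ^ d"
      by (simp add: power_divide power_mult_distrib mult.commute)
    have 2: "(real (m0 s) / real s + real d / real s) ^ d = (q * (real (m0 s) + d)) ^ d / (real q * real s) ^ d"
      using q by (simp add: power_divide power_mult_distrib flip: add_divide_distrib)
    have 3: "(real (m1 s) / real s + real d / real s) ^ d = q ^ d * (real (m1 s) + d) ^ d / (real q * real s) ^ d"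
      using q by (simp add: power_divide power_mult_distrib flip: add_divide_distrib)
    have 4: "(real (m0 s) / real s) ^ d = q ^ d * real (m0 s) ^ d / (real q * real s) ^ d"
      using q by (simp add: power_divide power_mult_distrib)
    define K where "K = (real q * real s) ^ d"
    have r: "\<alpha> * (a / K - b / K) = \<alpha> * (a - b) / K" "p * (r * a / K - r * b / K) = p * r * (a - b) / K"
      for a b r :: real by (simp_all add: diff_divide_distrib right_diff_distrib mult.assoc)
    show ?case
      unfolding 1 2 3 4 K_def[symmetric] r
      using h qs by (intro divide_right_mono) (simp_all add: K_def)
  qed
  have ld: "(\<lambda>s. real d / real s) \<longlonglongrightarrow> 0" by (rule lim_const_over_n)
  have "\<alpha> * ((c * \<mu>b * (real g / real q)) ^ d - (\<mu>0 + 0) ^ d) \<le> p * ((\<mu>1 + 0) ^ d - \<mu>0 ^ d)"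
  proof (rule tendsto_le[OF _ _ _ ineq])
    show "(\<lambda>s. \<alpha> * ((real (m s) / real s * (real g / real q)) ^ d - (real (m0 s) / real s + real d / real s) ^ d))
      \<longlonglongrightarrow> \<alpha> * ((c * \<mu>b * (real g / real q)) ^ d - (\<mu>0 + 0) ^ d)"
      by (intro tendsto_intros lm l0 ld)
    show "(\<lambda>s. p * ((real (m1 s) / real s + real d / real s) ^ d - (real (m0 s) / real s) ^ d))
      \<longlonglongrightarrow> p * ((\<mu>1 + 0) ^ d - \<mu>0 ^ d)"
      by (intro tendsto_intros l0 l1 ld)
  qed simp
  moreover have "c * \<mu>b * (real g / real q) = \<mu>b / (1 + 1 / e)"
  proof -
    have nz: "real g \<noteq> 0" "real q \<noteq> 0" "real e + 1 \<noteq> 0" using g(1) q by linarith+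
    have cg: "c * (real g / real q) = real e / (real e + 1)"
      unfolding c_def of_nat_mult using nz by (simp only: divide_simps mult_ac) simp
    have e1: "1 + 1 / real e = (real e + 1) / real e" using e by (simp add: field_simps)
    have "c * \<mu>b * (real g / real q) = \<mu>b * (c * (real g / real q))" by (simp only: mult_ac)
    then show ?thesis unfolding cg e1 by simp
  qed
  ultimately show ?thesis by (simp add: \<mu>b_def)
qed

text \<open>
The first bound is the case \<open>\<mu>0 = 0\<close>, \<open>\<mu>1 = 1\<close>. For the second put \<open>\<eta> = 1 / e\<close>, \<open>\<mu>0 = 1\<close>, and
choose \<open>\<mu>1 = 1 + \<nu>\<close> such that the quotient on the left becomes \<open>1 + \<eta>\<close>, which means
\<open>\<gamma> \<nu> = 2 \<eta> + \<eta>\<^sup>2\<close>. Bernoulli's inequality bounds the left side below by \<open>\<alpha> d \<eta>\<close>, and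
\<open>(1 + \<nu>)\<^sup>d - 1 \<le> d \<nu> exp (d \<nu>)\<close> bounds the right side above; the quotient \<open>\<eta> / \<nu>\<close> is of order
\<open>\<gamma>\<close>, independently of \<open>d\<close>.
\<close>
lemma two_bounds:
  fixes \<alpha> \<gamma> p :: real and e d :: nat
  assumes e: "e > 0" and d: "d > 0" and \<gamma>: "0 < \<gamma>" "\<gamma> \<le> 1" and \<alpha>: "\<alpha> \<ge> 0" and p: "p \<ge> 0"
    and L: "\<And>\<mu>0 \<mu>1. 0 \<le> \<mu>0 \<Longrightarrow> \<mu>0 \<le> \<mu>1 \<Longrightarrow> 0 < \<mu>1 \<Longrightarrow>
       \<alpha> * (((\<mu>0 + \<gamma> * (\<mu>1 - \<mu>0)) / (1 + 1 / e)) ^ d - \<mu>0 ^ d) \<le> p * (\<mu>1 ^ d - \<mu>0 ^ d)"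
  shows "\<alpha> * (\<gamma> / (1 + 1 / e)) ^ d \<le> p"
    and "\<alpha> * (\<gamma> / 4 * exp (- (8 * real d / (\<gamma> * e)))) \<le> p"
proof -
  show "\<alpha> * (\<gamma> / (1 + 1 / e)) ^ d \<le> p" using L[of 0 1] d by (simp add: zero_power)
next
  define \<eta> where "\<eta> = 1 / real e"
  have \<eta>: "0 < \<eta>" "\<eta> \<le> 1" using e by (simp_all add: \<eta>_def)
  define \<nu> where "\<nu> = (2 * \<eta> + \<eta>\<^sup>2) / \<gamma>"
  have \<nu>: "\<nu> > 0" using \<eta> \<gamma> by (simp add: \<nu>_def add_pos_pos)
  have "\<eta>\<^sup>2 \<le> \<eta>" using \<eta> by (simp add: power2_eq_square mult_left_le)
  then have nu3: "\<nu> \<le> 3 * \<eta> / \<gamma>" unfolding \<nu>_def using \<gamma> by (intro divide_right_mono) auto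
  have "(1 + \<gamma> * (1 + \<nu> - 1)) / (1 + 1 / e) = 1 + \<eta>"
  proof -
    have "1 + \<gamma> * (1 + \<nu> - 1) = (1 + \<eta>) * (1 + \<eta>)" using \<gamma> by (simp add: \<nu>_def power2_eq_square algebra_simps)
    then show ?thesis using \<eta> by (simp add: \<eta>_def)
  qed
  with L[of 1 "1 + \<nu>"] \<nu> have 1: "\<alpha> * ((1 + \<eta>) ^ d - 1) \<le> p * ((1 + \<nu>) ^ d - 1)" by simp
  have 2: "real d * \<eta> \<le> (1 + \<eta>) ^ d - 1" using Bernoulli_inequality[of \<eta> d] \<eta> by simp
  define u where "u = real d * \<nu>"
  have "(1 + \<nu>) ^ d \<le> exp \<nu> ^ d" using \<nu> by (intro power_mono) auto
  also have "\<dots> = exp u" by (simp add: u_def exp_of_nat_mult)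
  finally have "(1 + \<nu>) ^ d - 1 \<le> exp u - 1" by simp
  also have "\<dots> \<le> u * exp u"
  proof -
    have "(1 - u) * exp u \<le> exp (- u) * exp u" using exp_ge_add_one_self[of "- u"] by (intro mult_right_mono) auto
    also have "\<dots> = 1" by (simp flip: exp_add)
    finally show ?thesis by (simp add: algebra_simps)
  qed
  finally have 3: "(1 + \<nu>) ^ d - 1 \<le> u * exp u" .
  have "\<alpha> * (real d * \<eta>) \<le> \<alpha> * ((1 + \<eta>) ^ d - 1)" by (rule mult_left_mono[OF 2 \<alpha>])
  also note 1
  also have "p * ((1 + \<nu>) ^ d - 1) \<le> p * (u * exp u)" by (rule mult_left_mono[OF 3 p])
  finally have 4: "\<alpha> * \<eta> \<le> p * \<nu> * exp u" using d by (simp add: u_def mult_ac)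
  also have "p * \<nu> * exp u \<le> p * (3 * \<eta> / \<gamma>) * exp u"
    using nu3 p by (intro mult_right_mono mult_left_mono) auto
  finally have "\<alpha> * \<eta> \<le> p * (3 * \<eta> / \<gamma>) * exp u" .
  then have "\<alpha> * \<gamma> \<le> 3 * p * exp u" using \<eta> \<gamma> by (simp add: field_simps)
  then have "\<alpha> * \<gamma> * exp (- u) \<le> 3 * p * exp u * exp (- u)" by (rule mult_right_mono) simp
  also have "\<dots> = 3 * p" by (simp add: mult.assoc flip: exp_add)
  finally have 5: "\<alpha> * \<gamma> * exp (- u) \<le> 3 * p" .
  have "u \<le> real d * (3 * \<eta> / \<gamma>)" unfolding u_def by (rule mult_left_mono[OF nu3]) simp
  also have "\<dots> \<le> 8 * real d / (\<gamma> * e)" using \<gamma> e by (simp add: \<eta>_def field_simps)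
  finally have "exp (- (8 * real d / (\<gamma> * e))) \<le> exp (- u)" by simp
  then have "\<alpha> * \<gamma> * exp (- (8 * real d / (\<gamma> * e))) \<le> \<alpha> * \<gamma> * exp (- u)"
    using \<alpha> \<gamma> by (intro mult_left_mono) auto
  with 5 p show "\<alpha> * (\<gamma> / 4 * exp (- (8 * real d / (\<gamma> * e)))) \<le> p" by simp
qed

section \<open>The general linear group and flags\<close>

lemma card_vec_subspace:
  fixes V :: "('a::{field,finite} ^ 'n) set"
  assumes "vec.subspace V"
  shows "card V = CARD('a) ^ vec.dim V"
proof -
  obtain B where B: "B \<subseteq> V" "vec.independent B" "V \<subseteq> vec.span B" "card B = vec.dim V"
    using vec.basis_exists by blast
  have sp: "vec.span B = V" using B assms by (simp add: vec.span_subspace)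
  let ?A = "{g :: 'a ^ 'n \<Rightarrow> 'a. \<forall>b. b \<notin> B \<longrightarrow> g b = 0}"
  let ?f = "\<lambda>g. \<Sum>b\<in>B. g b *s b"
  have inj: "inj_on ?f ?A"
  proof (rule inj_onI)
    fix g h assume gh: "g \<in> ?A" "h \<in> ?A" "?f g = ?f h"
    have "(\<Sum>b\<in>B. (g b - h b) *s b) = 0"
      using gh(3) by (simp add: vector_sub_rdistrib sum_subtractf)
    then have "g b - h b = 0" if "b \<in> B" for b
      by (rule vec.independentD[OF B(2) finite order_refl _ that])
    then show "g = h" using gh by (force simp: fun_eq_iff)
  qed
  have img: "?f ` ?A = V"
  proof -
    have "range ?f \<subseteq> ?f ` ?A"
    proof (rule image_subsetI)
      fix g :: "'a ^ 'n \<Rightarrow> 'a"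
      have "?f g = ?f (\<lambda>b. if b \<in> B then g b else 0)" by (rule sum.cong) auto
      moreover have "(\<lambda>b. if b \<in> B then g b else 0) \<in> ?A" by simp
      ultimately show "?f g \<in> ?f ` ?A" by (rule image_eqI)
    qed
    moreover have "?f ` ?A \<subseteq> range ?f" by (rule image_mono) simp
    ultimately have "?f ` ?A = range ?f" by (rule equalityI[rotated])
    then show ?thesis using vec.span_finite[of B] sp by simp
  qed
  have "card V = card ?A" using card_image[OF inj] unfolding img .
  then show ?thesis using card_supported(2)[of B, where 'b='a] B(4) by simp
qed

definition lin_bij :: "('a::field ^ 'n \<Rightarrow> 'a ^ 'n) set" where
  "lin_bij = {T. Vector_Spaces.linear (*s) (*s) T \<and> bij T}"

lemma lin_bij_comp: "S \<in> lin_bij \<Longrightarrow> T \<in> lin_bij \<Longrightarrow> S \<circ> T \<in> lin_bij"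
  unfolding lin_bij_def by (auto intro: bij_comp Vector_Spaces.linear_compose)

lemma lin_bij_subspace:
  assumes "T \<in> lin_bij" "vec.subspace W"
  shows "vec.subspace (T ` W)" "vec.dim (T ` W) = vec.dim W"
proof -
  have l: "Vector_Spaces.linear (*s) (*s) T" and i: "inj T" using assms(1) by (auto simp: lin_bij_def bij_def)
  show "vec.subspace (T ` W)" using vec.linear_subspace_image[OF l assms(2)] .
  show "vec.dim (T ` W) = vec.dim W"
    by (rule vec.dim_image_eq[OF l]) (rule inj_on_subset[OF i subset_UNIV])
qed

lemma lin_bij_grassmannian: "T \<in> lin_bij \<Longrightarrow> W \<in> grassmannian r \<Longrightarrow> T ` W \<in> grassmannian r"
  using lin_bij_subspace by (auto simp: grassmannian_def)

lemma lin_bij_add: "T \<in> lin_bij \<Longrightarrow> T (x + y) = T x + T y"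
  by (simp add: lin_bij_def vec.linear_add)

lemma lin_bij_diff: "T \<in> lin_bij \<Longrightarrow> T (x - y) = T x - T y"
  by (simp add: lin_bij_def vec.linear_diff)

text \<open>
Map a basis adapted to the first flag to a basis adapted to the second.
\<close>
lemma flag_transitive:
  fixes W U W' U' :: "('a::{field,finite} ^ 'n) set"
  assumes W: "vec.subspace W" "vec.subspace W'" "vec.dim W = vec.dim W'"
    and U: "vec.subspace U" "vec.subspace U'" "vec.dim U = vec.dim U'" and sub: "W \<subseteq> U" "W' \<subseteq> U'"
  shows "\<exists>T\<in>lin_bij. T ` W = W' \<and> T ` U = U'"
proof -
  have basis: "\<exists>bW bU bV. bW \<subseteq> bU \<and> bU \<subseteq> bV \<and> vec.independent bV \<and> vec.span bW = W \<and> vec.span bU = U \<and>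
      vec.span bV = UNIV \<and> card bW = vec.dim W \<and> card bU = vec.dim U \<and> card bV = CARD('n)"
    if WU: "vec.subspace W" "vec.subspace U" "W \<subseteq> U" for W U :: "('a ^ 'n) set"
  proof -
    obtain bW where bW: "bW \<subseteq> W" "vec.independent bW" "W \<subseteq> vec.span bW"
      by (rule vec.maximal_independent_subset[of W])
    obtain bU where bU: "bW \<subseteq> bU" "bU \<subseteq> U" "vec.independent bU" "U \<subseteq> vec.span bU"
      by (rule vec.maximal_independent_subset_extend[OF order_trans[OF bW(1) WU(3)] bW(2)])
    obtain bV where bV: "bU \<subseteq> bV" "bV \<subseteq> UNIV" "vec.independent bV" "UNIV \<subseteq> vec.span bV"
      by (rule vec.maximal_independent_subset_extend[OF subset_UNIV bU(3)])
    have sp: "vec.span bW = W" "vec.span bU = U" "vec.span bV = UNIV"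
      by (rule vec.span_subspace[OF bW(1,3) WU(1)], rule vec.span_subspace[OF bU(2,4) WU(2)])
         (use bV(4) in auto)
    have "card bW = vec.dim W" "card bU = vec.dim U"
      by (rule vec.basis_card_eq_dim[OF bW(1,3,2)], rule vec.basis_card_eq_dim[OF bU(2,4,3)])
    have "card bV = vec.dim (UNIV :: ('a ^ 'n) set)"
      by (rule vec.basis_card_eq_dim) (use bV in auto)
    then have "card bV = CARD('n)" by (simp add: vec.dim_UNIV card_cart_basis)
    moreover note \<open>card bW = vec.dim W\<close> \<open>card bU = vec.dim U\<close>
    ultimately show ?thesis using bU(1) bV(1,3) sp by blast
  qed
  obtain bW bU bV where b: "bW \<subseteq> bU" "bU \<subseteq> bV" "vec.independent bV" "vec.span bW = W" "vec.span bU = U"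
      "vec.span bV = UNIV" "card bW = vec.dim W" "card bU = vec.dim U" "card bV = CARD('n)"
    using basis[OF W(1) U(1) sub(1)] by blast
  obtain cW cU cV where c: "cW \<subseteq> cU" "cU \<subseteq> cV" "vec.independent cV" "vec.span cW = W'" "vec.span cU = U'"
      "vec.span cV = UNIV" "card cW = vec.dim W'" "card cU = vec.dim U'" "card cV = CARD('n)"
    using basis[OF W(2) U(2) sub(2)] by blast
  obtain f1 where f1: "bij_betw f1 bW cW"
    using finite_same_card_bij[of bW cW] b c W(3) by auto
  obtain f2 where f2: "bij_betw f2 (bU - bW) (cU - cW)"
    using finite_same_card_bij[of "bU - bW" "cU - cW"] b c W(3) U(3) by (auto simp: card_Diff_subset)
  obtain f3 where f3: "bij_betw f3 (bV - bU) (cV - cU)"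
    using finite_same_card_bij[of "bV - bU" "cV - cU"] b c U(3) by (auto simp: card_Diff_subset)
  define f where "f x = (if x \<in> bW then f1 x else if x \<in> bU then f2 x else f3 x)" for x
  have fW: "f ` bW = cW" using f1 by (auto simp: f_def bij_betw_def)
  have "f ` (bU - bW) = f2 ` (bU - bW)" by (rule image_cong) (auto simp: f_def)
  then have "f ` (bU - bW) = cU - cW" using f2 by (simp add: bij_betw_def)
  then have fU: "f ` bU = cU" using fW b(1) c(1) by (metis Un_Diff_cancel image_Un sup.absorb2)
  have "f ` (bV - bU) = f3 ` (bV - bU)" by (rule image_cong) (use b(1) in \<open>auto simp: f_def\<close>)
  then have "f ` (bV - bU) = cV - cU" using f3 by (simp add: bij_betw_def)
  then have fV: "f ` bV = cV" using fU b(2) c(2) by (metis Un_Diff_cancel image_Un sup.absorb2)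
  obtain T where T: "Vector_Spaces.linear (*s) (*s) T" "\<forall>x\<in>bV. T x = f x"
    using vec.linear_independent_extend[OF b(3)] by blast
  have img: "T ` vec.span s = vec.span (f ` s)" if "s \<subseteq> bV" for s
  proof -
    have "T ` s = f ` s" by (rule image_cong) (use T(2) that in auto)
    then show ?thesis using vec.linear_span_image[OF T(1), of s] by simp
  qed
  have "T ` UNIV = UNIV" using img[of bV] b c fV by simp
  then have "bij T" using finite_UNIV_surj_inj[of T] by (simp add: bij_def)
  then have "T \<in> lin_bij" using T(1) by (simp add: lin_bij_def)
  moreover have "T ` W = W'" using img[of bW] b c fW by auto
  moreover have "T ` U = U'" using img[of bU] b c fU by auto
  ultimately show ?thesis by blast
qed

text \<open>
For a transitive action the image of \<open>x0\<close> under a random group element is uniformly distributed.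
\<close>
lemma card_orbit_uniform:
  assumes G: "finite G" "\<And>g h. g \<in> G \<Longrightarrow> h \<in> G \<Longrightarrow> g \<circ> h \<in> G" "\<And>g. g \<in> G \<Longrightarrow> inj g"
    and A: "finite A" "\<And>g. g \<in> G \<Longrightarrow> act g x0 \<in> A"
    and act: "\<And>g h. g \<in> G \<Longrightarrow> h \<in> G \<Longrightarrow> act (g \<circ> h) x0 = act g (act h x0)"
    and trans: "\<And>x y. x \<in> A \<Longrightarrow> y \<in> A \<Longrightarrow> \<exists>g\<in>G. act g x = y"
    and R: "R \<subseteq> A"
  shows "card {g\<in>G. act g x0 \<in> R} * card A = card G * card R"
proof -
  define n where "n x = card {g\<in>G. act g x0 = x}" for x
  have le: "n x \<le> n y" if xy: "x \<in> A" "y \<in> A" for x y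
  proof -
    obtain h where h: "h \<in> G" "act h x = y" using trans[OF xy] by blast
    show ?thesis unfolding n_def
    proof (rule card_inj_on_le[where f = "\<lambda>g. h \<circ> g"])
      show "inj_on ((\<circ>) h) {g \<in> G. act g x0 = x}"
        using G(3)[OF h(1)] by (auto simp: inj_on_def fun_eq_iff)
      show "(\<circ>) h ` {g \<in> G. act g x0 = x} \<subseteq> {g \<in> G. act g x0 = y}"
        using h G(2) act by auto
    qed (use G(1) in auto)
  qed
  have part: "card {g\<in>G. act g x0 \<in> R'} = (\<Sum>x\<in>R'. n x)" if "R' \<subseteq> A" for R'
  proof -
    have "{g\<in>G. act g x0 \<in> R'} = (\<Union>x\<in>R'. {g\<in>G. act g x0 = x})" by auto
    moreover have "card (\<Union>x\<in>R'. {g\<in>G. act g x0 = x}) = (\<Sum>x\<in>R'. card {g\<in>G. act g x0 = x})"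
      by (rule card_UN_disjoint) (use G(1) finite_subset[OF that A(1)] in auto)
    ultimately show ?thesis unfolding n_def by simp
  qed
  show ?thesis
  proof (cases "R = {}")
    case True
    then show ?thesis by simp
  next
    case False
    then obtain y where y: "y \<in> R" by blast
    have eq: "n x = n y" if "x \<in> A" for x using le that y R by (meson order_antisym subsetD)
    have "card {g\<in>G. act g x0 \<in> R} = card R * n y" using part[OF R] eq R by (simp add: subset_iff)
    moreover have "card G = card A * n y"
    proof -
      have "G = {g\<in>G. act g x0 \<in> A}" using A(2) by auto
      then have "card G = (\<Sum>x\<in>A. n x)" using part[of A] by simp
      then show ?thesis using eq by simp
    qed
    ultimately show ?thesis by simp
  qed
qed

section \<open>Averaging over coordinate systems\<close>

definition coords :: "'n::finite set \<Rightarrow> 'a::field ^ 'n \<Rightarrow> 'n \<Rightarrow> 'a" where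
  "coords I x = (\<lambda>i. if i \<in> I then x $ i else 0)"

lemma coords_add: "coords I (x + y) = (\<lambda>i. coords I x i + coords I y i)"
  by (auto simp: coords_def fun_eq_iff)

lemma coords_diff: "coords I (x - y) = coords I x - coords I y"
  by (auto simp: coords_def fun_eq_iff)

lemma coords_grid: "coords I x \<in> grid I UNIV"
  by (simp add: coords_def grid_def)

lemma coords_surj:
  assumes "u \<in> grid I UNIV"
  shows "coords I (\<chi> i. u i) = u"
  using assms by (auto simp: coords_def grid_def fun_eq_iff)

text \<open>
The quotient by the coordinate subspace \<open>cylinder I {0}\<close> is identified with the functions supported
on \<open>I\<close>; this is the preimage of a subset of the quotient.
\<close>
definition cylinder :: "'n::finite set \<Rightarrow> ('n \<Rightarrow> 'a::field) set \<Rightarrow> ('a ^ 'n) set" where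
  "cylinder I S = {x. coords I x \<in> S}"

lemma directions_closed:
  fixes S :: "('i::finite \<Rightarrow> 'a::{field,finite}) set"
  assumes "S \<in> directions I a"
  shows "S \<subseteq> grid I UNIV" "(\<lambda>i. 0) \<in> S"
    "x \<in> S \<Longrightarrow> y \<in> S \<Longrightarrow> (\<lambda>i. x i + y i) \<in> S" "x \<in> S \<Longrightarrow> (\<lambda>i. b * x i) \<in> S"
    "a > 0 \<Longrightarrow> card S = CARD('a) ^ a"
proof -
  obtain z where z: "z \<in> generic I a" "S = tr_point a z ` ext_field a" using assms by (auto simp: directions_def)
  have zg: "z \<in> grid I (ext_field a)" using z by (simp add: generic_def)
  show "S \<subseteq> grid I UNIV" using z tr_point_grid[OF zg] by auto
  have "tr_point a z 0 = (\<lambda>i. 0)" by (simp add: tr_point_def tr_def fun_eq_iff zero_power)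
  then show "(\<lambda>i. 0) \<in> S" using z(2) zero_in_ext_field by (metis image_eqI)
  show "x \<in> S \<Longrightarrow> y \<in> S \<Longrightarrow> (\<lambda>i. x i + y i) \<in> S"
  proof -
    assume "x \<in> S" "y \<in> S"
    then obtain s t where st: "s \<in> ext_field a" "t \<in> ext_field a" "x = tr_point a z s" "y = tr_point a z t" using z by auto
    have "to_ac (tr_point a z (s + t) i) = to_ac (x i + y i)" for i
      using st zg by (simp add: to_ac_tr_point ext_field_closed distrib_left tr_add)
    then have "tr_point a z (s + t) i = x i + y i" for i by (simp only: to_ac_eq_iff)
    then have "(\<lambda>i. x i + y i) = tr_point a z (s + t)" by (simp only: fun_eq_iff) simp
    then show ?thesis using z(2) ext_field_closed(1)[OF st(1,2)] by blast
  qed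
  show "x \<in> S \<Longrightarrow> (\<lambda>i. b * x i) \<in> S"
  proof -
    assume "x \<in> S"
    then obtain s where st: "s \<in> ext_field a" "x = tr_point a z s" using z by auto
    have bs: "to_ac b * s \<in> ext_field a" by (rule ext_field_closed(3)[OF to_ac_in_ext_field st(1)])
    have "to_ac (tr_point a z (to_ac b * s) i) = to_ac (b * x i)" for i
    proof -
      have "to_ac (tr_point a z (to_ac b * s) i) = tr a (to_ac b * (z i * s))"
        unfolding to_ac_tr_point[OF zg bs] by (simp only: mult_ac)
      also have "\<dots> = to_ac (b * x i)" unfolding tr_scale by (simp add: st(2) to_ac_tr_point[OF zg st(1)])
      finally show ?thesis .
    qed
    then have "tr_point a z (to_ac b * s) i = b * x i" for i by (simp only: to_ac_eq_iff)
    then have "(\<lambda>i. b * x i) = tr_point a z (to_ac b * s)" by (simp only: fun_eq_iff) simp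
    then show ?thesis using z(2) bs by blast
  qed
  show "card S = CARD('a) ^ a" if "a > 0"
    using card_image[OF inj_tr_point[OF z(1)]] z(2) card_ext_field(2)[OF that, where 'a='a] by simp
qed

lemma cylinder_subspace:
  fixes S :: "('n::finite \<Rightarrow> 'a::{field,finite}) set"
  assumes S: "S \<subseteq> grid I UNIV" "(\<lambda>i. 0) \<in> S" "\<And>x y. x \<in> S \<Longrightarrow> y \<in> S \<Longrightarrow> (\<lambda>i. x i + y i) \<in> S"
      "\<And>b x. x \<in> S \<Longrightarrow> (\<lambda>i. b * x i) \<in> S"
    and card: "card S = CARD('a) ^ r"
  shows "vec.subspace (cylinder I S)" "vec.dim (cylinder I S) = CARD('n) - card I + r"
proof -
  let ?q = "CARD('a)"
  have sc: "coords I (b *s x) = (\<lambda>i. b * coords I x i)" for b and x :: "'a ^ 'n"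
    by (simp add: coords_def fun_eq_iff)
  have z: "coords I (0 :: 'a ^ 'n) = (\<lambda>i. 0)" by (simp add: coords_def fun_eq_iff)
  show sub: "vec.subspace (cylinder I S)"
    unfolding vec.subspace_def cylinder_def using S z by (auto simp: coords_add sc)
  have hom: "card H = card (coords I ` H) * card {x\<in>H. coords I x = 0}" if "add_subgroup H" for H :: "('a ^ 'n) set"
    by (rule card_hom[OF that]) (auto simp: coords_diff)
  have 0: "{x\<in>cylinder I S. coords I x = 0} = {x\<in>UNIV. coords I x = 0}"
    using S(2) by (auto simp: cylinder_def zero_fun_def)
  have "coords I ` (UNIV :: ('a ^ 'n) set) = grid I UNIV"
  proof (intro equalityI subsetI)
    fix u :: "'n \<Rightarrow> 'a" assume "u \<in> grid I UNIV"
    from coords_surj[OF this] show "u \<in> coords I ` UNIV" by (metis rangeI)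
  qed (auto simp: coords_grid)
  then have 1: "?q ^ CARD('n) = ?q ^ card I * card {x\<in>UNIV :: ('a ^ 'n) set. coords I x = 0}"
    using hom[of UNIV] by (simp add: add_subgroup_def card_grid)
  have "coords I ` cylinder I S = S"
  proof (intro equalityI subsetI)
    fix u assume u: "u \<in> S"
    then have cu: "coords I (\<chi> i. u i) = u" using S(1) by (intro coords_surj) auto
    then have "(\<chi> i. u i) \<in> cylinder I S" using u by (simp add: cylinder_def)
    then show "u \<in> coords I ` cylinder I S" using cu by (metis image_eqI)
  qed (auto simp: cylinder_def)
  moreover have "add_subgroup (cylinder I S)"
    using vec.subspace_0[OF sub] vec.subspace_diff[OF sub] by (auto simp: add_subgroup_def)
  ultimately have "card (cylinder I S) = ?q ^ r * card {x\<in>UNIV :: ('a ^ 'n) set. coords I x = 0}"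
    using hom[of "cylinder I S"] 0 card by simp
  then have "?q ^ vec.dim (cylinder I S) * ?q ^ card I = ?q ^ r * ?q ^ CARD('n)"
    using 1 card_vec_subspace[OF sub] by (simp add: mult_ac)
  then have "?q ^ (vec.dim (cylinder I S) + card I) = ?q ^ (r + CARD('n))" by (simp add: power_add)
  then have "vec.dim (cylinder I S) + card I = r + CARD('n)"
    using card_field_gt_1[where 'a='a] by (simp only: power_inject_exp)
  moreover have "card I \<le> CARD('n)" by (rule card_mono) auto
  ultimately show "vec.dim (cylinder I S) = CARD('n) - card I + r" by simp
qed

text \<open>
The flats parallel to the image of \<open>cylinder I {0}\<close> under \<open>T\<close> are the sets \<open>T ` cylinder I {u}\<close>, one
for each point \<open>u\<close> of the quotient; \<open>E\<close> collects the points whose flat is in \<open>B\<close>. A flat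
inside the translate by \<open>T v'\<close> of the image of \<open>cylinder I S\<close> corresponds to a point of the translate of \<open>S\<close> by
the coordinates of \<open>v'\<close>.
\<close>
lemma rich_pullback:
  fixes B :: "('a::{field,finite} ^ 'n) set set"
  assumes T: "T \<in> lin_bij" and S: "S \<in> directions I a"
    and rich: "rich_flag B t (T ` cylinder I {\<lambda>i. 0}) (T ` cylinder I S)"
  defines "E \<equiv> {u \<in> grid I UNIV. T ` cylinder I {u} \<in> B}"
  shows "\<exists>u\<in>grid I UNIV. t \<le> real (card {x\<in>S. (\<lambda>i. u i + x i) \<in> E})"
proof -
  let ?W = "T ` cylinder I {\<lambda>i. 0}"
  have bT: "bij T" using T by (simp add: lin_bij_def)
  obtain v where v: "real (card {A \<in> B. translate_of A ?W \<and> A \<subseteq> (+) v ` (T ` cylinder I S)}) \<ge> t"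
    using rich by (auto simp: rich_flag_def translate_of_def)
  obtain v' where v': "v = T v'" using bT by (metis bij_pointE)
  define u where "u = coords I v'"
  have "{A \<in> B. translate_of A ?W \<and> A \<subseteq> (+) v ` (T ` cylinder I S)}
      \<subseteq> (\<lambda>x. T ` cylinder I {\<lambda>i. u i + x i}) ` {x\<in>S. (\<lambda>i. u i + x i) \<in> E}"
  proof clarify
    fix A assume A: "A \<in> B" "translate_of A ?W" "A \<subseteq> (+) v ` (T ` cylinder I S)"
    obtain w where w: "A = (+) w ` ?W" using A(2) by (auto simp: translate_of_def)
    have "(0 :: 'a ^ 'n) \<in> cylinder I {\<lambda>i. 0}" by (simp add: cylinder_def coords_def fun_eq_iff)
    moreover have "T 0 = 0" using lin_bij_diff[OF T, of 0 0] by simp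
    ultimately have "0 \<in> ?W" by (metis image_eqI)
    then have "w \<in> A" unfolding w by (metis add.right_neutral image_eqI)
    then obtain y where y: "y \<in> cylinder I S" "w = v + T y" using A(3) by auto
    have wT: "w = T (v' + y)" using y(2) v' lin_bij_add[OF T] by simp
    define x where "x = coords I y"
    have xS: "x \<in> S" using y(1) by (simp add: cylinder_def x_def)
    have "A = T ` ((+) (v' + y) ` cylinder I {\<lambda>i. 0})"
      unfolding w wT by (auto simp: image_image lin_bij_add[OF T])
    also have "(+) (v' + y) ` cylinder I {\<lambda>i. 0} = cylinder I {\<lambda>i. u i + x i}"
    proof (intro equalityI subsetI)
      fix p assume "p \<in> (+) (v' + y) ` cylinder I {\<lambda>i. 0}"
      then show "p \<in> cylinder I {\<lambda>i. u i + x i}" by (auto simp: cylinder_def coords_add u_def x_def)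
    next
      fix p assume p: "p \<in> cylinder I {\<lambda>i. u i + x i}"
      then have "p - (v' + y) \<in> cylinder I {\<lambda>i. 0}"
        by (auto simp: cylinder_def coords_diff coords_add u_def x_def fun_eq_iff)
      then show "p \<in> (+) (v' + y) ` cylinder I {\<lambda>i. 0}" by (intro image_eqI[of _ _ "p - (v' + y)"]) auto
    qed
    finally have Aeq: "A = T ` cylinder I {\<lambda>i. u i + x i}" .
    have "(\<lambda>i. u i + x i) \<in> E"
      using A(1) Aeq by (auto simp: E_def u_def x_def simp flip: coords_add intro: coords_grid)
    then show "A \<in> (\<lambda>x. T ` cylinder I {\<lambda>i. u i + x i}) ` {x\<in>S. (\<lambda>i. u i + x i) \<in> E}"
      using Aeq xS by blast
  qed
  then have "card {A \<in> B. translate_of A ?W \<and> A \<subseteq> (+) v ` (T ` cylinder I S)}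
      \<le> card ((\<lambda>x. T ` cylinder I {\<lambda>i. u i + x i}) ` {x\<in>S. (\<lambda>i. u i + x i) \<in> E})"
    by (rule card_mono[rotated]) simp
  also have "\<dots> \<le> card {x\<in>S. (\<lambda>i. u i + x i) \<in> E}" by (rule card_image_le) simp
  finally have "t \<le> real (card {x\<in>S. (\<lambda>i. u i + x i) \<in> E})" using v by linarith
  then show ?thesis using coords_grid[of I v'] unfolding u_def by blast
qed

lemma translate_direction:
  assumes "vec.subspace W" "vec.subspace W'" "translate_of A W" "translate_of A W'"
  shows "W = W'"
proof -
  have le: "W \<subseteq> W'" if h: "vec.subspace W" "vec.subspace W'" "translate_of A W" "translate_of A W'" for W W' :: "('a ^ 'b) set"
  proof
    fix x assume x: "x \<in> W"
    obtain v where v1: "A = (+) v ` W" using h(3) by (auto simp: translate_of_def)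
    obtain v' where v2: "A = (+) v' ` W'" using h(4) by (auto simp: translate_of_def)
    note v = v1 v2
    have "v + 0 \<in> A" "v + x \<in> A" using v(1) x vec.subspace_0[OF h(1)] by auto
    then obtain y z where yz: "y \<in> W'" "v = v' + y" "z \<in> W'" "v + x = v' + z" using v(2) by auto
    then have "x = z - y" by (simp add: algebra_simps)
    then show "x \<in> W'" using vec.subspace_diff[OF h(2) yz(3,1)] by simp
  qed
  show ?thesis using le[OF assms] le[OF assms(2,1,4,3)] by (rule equalityI)
qed

lemma translate_T:
  assumes T: "T \<in> lin_bij" and A: "translate_of A (T ` cylinder I {\<lambda>i. 0})"
  shows "\<exists>u\<in>grid I UNIV. A = T ` cylinder I {u}"
proof -
  obtain w where w: "A = (+) w ` (T ` cylinder I {\<lambda>i. 0})" using A by (auto simp: translate_of_def)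
  have "surj T" using T by (simp add: lin_bij_def bij_def)
  then obtain v where v: "w = T v" using surjD[of T w] by blast
  have "A = T ` ((+) v ` cylinder I {\<lambda>i. 0})"
    unfolding w v by (auto simp: image_image lin_bij_add[OF T])
  also have "(+) v ` cylinder I {\<lambda>i. 0} = cylinder I {coords I v}"
  proof (intro equalityI subsetI)
    fix p assume "p \<in> (+) v ` cylinder I {\<lambda>i. 0}"
    then show "p \<in> cylinder I {coords I v}" by (auto simp: cylinder_def coords_add)
  next
    fix p assume p: "p \<in> cylinder I {coords I v}"
    then have "p - v \<in> cylinder I {\<lambda>i. 0}" by (auto simp: cylinder_def coords_diff fun_eq_iff)
    then show "p \<in> (+) v ` cylinder I {\<lambda>i. 0}" by (intro image_eqI[of _ _ "p - v"]) auto
  qed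
  finally show ?thesis by (intro bexI[of _ "coords I v"]) (simp_all add: coords_grid)
qed

lemma T_translate:
  assumes T: "T \<in> lin_bij" and u: "u \<in> grid I UNIV"
  shows "translate_of (T ` cylinder I {u}) (T ` cylinder I {\<lambda>i. 0})"
proof -
  define v where "v = (\<chi> i. u i)"
  have cv: "coords I v = u" unfolding v_def by (rule coords_surj[OF u])
  have "cylinder I {u} = (+) v ` cylinder I {\<lambda>i. 0}"
  proof (intro equalityI subsetI)
    fix p assume "p \<in> (+) v ` cylinder I {\<lambda>i. 0}"
    then show "p \<in> cylinder I {u}" by (auto simp: cylinder_def coords_add cv)
  next
    fix p assume p: "p \<in> cylinder I {u}"
    then have "p - v \<in> cylinder I {\<lambda>i. 0}" by (auto simp: cylinder_def coords_diff fun_eq_iff cv)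
    then show "p \<in> (+) v ` cylinder I {\<lambda>i. 0}" by (intro image_eqI[of _ _ "p - v"]) auto
  qed
  then have "T ` cylinder I {u} = (+) (T v) ` (T ` cylinder I {\<lambda>i. 0})"
    by (auto simp: image_image lin_bij_add[OF T])
  then show ?thesis unfolding translate_of_def by (rule exI)
qed

lemma inj_cylinder:
  assumes "T \<in> lin_bij"
  shows "inj_on (\<lambda>u. T ` cylinder I {u}) (grid I UNIV)"
proof (rule inj_onI)
  fix u v assume uv: "u \<in> grid I UNIV" "v \<in> grid I UNIV" "T ` cylinder I {u} = T ` cylinder I {v}"
  have "inj T" using assms by (simp add: lin_bij_def bij_def)
  then have "cylinder I {u} = cylinder I {v}" using uv(3) by (simp add: inj_image_eq_iff)
  moreover have "(\<chi> i. u i) \<in> cylinder I {u}" using coords_surj[OF uv(1)] by (simp add: cylinder_def)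
  ultimately show "u = v" using coords_surj[OF uv(1)] by (simp add: cylinder_def)
qed

text \<open>
Apply \<open>direction_weights\<close> in every coordinate system \<open>T\<close> and add up. A fixed direction \<open>S\<close> gives,
for random \<open>T\<close>, a uniformly distributed flag, so its weight is counted for at least a fraction
\<open>\<alpha>\<close> of all \<open>T\<close>. On the other side a random \<open>T\<close> makes a given member of \<open>B\<close> parallel to the image
of \<open>cylinder I {0}\<close> with probability one over the number of \<open>l\<close>-dimensional subspaces, and there are
at most \<open>q\<^sup>d\<close> flats for each of these subspaces.
\<close>
theorem averaged_bound:
  fixes B :: "('a::{field,finite} ^ 'n) set set" and \<alpha> \<gamma> :: real and l k m0 m1 N m :: nat
  defines "q \<equiv> CARD('a)" and "a \<equiv> k - l" and "d \<equiv> CARD('n) - l"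
  assumes lk: "l < k" "k < CARD('n)" and \<alpha>: "0 \<le> \<alpha>" and \<gamma>: "0 < \<gamma>"
    and B: "B \<subseteq> affine_flats l"
    and rich: "real (card {(W, U) \<in> containment_flags l k. rich_flag B (\<gamma> * real q ^ a) W U})
           \<ge> \<alpha> * real (card (containment_flags l k :: (('a ^ 'n) set \<times> ('a ^ 'n) set) set))"
    and I: "card (I :: 'n set) = d"
    and m01: "m0 \<le> m1" and N: "N < m * (q ^ a - q ^ (a - 1))"
    and big: "real (N * q ^ (a - 1) + (m - 1) * (q ^ a - q ^ (a - 1))) < real (q ^ a) * (m0 + \<gamma> * (real m1 - m0))"
  shows "\<alpha> * (real (card (exponents I N)) - real (q ^ d * jet_dim I m0))
      \<le> flat_density l B * q ^ d * (real (jet_dim I m1) - real (jet_dim I m0))"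
proof -
  have a: "a > 0" and ad: "a < card I" using lk I by (auto simp: a_def d_def)
  let ?W0 = "cylinder I {\<lambda>i. 0} :: ('a ^ 'n) set"
  let ?G = "lin_bij :: ('a ^ 'n \<Rightarrow> 'a ^ 'n) set"
  let ?F = "containment_flags l k :: (('a ^ 'n) set \<times> ('a ^ 'n) set) set"
  let ?L = "grassmannian l :: ('a ^ 'n) set set"
  define R where "R = {(W, U) \<in> ?F. rich_flag B (\<gamma> * real q ^ a) W U}"
  let ?act = "\<lambda>(T :: 'a ^ 'n \<Rightarrow> 'a ^ 'n) (W, U). (T ` W, T ` U)"
  have finG: "finite ?G" by simp
  have injG: "inj T" if "T \<in> ?G" for T using that by (simp add: lin_bij_def bij_def)
  have idG: "id \<in> ?G" by (simp add: lin_bij_def vec.linear_id)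
  have Gpos: "card ?G > 0" using idG finG by (auto simp: card_gt_0_iff)
  have W0: "?W0 \<in> ?L"
  proof -
    have "vec.subspace ?W0" "vec.dim ?W0 = CARD('n) - card I + 0"
      by (rule cylinder_subspace[where r = 0]; simp add: grid_def)+
    then show ?thesis using lk I by (simp add: grassmannian_def d_def)
  qed
  have flag: "(?W0, cylinder I S) \<in> ?F" if S: "S \<in> directions I a" for S
  proof -
    note dc = directions_closed[OF S]
    have U: "vec.subspace (cylinder I S)" "vec.dim (cylinder I S) = CARD('n) - card I + a"
      by (rule cylinder_subspace[OF dc(1-4) dc(5)[OF a]], assumption+)+
    then have dim: "vec.dim (cylinder I S) = k" using lk I by (simp add: a_def d_def)
    moreover have "?W0 \<subseteq> cylinder I S" using dc(2) by (auto simp: cylinder_def)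
    moreover have "?W0 \<noteq> cylinder I S" using dim W0 lk by (auto simp: grassmannian_def)
    ultimately show ?thesis using W0 U by (auto simp: containment_flags_def grassmannian_def)
  qed
  obtain w :: "('n \<Rightarrow> 'a) set \<Rightarrow> real" where w0: "\<And>S. w S \<ge> 0"
    and wtot: "real (card (exponents I N)) - real (q ^ card I * jet_dim I m0) \<le> (\<Sum>S\<in>directions I a. w S)"
    and wD: "\<And>E D. E \<subseteq> grid I UNIV \<Longrightarrow> D \<subseteq> directions I a \<Longrightarrow>
       (\<forall>S\<in>D. \<exists>u\<in>grid I UNIV. N * q ^ (a - 1) + (m - 1) * (q ^ a - q ^ (a - 1))
           < m0 * q ^ a + (m1 - m0) * card {x\<in>S. (\<lambda>i. u i + x i) \<in> E}) \<Longrightarrow>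
       (\<Sum>S\<in>D. w S) \<le> real (card E) * (real (jet_dim I m1) - real (jet_dim I m0))"
    using direction_weights[OF a ad m01 N[unfolded q_def]] unfolding q_def by blast
  define C where "C = real (jet_dim I m1) - real (jet_dim I m0)"
  have C0: "C \<ge> 0" using jet_dim_mono[OF m01, of I] by (simp add: C_def)
  let ?D = "\<lambda>T. {S\<in>directions I a. (T ` ?W0, T ` cylinder I S) \<in> R}"
  let ?B = "\<lambda>T. {A\<in>B. translate_of A (T ` ?W0)}"
  have each: "(\<Sum>S\<in>?D T. w S) \<le> real (card (?B T)) * C" if T: "T \<in> ?G" for T
  proof -
    define E where "E = {u \<in> grid I UNIV. T ` cylinder I {u} \<in> B}"
    have "(\<Sum>S\<in>?D T. w S) \<le> real (card E) * C"
      unfolding C_def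
    proof (rule wD)
      show "\<forall>S\<in>?D T. \<exists>u\<in>grid I UNIV. N * q ^ (a - 1) + (m - 1) * (q ^ a - q ^ (a - 1))
           < m0 * q ^ a + (m1 - m0) * card {x\<in>S. (\<lambda>i. u i + x i) \<in> E}"
      proof
        fix S assume S: "S \<in> ?D T"
        then have "rich_flag B (\<gamma> * real q ^ a) (T ` ?W0) (T ` cylinder I S)" by (auto simp: R_def)
        from rich_pullback[OF T _ this] S
        obtain u where u: "u \<in> grid I UNIV" "\<gamma> * real q ^ a \<le> real (card {x\<in>S. (\<lambda>i. u i + x i) \<in> E})"
          unfolding E_def by blast
        have "real (q ^ a) * (m0 + \<gamma> * (real m1 - m0)) = real (m0 * q ^ a) + real (m1 - m0) * (\<gamma> * real q ^ a)"
          using m01 by (simp add: of_nat_diff algebra_simps)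
        also have "\<dots> \<le> real (m0 * q ^ a) + real (m1 - m0) * real (card {x\<in>S. (\<lambda>i. u i + x i) \<in> E})"
          by (intro add_left_mono mult_left_mono u(2)) simp
        finally have "real (N * q ^ (a - 1) + (m - 1) * (q ^ a - q ^ (a - 1)))
            < real (m0 * q ^ a + (m1 - m0) * card {x\<in>S. (\<lambda>i. u i + x i) \<in> E})"
          using big by simp
        then have "N * q ^ (a - 1) + (m - 1) * (q ^ a - q ^ (a - 1))
            < m0 * q ^ a + (m1 - m0) * card {x\<in>S. (\<lambda>i. u i + x i) \<in> E}"
          by (simp only: of_nat_less_iff)
        then show "\<exists>u\<in>grid I UNIV. N * q ^ (a - 1) + (m - 1) * (q ^ a - q ^ (a - 1))
           < m0 * q ^ a + (m1 - m0) * card {x\<in>S. (\<lambda>i. u i + x i) \<in> E}"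
          by (rule bexI[OF _ u(1)])
      qed
    qed (auto simp: E_def)
    also have "real (card E) * C \<le> real (card (?B T)) * C"
    proof (intro mult_right_mono C0 of_nat_mono)
      show "card E \<le> card (?B T)"
    proof (rule card_inj_on_le)
      show "inj_on (\<lambda>u. T ` cylinder I {u}) E"
        by (rule inj_on_subset[OF inj_cylinder[OF T]]) (auto simp: E_def)
      show "(\<lambda>u. T ` cylinder I {u}) ` E \<subseteq> ?B T" using T_translate[OF T] by (auto simp: E_def)
      qed simp
    qed
    finally show ?thesis .
  qed
  have "(\<Sum>T\<in>?G. \<Sum>S\<in>?D T. w S) \<le> (\<Sum>T\<in>?G. real (card (?B T)) * C)" by (rule sum_mono[OF each])
  also have "\<dots> = real (\<Sum>T\<in>?G. card (?B T)) * C" by (simp add: sum_distrib_right)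
  finally have main: "(\<Sum>T\<in>?G. \<Sum>S\<in>?D T. w S) \<le> real (\<Sum>T\<in>?G. card (?B T)) * C" .
  have finD: "finite (directions I a :: ('n \<Rightarrow> 'a) set set)" by simp
  have "(\<Sum>T\<in>?G. \<Sum>S\<in>?D T. w S) = (\<Sum>T\<in>?G. \<Sum>S\<in>directions I a. if (T ` ?W0, T ` cylinder I S) \<in> R then w S else 0)"
    by (intro sum.cong refl sum.inter_filter finD)
  also have "\<dots> = (\<Sum>S\<in>directions I a. \<Sum>T\<in>?G. if (T ` ?W0, T ` cylinder I S) \<in> R then w S else 0)"
    by (rule sum.swap)
  also have "\<dots> = (\<Sum>S\<in>directions I a. real (card {T\<in>?G. (T ` ?W0, T ` cylinder I S) \<in> R}) * w S)"
    by (intro sum.cong refl) (simp add: sum.inter_filter[OF finG, symmetric])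
  finally have lhs: "(\<Sum>T\<in>?G. \<Sum>S\<in>?D T. w S) = (\<Sum>S\<in>directions I a. real (card {T\<in>?G. (T ` ?W0, T ` cylinder I S) \<in> R}) * w S)" .
  have cnt: "real (card {T\<in>?G. (T ` ?W0, T ` cylinder I S) \<in> R}) \<ge> \<alpha> * real (card ?G)" if S: "S \<in> directions I a" for S
  proof -
    have orb: "card {T\<in>?G. ?act T (?W0, cylinder I S) \<in> R} * card ?F = card ?G * card R"
    proof (rule card_orbit_uniform[OF finG lin_bij_comp injG])
      show "?act T (?W0, cylinder I S) \<in> ?F" if T: "T \<in> ?G" for T
      proof -
        have "T ` ?W0 \<subset> T ` cylinder I S"
          using flag[OF S] injG[OF T] by (auto simp: containment_flags_def psubset_eq inj_image_eq_iff inj_image_subset_iff)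
        then show ?thesis using flag[OF S] lin_bij_grassmannian[OF T] by (auto simp: containment_flags_def)
      qed
      show "\<exists>g\<in>?G. ?act g x = y" if xy: "x \<in> ?F" "y \<in> ?F" for x y
      proof -
        obtain W U W' U' where e: "x = (W, U)" "y = (W', U')" by (metis surj_pair)
        have "\<exists>T\<in>?G. T ` W = W' \<and> T ` U = U'"
          by (rule flag_transitive) (use xy e in \<open>auto simp: containment_flags_def grassmannian_def\<close>)
        then show ?thesis using e by auto
      qed
      show "R \<subseteq> ?F" by (auto simp: R_def)
      show "finite ?F" by simp
      show "?act (g \<circ> h) (?W0, cylinder I S) = ?act g (?act h (?W0, cylinder I S))" for g h
        by (simp add: image_comp)
    qed auto
    have Fpos: "card ?F > 0" using flag[OF S] by (auto simp: card_gt_0_iff)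
    have "\<alpha> * real (card ?G) * real (card ?F) \<le> real (card ?G) * real (card R)"
      using mult_left_mono[OF rich, of "real (card ?G)"] by (simp add: R_def mult_ac)
    also have "\<dots> = real (card {T\<in>?G. (T ` ?W0, T ` cylinder I S) \<in> R}) * real (card ?F)"
      using orb by (simp flip: of_nat_mult)
    finally show ?thesis using Fpos by simp
  qed
  have "\<alpha> * real (card ?G) * (\<Sum>S\<in>directions I a. w S) \<le> (\<Sum>S\<in>directions I a. real (card {T\<in>?G. (T ` ?W0, T ` cylinder I S) \<in> R}) * w S)"
    unfolding sum_distrib_left by (intro sum_mono mult_right_mono cnt w0)
  with main lhs have 1: "\<alpha> * real (card ?G) * (\<Sum>S\<in>directions I a. w S) \<le> real (\<Sum>T\<in>?G. card (?B T)) * C" by simp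
  have Lpos: "card ?L > 0" using W0 by (auto simp: card_gt_0_iff)
  have orbL: "card {T\<in>?G. T ` ?W0 \<in> {W}} * card ?L = card ?G" if W: "W \<in> ?L" for W
  proof -
    have "card {T\<in>?G. T ` ?W0 \<in> {W}} * card ?L = card ?G * card {W}"
    proof (rule card_orbit_uniform[where act = "\<lambda>T W. T ` W" and A = ?L, OF finG lin_bij_comp injG])
      show "T ` ?W0 \<in> ?L" if "T \<in> ?G" for T using lin_bij_grassmannian[OF that W0] .
      show "\<exists>g\<in>?G. g ` x = y" if xy: "x \<in> ?L" "y \<in> ?L" for x y
        using flag_transitive[of x y x y] xy by (auto simp: grassmannian_def)
      show "(g \<circ> h) ` ?W0 = g ` h ` ?W0" for g h :: "'a ^ 'n \<Rightarrow> 'a ^ 'n" by (simp add: image_comp)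
    qed (use W in auto)
    then show ?thesis by simp
  qed
  have "(\<Sum>T\<in>?G. card (?B T)) * card ?L \<le> card B * card ?G"
  proof -
    have "(\<Sum>T\<in>?G. card (?B T)) = (\<Sum>T\<in>?G. \<Sum>A\<in>B. if translate_of A (T ` ?W0) then 1 else 0)"
      by (intro sum.cong refl) (simp add: sum.inter_filter[symmetric])
    also have "\<dots> = (\<Sum>A\<in>B. \<Sum>T\<in>?G. if translate_of A (T ` ?W0) then 1 else 0)" by (rule sum.swap)
    also have "\<dots> = (\<Sum>A\<in>B. card {T\<in>?G. translate_of A (T ` ?W0)})"
      by (intro sum.cong refl) (simp add: sum.inter_filter[symmetric])
    finally have "(\<Sum>T\<in>?G. card (?B T)) * card ?L = (\<Sum>A\<in>B. card {T\<in>?G. translate_of A (T ` ?W0)} * card ?L)"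
      by (simp add: sum_distrib_right)
    also have "\<dots> \<le> (\<Sum>A\<in>B. card ?G)"
    proof (rule sum_mono)
      fix A assume "A \<in> B"
      then obtain W where W: "W \<in> ?L" "translate_of A W" using B by (auto simp: affine_flats_def)
      have "{T\<in>?G. translate_of A (T ` ?W0)} \<subseteq> {T\<in>?G. T ` ?W0 \<in> {W}}"
      proof
        fix T assume "T \<in> {T\<in>?G. translate_of A (T ` ?W0)}"
        then have T: "T \<in> ?G" "translate_of A (T ` ?W0)" by auto
        have "T ` ?W0 = W"
          by (rule translate_direction[OF _ _ T(2) W(2)])
             (use W(1) lin_bij_grassmannian[OF T(1) W0] in \<open>auto simp: grassmannian_def\<close>)
        then show "T \<in> {T\<in>?G. T ` ?W0 \<in> {W}}" using T(1) by simp
      qed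
      then have "card {T\<in>?G. translate_of A (T ` ?W0)} \<le> card {T\<in>?G. T ` ?W0 \<in> {W}}" by (rule card_mono[rotated]) simp
      then have "card {T\<in>?G. translate_of A (T ` ?W0)} * card ?L \<le> card {T\<in>?G. T ` ?W0 \<in> {W}} * card ?L"
        by (rule mult_le_mono1)
      then show "card {T\<in>?G. translate_of A (T ` ?W0)} * card ?L \<le> card ?G" unfolding orbL[OF W(1)] .
    qed
    finally show ?thesis by simp
  qed
  then have "real ((\<Sum>T\<in>?G. card (?B T)) * card ?L) \<le> real (card B * card ?G)"
    by (simp only: of_nat_le_iff)
  then have 2: "real (\<Sum>T\<in>?G. card (?B T)) * real (card ?L) \<le> real (card B) * real (card ?G)"
    by (simp only: of_nat_mult)
  have flats: "card (affine_flats l :: ('a ^ 'n) set set) \<le> card ?L * q ^ d"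
  proof -
    have "card {A. translate_of A W} \<le> q ^ d" if W: "W \<in> ?L" for W
    proof -
      obtain T where T: "T \<in> ?G" "T ` ?W0 = W"
        using flag_transitive[of ?W0 W ?W0 W] W W0 by (auto simp: grassmannian_def)
      have "{A. translate_of A W} \<subseteq> (\<lambda>u. T ` cylinder I {u}) ` grid I UNIV"
        using translate_T[OF T(1)] T(2) by blast
      then have "card {A. translate_of A W} \<le> card ((\<lambda>u. T ` cylinder I {u}) ` (grid I UNIV :: ('n \<Rightarrow> 'a) set))"
        by (rule card_mono[rotated]) simp
      also have "\<dots> \<le> card (grid I UNIV :: ('n \<Rightarrow> 'a) set)" by (rule card_image_le) simp
      also have "\<dots> = q ^ d" by (simp add: card_grid q_def I)
      finally show ?thesis .
    qed
    then have "(\<Sum>W\<in>?L. card {A. translate_of A W}) \<le> (\<Sum>W\<in>?L. q ^ d)" by (rule sum_mono)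
    moreover have "affine_flats l = (\<Union>W\<in>?L. {A. translate_of A W})" by (auto simp: affine_flats_def)
    moreover have "card (\<Union>W\<in>?L. {A. translate_of A W}) \<le> (\<Sum>W\<in>?L. card {A. translate_of A W})"
      by (rule card_UN_le) simp
    ultimately show ?thesis by simp
  qed
  have "?W0 \<in> affine_flats l"
  proof -
    have "?W0 = (+) 0 ` ?W0" by simp
    then show ?thesis using W0 unfolding affine_flats_def translate_of_def by blast
  qed
  then have AF: "card (affine_flats l :: ('a ^ 'n) set set) > 0" by (auto simp: card_gt_0_iff)
  have dens: "real (card B) \<le> flat_density l B * q ^ d * real (card ?L)"
  proof -
    have "real (card (affine_flats l :: ('a ^ 'n) set set)) \<le> real (card ?L * q ^ d)"
      using flats by (simp only: of_nat_le_iff)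
    then have "flat_density l B * real (card (affine_flats l :: ('a ^ 'n) set set)) \<le> flat_density l B * real (card ?L * q ^ d)"
      by (rule mult_left_mono) (simp add: flat_density_def)
    moreover have "flat_density l B * real (card (affine_flats l :: ('a ^ 'n) set set)) = real (card B)"
    proof -
      have "real (card (affine_flats l :: ('a ^ 'n) set set)) \<noteq> 0" using AF by linarith
      then show ?thesis unfolding flat_density_def by (rule nonzero_divide_eq_eq[THEN iffD1, OF _ refl, symmetric])
    qed
    ultimately show ?thesis by (simp add: mult_ac)
  qed
  have "\<alpha> * real (card ?G) * (\<Sum>S\<in>directions I a. w S) * real (card ?L) \<le> real (\<Sum>T\<in>?G. card (?B T)) * C * real (card ?L)"
    by (rule mult_right_mono[OF 1]) simp
  also have "\<dots> = real (\<Sum>T\<in>?G. card (?B T)) * real (card ?L) * C" by (simp only: mult_ac)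
  also have "\<dots> \<le> real (card B) * real (card ?G) * C" by (rule mult_right_mono[OF 2 C0])
  also have "\<dots> \<le> (flat_density l B * q ^ d * real (card ?L)) * real (card ?G) * C"
    by (intro mult_right_mono dens C0) simp
  finally have "(real (card ?G) * real (card ?L)) * (\<alpha> * (\<Sum>S\<in>directions I a. w S))
      \<le> (real (card ?G) * real (card ?L)) * (flat_density l B * q ^ d * C)" by (simp only: mult_ac)
  moreover have "real (card ?G) * real (card ?L) > 0" using Gpos Lpos by simp
  ultimately have 3: "\<alpha> * (\<Sum>S\<in>directions I a. w S) \<le> flat_density l B * q ^ d * C" by (simp only: mult_le_cancel_left_pos)
  have "\<alpha> * (real (card (exponents I N)) - real (q ^ d * jet_dim I m0)) \<le> \<alpha> * (\<Sum>S\<in>directions I a. w S)"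
    using wtot by (intro mult_left_mono \<alpha>) (simp add: I)
  with 3 show ?thesis by (simp add: C_def)
qed

section \<open>The density bound\<close>

theorem claim2p1:
  fixes B :: "('a::{field,finite} ^ 'n) set set"
    and q n l k a d :: nat and \<alpha> \<gamma> :: real
  assumes "q = CARD('a)" and "n = CARD('n)"
    and "1 \<le> l" and "l < k" and "k < n"
    and "0 \<le> \<alpha>" and "\<alpha> \<le> 1"
    and "0 < \<gamma>" and "\<gamma> \<le> 1"
    and "a = k - l" and "d = n - l"
    and "B \<subseteq> affine_flats l"
    and "real (card {(W, U) \<in> containment_flags l k. rich_flag B (\<gamma> * real q ^ a) W U})
           \<ge> \<alpha> * real (card (containment_flags l k :: (('a ^ 'n) set \<times> ('a ^ 'n) set) set))"
  shows "flat_density l B \<ge>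
    \<alpha> * (let x = (\<gamma> / (1 + real q powi (1 - int a))) ^ d;
             y = \<gamma> / 4 * exp (- (8 * real d / (\<gamma> * real q ^ (a - 1))))
         in if \<gamma> * real q ^ (a - 1) \<ge> 8 then max x y else x)"
proof -
  have a: "a > 0" and d: "d > 0" using assms by auto
  have q: "q > 1" using card_field_gt_1[where 'a='a] assms(1) by simp
  define e where "e = q ^ (a - 1)"
  have e: "e > 0" using q by (simp add: e_def)
  have Q: "q ^ a = q * e" using a by (simp add: e_def power_eq_if)
  have "d \<le> card (UNIV :: 'n set)" using assms by simp
  then obtain I :: "'n set" where I: "card I = d" by (rule obtain_subset_with_card_n)
  define p where "p = flat_density l B"
  have p: "p \<ge> 0" by (simp add: p_def flat_density_def)
  have H: "\<alpha> * ((real N + 1) ^ d - (q * (real m0 + d)) ^ d) \<le> p * q ^ d * ((real m1 + d) ^ d - real m0 ^ d)"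
    if m01: "m0 \<le> m1" and N: "N < m * (q * e - e)"
      and big: "real (N * e + (m - 1) * (q * e - e)) < real (q * e) * (m0 + \<gamma> * (real m1 - m0))" for m0 m1 N m :: nat
  proof -
    have av: "\<alpha> * (real (card (exponents I N)) - real (q ^ d * jet_dim I m0)) \<le> p * real q ^ d * (real (jet_dim I m1) - real (jet_dim I m0))"
      unfolding p_def assms(1,11) assms(2)
    proof (rule averaged_bound[where k = k and m = m])
      show "\<alpha> * real (card (containment_flags l k :: (('a ^ 'n) set \<times> ('a ^ 'n) set) set))
          \<le> real (card {(W, U) \<in> containment_flags l k. rich_flag B (\<gamma> * real CARD('a) ^ (k - l)) W U})"
        using assms(13) by (simp add: assms(1,10))
      show "N < m * (CARD('a) ^ (k - l) - CARD('a) ^ (k - l - 1))"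
        using N Q by (simp add: assms(1,10) e_def)
      show "real (N * CARD('a) ^ (k - l - 1) + (m - 1) * (CARD('a) ^ (k - l) - CARD('a) ^ (k - l - 1)))
          < real (CARD('a) ^ (k - l)) * (m0 + \<gamma> * (real m1 - m0))"
        using big Q by (simp add: assms(1,10) e_def)
      show "card I = CARD('n) - l" using I assms(2,11) by simp
    qed (use assms m01 in auto)
    let ?f = "fact d :: real"
    have f: "?f > 0" by simp
    have "(real N + 1) ^ d \<le> ?f * real (card (exponents I N))" using exponents_lower[of N I] by (simp add: I add.commute)
    moreover have "(q * (real m0 + d)) ^ d \<ge> ?f * real (q ^ d * jet_dim I m0)"
      using mult_left_mono[OF jet_dim_upper[of I m0], of "real q ^ d"] by (simp add: I power_mult_distrib mult_ac)
    ultimately have "(real N + 1) ^ d - (q * (real m0 + d)) ^ d \<le> ?f * (real (card (exponents I N)) - real (q ^ d * jet_dim I m0))"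
      by (simp add: right_diff_distrib)
    then have "\<alpha> * ((real N + 1) ^ d - (q * (real m0 + d)) ^ d) \<le> ?f * (\<alpha> * (real (card (exponents I N)) - real (q ^ d * jet_dim I m0)))"
      using mult_left_mono[OF _ assms(6)] by (simp only: mult.left_commute)
    also have "\<dots> \<le> ?f * (p * real q ^ d * (real (jet_dim I m1) - real (jet_dim I m0)))"
      by (rule mult_left_mono[OF av]) simp
    also have "\<dots> = p * real q ^ d * (?f * real (jet_dim I m1) - ?f * real (jet_dim I m0))"
      by (simp add: right_diff_distrib mult_ac)
    also have "\<dots> \<le> p * real q ^ d * ((real m1 + d) ^ d - real m0 ^ d)"
      using jet_dim_upper[of I m1] jet_dim_lower[of I m0] p d by (intro mult_left_mono diff_mono) (simp_all add: I)
    finally show ?thesis by simp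
  qed
  have L: "\<alpha> * (((\<mu>0 + \<gamma> * (\<mu>1 - \<mu>0)) / (1 + 1 / e)) ^ d - \<mu>0 ^ d) \<le> p * (\<mu>1 ^ d - \<mu>0 ^ d)"
    if "0 \<le> \<mu>0" "\<mu>0 \<le> \<mu>1" "0 < \<mu>1" for \<mu>0 \<mu>1 :: real
    by (rule multiplicity_limit[OF q e d assms(8,9) that H])
  note bounds = two_bounds[OF e d assms(8,9,6) p L]
  have "real q powi (1 - int a) = 1 / real e"
    using a q by (simp add: e_def power_int_def field_simps nat_diff_distrib)
  then have x: "\<alpha> * (\<gamma> / (1 + real q powi (1 - int a))) ^ d \<le> p" using bounds(1) by simp
  have y: "\<alpha> * (\<gamma> / 4 * exp (- (8 * real d / (\<gamma> * real q ^ (a - 1))))) \<le> p"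
    using bounds(2) by (simp add: e_def)
  show ?thesis using x y by (simp add: Let_def p_def max_def)
qed

end
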